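(* Consider one of the Cases A, B, C described in the context. Let $\chi\in C^2(\overline\Omega)$ with $\chi<0$ on $\partial\Omega$, let $f\in\mathcal V'$, and let $u\in\mathcal K$ be the unique solution of $$\mathcal A(u,u-v)\le\langle f,u-v\rangle_{\mathcal V',\mathcal V}\qquad\forall v\in\mathcal K .$$ Let $\Lambda:=\iota Lu+\boldsymbol\beta\cdot\nabla u+(-\Delta)^s\widetilde u-f\in\mathcal V'$, i.e. $\langle\Lambda,v\rangle_{\mathcal V',\mathcal V}=\mathcal A(u,v)-\langle f,v\rangle_{\mathcal V',\mathcal V}$ for all $v\in\mathcal V$. Then $\Lambda\ge0$ in $\mathcal V'$. In addition, if $u\in\mathcal V\cap C(\overline\Omega)$, then the complementarity conditions $$\Lambda\ge0,\qquad u\ge\chi,\qquad \Lambda(u-\chi)=0$$ hold in the sense of distributions in $\Omega$.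
   Context: Spaces: $d\in\{1,2,3\}$ and $\Omega\subset\mathbb R^d$ is a bounded domain with Lipschitz boundary. $\|w\|_{H^t(\mathbb R^d)}^2=\int_{\mathbb R^d}(1+|\xi|^{2t})|\mathcal F(w)(\xi)|^2\,d\xi$ with $\mathcal F$ the Fourier transform. $\widetilde w$ denotes the extension by zero of $w$ to $\mathbb R^d$. For $t\in[0,2]$, $\widetilde H^t(\Omega)=\{w\in L^2(\Omega):\widetilde w\in H^t(\mathbb R^d)\}$ with norm $\|\widetilde w\|_{H^t(\mathbb R^d)}$; $\|w\|_{H^1_0(\Omega)}=\|\nabla w\|_{L^2(\Omega)}$. Operators: $A\in C^{0,1}(\overline\Omega)$ takes values in symmetric $d\times d$ matrices, with $a_0|v|^2\le v^TA(x)v\le a_1|v|^2$ for all $v\in\mathbb R^d$, $x\in\overline\Omega$ ($a_0,a_1>0$ constants); $c\in C^{0,1}(\overline\Omega)$, $c\ge0$; $Lw=-\nabla\cdot(A\nabla w)+cw$; $\mathcal L(v,w)=\int_\Omega(\nabla w^TA\nabla v+cvw)\,dx$. $\boldsymbol\beta\in C^1(\overline\Omega,\mathbb R^d)$ with $\nabla\cdot\boldsymbol\beta=0$; $\mathcal D(v,w)=\int_\Omega(\boldsymbol\beta\cdot\nabla v)\,w\,dx$ for $v,w\in C_0^\infty(\Omega)$, extended by continuity to $\mathcal V\times\mathcal V$ ($\mathcal V$ below). For $s\in(0,1)$, $(-\Delta)^s$ is the integral fractional Laplacian on $\mathbb R^d$, $\mathcal F((-\Delta)^sw)(\xi)=|\xi|^{2s}\mathcal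 F(w)(\xi)$, and $a_s(v,w)=\int_{\mathbb R^d}|\xi|^{2s}\mathcal F(\widetilde v)\overline{\mathcal F(\widetilde w)}\,d\xi$. Cases ($\iota\in\{0,1\}$): A: $\iota=0$, $\boldsymbol\beta=\mathbf 0$, $s\in(0,1)$. B: $\iota=0$, $\boldsymbol\beta\ne\mathbf 0$, $s\in[\tfrac12,1)$. C: $\iota=1$, $s\in(0,1)$. $\mathcal V=\widetilde H^s(\Omega)$ if $\iota=0$, $\mathcal V=H^1_0(\Omega)$ if $\iota=1$, with $\|w\|_{\mathcal V}^2=\|w\|_{\widetilde H^s(\Omega)}^2+\iota\|w\|_{H^1_0(\Omega)}^2$. $\mathcal A(v,w)=\iota\mathcal L(v,w)+\mathcal D(v,w)+a_s(v,w)$ on $\mathcal V$ (bounded and coercive). $\mathcal K=\{w\in\mathcal V: w\ge\chi\text{ a.e. in }\Omega\}$. Meaning of the conclusions: $\Lambda\ge0$ in $\mathcal V'$ means $\langle\Lambda,\varphi\rangle_{\mathcal V',\mathcal V}\ge0$ for all nonnegative $\varphi\in\mathcal V$; as a distribution, for all nonnegative $\varphi\in C_0^\infty(\Omega)$. A nonnegative distribution is a positive Radon measure on $\Omega$, so that for continuous $u-\chi$ the product $\Lambda(u-\chi)$ is a well-defined Radon measure; $\Lambda(u-\chi)=0$ means it vanishes, equivalently $\langle\Lambda,\phi\rangle=0$ for all $\phi\in C_0^\infty(N)$ with $N=\{x\in\Omega:u(x)>\chi(x)\}$. *)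

theory Defs
  imports "HOL-Analysis.Analysis"
begin

section \<open>Classical function spaces\<close>

definition partial_deriv :: "'n::finite \<Rightarrow> (real^'n \<Rightarrow> real) \<Rightarrow> real^'n \<Rightarrow> real" where
  "partial_deriv i g x = frechet_derivative g (at x) (axis i 1)"

definition gradient :: "(real^'n::finite \<Rightarrow> real) \<Rightarrow> real^'n \<Rightarrow> real^'n" where
  "gradient g x = (\<chi> i. partial_deriv i g x)"

(* C^k on an open set. *)
primrec Ck_on :: "nat \<Rightarrow> (real^'n::finite) set \<Rightarrow> (real^'n \<Rightarrow> real) \<Rightarrow> bool" where
  "Ck_on 0 S g \<longleftrightarrow> continuous_on S g"
| "Ck_on (Suc k) S g \<longleftrightarrow>
     (\<forall>x\<in>S. g differentiable (at x)) \<and> (\<forall>i. Ck_on k S (partial_deriv i g))"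

(* C^k up to the boundary of an open set S: all partial derivatives of order at most k exist
   in S and extend continuously to the closure of S. *)
primrec Ck_closure :: "nat \<Rightarrow> (real^'n::finite) set \<Rightarrow> (real^'n \<Rightarrow> real) \<Rightarrow> bool" where
  "Ck_closure 0 S g \<longleftrightarrow> continuous_on (closure S) g"
| "Ck_closure (Suc k) S g \<longleftrightarrow>
     continuous_on (closure S) g \<and> (\<forall>x\<in>S. g differentiable (at x)) \<and>
     (\<forall>i. \<exists>h. Ck_closure k S h \<and> (\<forall>x\<in>S. h x = partial_deriv i g x))"

definition test_functions :: "(real^'n::finite) set \<Rightarrow> (real^'n \<Rightarrow> real) set" where
  "test_functions \<Omega> = {\<phi>. (\<forall>k. Ck_on k UNIV \<phi>) \<and>
     compact (closure {x. \<phi> x \<noteq> 0}) \<and> closure {x. \<phi> x \<noteq> 0} \<subseteq> \<Omega>}"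

(* Near each boundary point the domain is, for a suitable unit direction e, the strict epigraph
   of a Lipschitz function on the hyperplane orthogonal to e.  In dimension one that hyperplane
   is {0}, and the domain is locally a half-line. *)
definition lipschitz_boundary :: "(real^'n::finite) set \<Rightarrow> bool" where
  "lipschitz_boundary \<Omega> \<longleftrightarrow>
     (\<forall>p\<in>frontier \<Omega>. \<exists>r>0. \<exists>e \<gamma> M. norm e = 1 \<and> M-lipschitz_on {y. y \<bullet> e = 0} \<gamma> \<and>
        (\<forall>x\<in>ball p r. x \<in> \<Omega> \<longleftrightarrow> \<gamma> (x - (x \<bullet> e) *\<^sub>R e) < x \<bullet> e))"

definition bounded_lipschitz_domain :: "(real^'n::finite) set \<Rightarrow> bool" where
  "bounded_lipschitz_domain \<Omega> \<longleftrightarrow>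
     open \<Omega> \<and> connected \<Omega> \<and> \<Omega> \<noteq> {} \<and> bounded \<Omega> \<and> lipschitz_boundary \<Omega>"

section \<open>Sobolev spaces\<close>

(* Elements of the function spaces on an open set are represented by functions on the whole space
   whose values outside the set are irrelevant; equality almost everywhere is not quotiented out. *)

definition L2 :: "(real^'n::finite) set \<Rightarrow> (real^'n \<Rightarrow> real) set" where
  "L2 \<Omega> = {w \<in> borel_measurable (lebesgue_on \<Omega>). integrable (lebesgue_on \<Omega>) (\<lambda>x. (w x)\<^sup>2)}"

definition zero_extension :: "(real^'n::finite) set \<Rightarrow> (real^'n \<Rightarrow> real) \<Rightarrow> real^'n \<Rightarrow> real" where
  "zero_extension \<Omega> w x = (if x \<in> \<Omega> then w x else 0)"

(* Unitary Fourier transform, as a Lebesgue integral.  It is only applied to zero extensions of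
   L2 functions on a bounded set; these are integrable, so the integral is the L2 transform. *)
definition fourier :: "(real^'n::finite \<Rightarrow> real) \<Rightarrow> real^'n \<Rightarrow> complex" where
  "fourier w \<xi> = complex_of_real ((2 * pi) powr (- real CARD('n) / 2)) *
     (LINT x|lebesgue. complex_of_real (w x) * cis (- (\<xi> \<bullet> x)))"

definition Ht_norm :: "real \<Rightarrow> (real^'n::finite \<Rightarrow> real) \<Rightarrow> real" where
  "Ht_norm t w = sqrt (LINT \<xi>|lebesgue. (1 + norm \<xi> powr (2 * t)) * (cmod (fourier w \<xi>))\<^sup>2)"

definition Ht_tilde :: "real \<Rightarrow> (real^'n::finite) set \<Rightarrow> (real^'n \<Rightarrow> real) set" where
  "Ht_tilde t \<Omega> = {w \<in> L2 \<Omega>. integrable lebesgue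
     (\<lambda>\<xi>. (1 + norm \<xi> powr (2 * t)) * (cmod (fourier (zero_extension \<Omega> w) \<xi>))\<^sup>2)}"

definition has_weak_gradient ::
  "(real^'n::finite) set \<Rightarrow> (real^'n \<Rightarrow> real) \<Rightarrow> (real^'n \<Rightarrow> real^'n) \<Rightarrow> bool" where
  "has_weak_gradient \<Omega> w g \<longleftrightarrow>
     (\<forall>i. (\<lambda>x. g x $ i) \<in> L2 \<Omega>) \<and>
     (\<forall>\<phi>\<in>test_functions \<Omega>. \<forall>i.
        (LINT x|lebesgue_on \<Omega>. w x * partial_deriv i \<phi> x) =
        - (LINT x|lebesgue_on \<Omega>. g x $ i * \<phi> x))"

definition H1 :: "(real^'n::finite) set \<Rightarrow> (real^'n \<Rightarrow> real) set" where
  "H1 \<Omega> = {w \<in> L2 \<Omega>. \<exists>g. has_weak_gradient \<Omega> w g}"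

(* A weak gradient is determined up to a null set of the domain. *)
definition weak_gradient ::
  "(real^'n::finite) set \<Rightarrow> (real^'n \<Rightarrow> real) \<Rightarrow> real^'n \<Rightarrow> real^'n" where
  "weak_gradient \<Omega> w = (SOME g. has_weak_gradient \<Omega> w g)"

definition H10_norm :: "(real^'n::finite) set \<Rightarrow> (real^'n \<Rightarrow> real) \<Rightarrow> real" where
  "H10_norm \<Omega> w = sqrt (LINT x|lebesgue_on \<Omega>. (norm (weak_gradient \<Omega> w x))\<^sup>2)"

definition H1_norm :: "(real^'n::finite) set \<Rightarrow> (real^'n \<Rightarrow> real) \<Rightarrow> real" where
  "H1_norm \<Omega> w = sqrt ((LINT x|lebesgue_on \<Omega>. (w x)\<^sup>2) + (H10_norm \<Omega> w)\<^sup>2)"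

definition H10 :: "(real^'n::finite) set \<Rightarrow> (real^'n \<Rightarrow> real) set" where
  "H10 \<Omega> = {w \<in> H1 \<Omega>. \<exists>\<phi>. (\<forall>k::nat. \<phi> k \<in> test_functions \<Omega>) \<and>
     (\<lambda>k. H1_norm \<Omega> (\<lambda>x. w x - \<phi> k x)) \<longlonglongrightarrow> 0}"

definition V_space :: "nat \<Rightarrow> real \<Rightarrow> (real^'n::finite) set \<Rightarrow> (real^'n \<Rightarrow> real) set" where
  "V_space \<iota> s \<Omega> = (if \<iota> = 0 then Ht_tilde s \<Omega> else H10 \<Omega>)"

definition V_norm :: "nat \<Rightarrow> real \<Rightarrow> (real^'n::finite) set \<Rightarrow> (real^'n \<Rightarrow> real) \<Rightarrow> real" where
  "V_norm \<iota> s \<Omega> w =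
     sqrt ((Ht_norm s (zero_extension \<Omega> w))\<^sup>2 + real \<iota> * (H10_norm \<Omega> w)\<^sup>2)"

definition linear_on_space ::
  "(real^'n::finite \<Rightarrow> real) set \<Rightarrow> ((real^'n \<Rightarrow> real) \<Rightarrow> real) \<Rightarrow> bool" where
  "linear_on_space V F \<longleftrightarrow>
     (\<forall>v\<in>V. \<forall>w\<in>V. F (\<lambda>x. v x + w x) = F v + F w) \<and>
     (\<forall>a. \<forall>v\<in>V. F (\<lambda>x. a * v x) = a * F v)"

(* Boundedness forces a functional in the dual to agree on functions that coincide almost
   everywhere in the domain. *)
definition V_dual ::
  "nat \<Rightarrow> real \<Rightarrow> (real^'n::finite) set \<Rightarrow> ((real^'n \<Rightarrow> real) \<Rightarrow> real) set" where
  "V_dual \<iota> s \<Omega> = {F. linear_on_space (V_space \<iota> s \<Omega>) F \<and>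
     (\<exists>C. \<forall>v\<in>V_space \<iota> s \<Omega>. \<bar>F v\<bar> \<le> C * V_norm \<iota> s \<Omega> v)}"

section \<open>Bilinear forms\<close>

definition admissible_diffusion ::
  "(real^'n::finite) set \<Rightarrow> real \<Rightarrow> real \<Rightarrow> (real^'n \<Rightarrow> real^'n^'n) \<Rightarrow> bool" where
  "admissible_diffusion \<Omega> a0 a1 A \<longleftrightarrow>
     a0 > 0 \<and> a1 > 0 \<and> (\<exists>M. M-lipschitz_on (closure \<Omega>) A) \<and>
     (\<forall>x\<in>closure \<Omega>. transpose (A x) = A x \<and>
        (\<forall>v. a0 * (norm v)\<^sup>2 \<le> v \<bullet> (A x *v v) \<and> v \<bullet> (A x *v v) \<le> a1 * (norm v)\<^sup>2))"

definition admissible_reaction :: "(real^'n::finite) set \<Rightarrow> (real^'n \<Rightarrow> real) \<Rightarrow> bool" where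
  "admissible_reaction \<Omega> c \<longleftrightarrow>
     (\<exists>M. M-lipschitz_on (closure \<Omega>) c) \<and> (\<forall>x\<in>closure \<Omega>. 0 \<le> c x)"

definition admissible_convection :: "(real^'n::finite) set \<Rightarrow> (real^'n \<Rightarrow> real^'n) \<Rightarrow> bool" where
  "admissible_convection \<Omega> \<beta> \<longleftrightarrow>
     (\<forall>i. Ck_closure 1 \<Omega> (\<lambda>x. \<beta> x $ i)) \<and>
     (\<forall>x\<in>\<Omega>. (\<Sum>i\<in>UNIV. partial_deriv i (\<lambda>y. \<beta> y $ i) x) = 0)"

definition L_form :: "(real^'n::finite) set \<Rightarrow> (real^'n \<Rightarrow> real^'n^'n) \<Rightarrow> (real^'n \<Rightarrow> real) \<Rightarrow>
    (real^'n \<Rightarrow> real) \<Rightarrow> (real^'n \<Rightarrow> real) \<Rightarrow> real" where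
  "L_form \<Omega> A c v w =
     (LINT x|lebesgue_on \<Omega>. weak_gradient \<Omega> w x \<bullet> (A x *v weak_gradient \<Omega> v x) + c x * v x * w x)"

(* For real-valued arguments the integral is real. *)
definition frac_form ::
  "real \<Rightarrow> (real^'n::finite) set \<Rightarrow> (real^'n \<Rightarrow> real) \<Rightarrow> (real^'n \<Rightarrow> real) \<Rightarrow> real" where
  "frac_form s \<Omega> v w = Re (LINT \<xi>|lebesgue. complex_of_real (norm \<xi> powr (2 * s)) *
     fourier (zero_extension \<Omega> v) \<xi> * cnj (fourier (zero_extension \<Omega> w) \<xi>))"

(* D is the continuous extension to V x V of the form (v, w) |-> integral of (beta . grad v) w on
   test functions: a bounded bilinear form on V x V with these values.  Test functions are dense
   in V, so D is determined on V x V. *)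
definition convection_form :: "nat \<Rightarrow> real \<Rightarrow> (real^'n::finite) set \<Rightarrow> (real^'n \<Rightarrow> real^'n) \<Rightarrow>
    ((real^'n \<Rightarrow> real) \<Rightarrow> (real^'n \<Rightarrow> real) \<Rightarrow> real) \<Rightarrow> bool" where
  "convection_form \<iota> s \<Omega> \<beta> D \<longleftrightarrow>
     (\<forall>v\<in>test_functions \<Omega>. \<forall>w\<in>test_functions \<Omega>.
        D v w = (LINT x|lebesgue_on \<Omega>. (\<beta> x \<bullet> gradient v x) * w x)) \<and>
     (\<forall>v\<in>V_space \<iota> s \<Omega>. linear_on_space (V_space \<iota> s \<Omega>) (\<lambda>w. D v w)) \<and>
     (\<forall>w\<in>V_space \<iota> s \<Omega>. linear_on_space (V_space \<iota> s \<Omega>) (\<lambda>v. D v w)) \<and>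
     (\<exists>C. \<forall>v\<in>V_space \<iota> s \<Omega>. \<forall>w\<in>V_space \<iota> s \<Omega>.
        \<bar>D v w\<bar> \<le> C * V_norm \<iota> s \<Omega> v * V_norm \<iota> s \<Omega> w)"

definition A_form :: "nat \<Rightarrow> real \<Rightarrow> (real^'n::finite) set \<Rightarrow> (real^'n \<Rightarrow> real^'n^'n) \<Rightarrow>
    (real^'n \<Rightarrow> real) \<Rightarrow> ((real^'n \<Rightarrow> real) \<Rightarrow> (real^'n \<Rightarrow> real) \<Rightarrow> real) \<Rightarrow>
    (real^'n \<Rightarrow> real) \<Rightarrow> (real^'n \<Rightarrow> real) \<Rightarrow> real" where
  "A_form \<iota> s \<Omega> A c D v w = real \<iota> * L_form \<Omega> A c v w + D v w + frac_form s \<Omega> v w"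

definition case_A :: "nat \<Rightarrow> real \<Rightarrow> (real^'n::finite) set \<Rightarrow> (real^'n \<Rightarrow> real^'n) \<Rightarrow> bool" where
  "case_A \<iota> s \<Omega> \<beta> \<longleftrightarrow> \<iota> = 0 \<and> (\<forall>x\<in>closure \<Omega>. \<beta> x = 0) \<and> 0 < s \<and> s < 1"

definition case_B :: "nat \<Rightarrow> real \<Rightarrow> (real^'n::finite) set \<Rightarrow> (real^'n \<Rightarrow> real^'n) \<Rightarrow> bool" where
  "case_B \<iota> s \<Omega> \<beta> \<longleftrightarrow> \<iota> = 0 \<and> (\<exists>x\<in>closure \<Omega>. \<beta> x \<noteq> 0) \<and> 1 / 2 \<le> s \<and> s < 1"

definition case_C :: "nat \<Rightarrow> real \<Rightarrow> bool" where
  "case_C \<iota> s \<longleftrightarrow> \<iota> = 1 \<and> 0 < s \<and> s < 1"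

section \<open>Obstacle problem and complementarity\<close>

definition K_set ::
  "nat \<Rightarrow> real \<Rightarrow> (real^'n::finite) set \<Rightarrow> (real^'n \<Rightarrow> real) \<Rightarrow> (real^'n \<Rightarrow> real) set" where
  "K_set \<iota> s \<Omega> obst = {w \<in> V_space \<iota> s \<Omega>. AE x in lebesgue_on \<Omega>. obst x \<le> w x}"

definition nonneg_in_dual ::
  "nat \<Rightarrow> real \<Rightarrow> (real^'n::finite) set \<Rightarrow> ((real^'n \<Rightarrow> real) \<Rightarrow> real) \<Rightarrow> bool" where
  "nonneg_in_dual \<iota> s \<Omega> T \<longleftrightarrow>
     (\<forall>\<phi>\<in>V_space \<iota> s \<Omega>. (AE x in lebesgue_on \<Omega>. 0 \<le> \<phi> x) \<longrightarrow> 0 \<le> T \<phi>)"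

definition nonneg_distribution ::
  "(real^'n::finite) set \<Rightarrow> ((real^'n \<Rightarrow> real) \<Rightarrow> real) \<Rightarrow> bool" where
  "nonneg_distribution \<Omega> T \<longleftrightarrow>
     (\<forall>\<phi>\<in>test_functions \<Omega>. (\<forall>x. 0 \<le> \<phi> x) \<longrightarrow> 0 \<le> T \<phi>)"

definition regular_distribution ::
  "(real^'n::finite) set \<Rightarrow> (real^'n \<Rightarrow> real) \<Rightarrow> (real^'n \<Rightarrow> real) \<Rightarrow> real" where
  "regular_distribution \<Omega> g \<phi> = (LINT x|lebesgue_on \<Omega>. g x * \<phi> x)"

definition radon_measure_on :: "(real^'n::finite) set \<Rightarrow> (real^'n) measure \<Rightarrow> bool" where
  "radon_measure_on \<Omega> \<mu> \<longleftrightarrow> sets \<mu> = sets (restrict_space borel \<Omega>) \<and>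
     (\<forall>K. compact K \<and> K \<subseteq> \<Omega> \<longrightarrow> emeasure \<mu> K < \<infinity>)"

(* T is a positive Radon measure mu on the domain (such a mu is unique), and the signed Radon
   measure g mu vanishes; g is meant to be continuous on the domain. *)
definition product_vanishes ::
  "(real^'n::finite) set \<Rightarrow> ((real^'n \<Rightarrow> real) \<Rightarrow> real) \<Rightarrow> (real^'n \<Rightarrow> real) \<Rightarrow> bool" where
  "product_vanishes \<Omega> T g \<longleftrightarrow>
     (\<exists>\<mu>. radon_measure_on \<Omega> \<mu> \<and>
        (\<forall>\<phi>\<in>test_functions \<Omega>. T \<phi> = (LINT x|\<mu>. \<phi> x)) \<and>
        (\<forall>\<phi>\<in>test_functions \<Omega>. (LINT x|\<mu>. g x * \<phi> x) = 0))"

end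

theory Submission
  imports Defs "HOL-Probability.Probability"
begin

text \<open>Testing the variational inequality with \<open>u + \<phi>\<close> gives positivity of \<open>\<Lambda>\<close>, and testing it with
  \<open>u - t \<eta>\<close>, where \<open>\<eta> \<ge> 0\<close> is supported where \<open>u\<close> exceeds the obstacle and \<open>t > 0\<close> is
  small, gives \<open>\<Lambda> \<eta> = 0\<close>. The Radon measure representing \<open>\<Lambda>\<close> is the upper integral
  \<open>inf (\<Sum>k. \<Lambda> \<phi>\<^sub>k)\<close> over all sequences of nonnegative test functions with \<open>f \<le> (\<Sum>k. \<phi>\<^sub>k)\<close>.

  That \<open>\<Lambda>\<close> lies in the dual requires linearity of the forms on the energy space: weak gradients are
  unique almost everywhere, and \<open>H10\<close> embeds into \<open>Ht_tilde s\<close> because the Fourier transform of a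
  square-integrable function is square-integrable and turns \<open>\<partial>\<^sub>i\<close> into multiplication by
  \<open>\<i> \<xi>\<^sub>i\<close>. Poincare's inequality bounds the reaction term.\<close>

section \<open>Smooth functions\<close>

text \<open>One device serves both the measure and the fundamental lemma. The smooth functions
  \<open>flat (m * (x \<bullet> b - a))\<close> increase with m to the indicator of an open
  half-space, half-spaces generate the Borel sets, and a smooth factor can be absorbed into a test
  function. This takes the place of truncation and of mollification. The product condition speaks of
  a measure, which may charge Lebesgue null sets. Hence the obstacle inequality has to hold at every
  point of the domain, and the set where u exceeds the obstacle has to be null for the representing
  measure, not only invisible to the functional. For the embedding of \<open>H10\<close> only
  finiteness of the integral of the squared transform matters. A one-sided Plancherel estimate gives
  it: a Gaussian weight makes Fubini's theorem applicable, and Fatou's lemma removes the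
  weight.\<close>

definition smooth :: "(real^'n::finite \<Rightarrow> real) \<Rightarrow> bool" where
  "smooth g \<longleftrightarrow> (\<forall>k. Ck_on k UNIV g)"

lemma partial_deriv_eq:
  "(g has_derivative g') (at x) \<Longrightarrow> partial_deriv i g x = g' (axis i 1)"
  by (simp add: partial_deriv_def frechet_derivative_at[symmetric])

lemma differentiable_imp_frechet:
  "g differentiable (at x) \<Longrightarrow> (g has_derivative frechet_derivative g (at x)) (at x)"
  by (simp add: frechet_derivative_works)

lemma partial_deriv_add:
  assumes "f differentiable (at x)" "g differentiable (at x)"
  shows "partial_deriv i (\<lambda>x. f x + g x) x = partial_deriv i f x + partial_deriv i g x"
  using partial_deriv_eq[OF has_derivative_add[OF assms[THEN differentiable_imp_frechet]], of i]
  by (simp add: partial_deriv_def)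

lemma partial_deriv_mult:
  assumes "f differentiable (at x)" "g differentiable (at x)"
  shows "partial_deriv i (\<lambda>x. f x * g x) x = partial_deriv i f x * g x + f x * partial_deriv i g x"
  using partial_deriv_eq[OF has_derivative_mult[OF assms[THEN differentiable_imp_frechet]], of i]
  by (simp add: partial_deriv_def)

lemma partial_deriv_const: "partial_deriv i (\<lambda>x. c) x = 0"
  using partial_deriv_eq[OF has_derivative_const, of i c x] by simp

lemma partial_deriv_inner: "partial_deriv i (\<lambda>x. x \<bullet> v) x = v $ i"
proof -
  have "((\<lambda>x. x \<bullet> v) has_derivative (\<lambda>h. h \<bullet> v)) (at x)"
    by (auto intro!: derivative_eq_intros)
  from partial_deriv_eq[OF this, of i] show ?thesis
    by (simp add: inner_axis')
qed

lemma has_derivative_compose_real: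
  assumes "(F has_real_derivative F') (at (g x))" "g differentiable (at x)"
  shows "((\<lambda>x. F (g x)) has_derivative (\<lambda>h. F' * frechet_derivative g (at x) h)) (at x)"
  using has_derivative_compose[OF differentiable_imp_frechet[OF assms(2)], of F "\<lambda>h. F' * h"] assms(1)
  by (simp add: has_field_derivative_def)

lemma partial_deriv_compose:
  assumes "(F has_real_derivative F') (at (g x))" "g differentiable (at x)"
  shows "partial_deriv i (\<lambda>x. F (g x)) x = F' * partial_deriv i g x"
  using partial_deriv_eq[OF has_derivative_compose_real[OF assms], of i]
  by (simp add: partial_deriv_def)

text \<open>The recursion puts continuity only at order 0, so the classes are not nested by
  definition; differentiability supplies the missing continuity at the bottom.\<close>

lemma Ck_on_Suc_imp: "Ck_on (Suc k) UNIV g \<Longrightarrow> Ck_on k UNIV g"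
proof (induction k arbitrary: g)
  case 0
  then have "\<forall>x. isCont g x" by (auto dest: differentiable_imp_continuous_within)
  then show ?case by (simp add: continuous_on_eq_continuous_at)
next
  case (Suc k)
  then show ?case by (metis Ck_on.simps(2))
qed

lemma Ck_on_const: "Ck_on k UNIV (\<lambda>x. c)"
proof (induction k arbitrary: c)
  case (Suc k)
  have "partial_deriv i (\<lambda>x. c) = (\<lambda>x. 0)" for i :: 'a
    by (auto simp: partial_deriv_const)
  then show ?case using Suc by simp
qed simp

lemma Ck_on_add:
  "Ck_on k UNIV f \<Longrightarrow> Ck_on k UNIV g \<Longrightarrow> Ck_on k UNIV (\<lambda>x. f x + g x)"
proof (induction k arbitrary: f g)
  case 0
  then show ?case by (auto intro: continuous_on_add)
next
  case (Suc k)
  then have "partial_deriv i (\<lambda>x. f x + g x) = (\<lambda>x. partial_deriv i f x + partial_deriv i g x)" for i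
    by (auto simp: partial_deriv_add)
  then show ?case using Suc by simp
qed

lemma Ck_on_mult:
  "Ck_on k UNIV f \<Longrightarrow> Ck_on k UNIV g \<Longrightarrow> Ck_on k UNIV (\<lambda>x. f x * g x)"
proof (induction k arbitrary: f g)
  case 0
  then show ?case by (auto intro: continuous_on_mult)
next
  case (Suc k)
  then have "partial_deriv i (\<lambda>x. f x * g x) =
      (\<lambda>x. partial_deriv i f x * g x + f x * partial_deriv i g x)" for i
    by (auto simp: partial_deriv_mult)
  moreover have "Ck_on k UNIV f" "Ck_on k UNIV g"
    using Suc.prems Ck_on_Suc_imp by blast+
  ultimately show ?case using Suc by (simp add: Ck_on_add)
qed

text \<open>The chain rule turns \<open>F j\<close> into \<open>F (Suc j)\<close>, so a whole chain
  of successive derivatives is carried along and the induction runs over all j at once.\<close>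

lemma Ck_on_compose:
  assumes F: "\<And>k t. (F k has_real_derivative F (Suc k) t) (at t)"
  shows "Ck_on k UNIV g \<Longrightarrow> Ck_on k UNIV (\<lambda>x. F j (g x))"
proof (induction k arbitrary: j)
  case 0
  have "continuous_on UNIV (F j)"
    by (meson DERIV_continuous_on F has_field_derivative_at_within)
  with 0 show ?case by (auto intro: continuous_on_compose2)
next
  case (Suc k)
  have "partial_deriv i (\<lambda>x. F j (g x)) = (\<lambda>x. F (Suc j) (g x) * partial_deriv i g x)" for i
    using Suc.prems by (auto simp: partial_deriv_compose[OF F])
  moreover have "(\<lambda>x. F j (g x)) differentiable (at x)" for x
    using has_derivative_compose_real[OF F, of g x] Suc.prems by (auto simp: differentiable_def)
  moreover have "Ck_on k UNIV g" using Suc.prems Ck_on_Suc_imp by blast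
  ultimately show ?case using Suc by (auto intro!: Ck_on_mult)
qed

lemma smooth_const: "smooth (\<lambda>x. c)"
  by (simp add: smooth_def Ck_on_const)

lemma smooth_add: "smooth f \<Longrightarrow> smooth g \<Longrightarrow> smooth (\<lambda>x. f x + g x)"
  by (simp add: smooth_def Ck_on_add)

lemma smooth_mult: "smooth f \<Longrightarrow> smooth g \<Longrightarrow> smooth (\<lambda>x. f x * g x)"
  by (simp add: smooth_def Ck_on_mult)

lemma smooth_diff: "smooth f \<Longrightarrow> smooth g \<Longrightarrow> smooth (\<lambda>x. f x - g x)"
  using smooth_add[of f "\<lambda>x. (-1) * g x"] smooth_mult[OF smooth_const[of "-1"], of g] by simp

lemma smooth_sum: "finite I \<Longrightarrow> (\<And>i. i \<in> I \<Longrightarrow> smooth (f i)) \<Longrightarrow> smooth (\<lambda>x. \<Sum>i\<in>I. f i x)"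
  by (induction I rule: finite_induct) (auto simp: smooth_const smooth_add)

lemma smooth_compose:
  assumes "\<And>k t. (F k has_real_derivative F (Suc k) t) (at t)" "smooth g"
  shows "smooth (\<lambda>x. F j (g x))"
  using assms by (simp add: smooth_def Ck_on_compose)

lemma smooth_inner: "smooth (\<lambda>x. x \<bullet> v)"
  unfolding smooth_def
proof
  fix k show "Ck_on k UNIV (\<lambda>x. x \<bullet> v)"
  proof (cases k)
    case 0
    then show ?thesis by (auto intro: continuous_intros)
  next
    case (Suc m)
    have "partial_deriv i (\<lambda>x. x \<bullet> v) = (\<lambda>x. v $ i)" for i
      by (auto simp: partial_deriv_inner)
    moreover have "(\<lambda>x. x \<bullet> v) differentiable (at x)" for x
      unfolding differentiable_def by (rule exI[of _ "\<lambda>h. h \<bullet> v"]) (auto intro!: derivative_eq_intros)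
    ultimately show ?thesis using Suc by (simp add: Ck_on_const)
  qed
qed

lemma smooth_norm_diff_sq: "smooth (\<lambda>x. (norm (x - p))\<^sup>2)"
proof -
  have "(norm (x - p))\<^sup>2 = (\<Sum>b\<in>Basis. (x \<bullet> b - p \<bullet> b) * (x \<bullet> b - p \<bullet> b))" for x
    unfolding power2_norm_eq_inner by (subst euclidean_inner) (simp add: inner_diff_left)
  moreover have "smooth (\<lambda>x. \<Sum>b\<in>Basis. (x \<bullet> b - p \<bullet> b) * (x \<bullet> b - p \<bullet> b))"
    by (intro smooth_sum smooth_mult smooth_diff smooth_inner smooth_const) auto
  ultimately show ?thesis by simp
qed

lemma smooth_cos_inner: "smooth (\<lambda>x. cos (x \<bullet> v))"
proof -
  \<comment> \<open>Each derivative of the cosine is a shift by a quarter period, which puts all of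
    them into one explicit family.\<close>
  have "((\<lambda>t. cos (t + real k * (pi/2))) has_real_derivative cos (t + real (Suc k) * (pi/2))) (at t)" for k t
  proof -
    have "cos (t + real (Suc k) * (pi/2)) = - sin (t + real k * (pi/2))"
      using cos_add[of "t + real k * (pi/2)" "pi/2"] by (simp add: algebra_simps add_divide_distrib)
    then show ?thesis by (auto intro!: derivative_eq_intros)
  qed
  from smooth_compose[where F = "\<lambda>k t. cos (t + real k * (pi/2))", OF this smooth_inner, where j = 0]
  show ?thesis by simp
qed

lemma smooth_sin_inner: "smooth (\<lambda>x. sin (x \<bullet> v))"
proof -
  have "((\<lambda>t. sin (t + real k * (pi/2))) has_real_derivative sin (t + real (Suc k) * (pi/2))) (at t)" for k t
  proof -
    have "sin (t + real (Suc k) * (pi/2)) = cos (t + real k * (pi/2))"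
      using sin_add[of "t + real k * (pi/2)" "pi/2"] by (simp add: algebra_simps add_divide_distrib)
    then show ?thesis by (auto intro!: derivative_eq_intros)
  qed
  from smooth_compose[where F = "\<lambda>k t. sin (t + real k * (pi/2))", OF this smooth_inner, where j = 0]
  show ?thesis by simp
qed

lemma smooth_imp_differentiable: "smooth g \<Longrightarrow> g differentiable (at x)"
  unfolding smooth_def by (metis Ck_on.simps(2) UNIV_I)

lemma smooth_imp_continuous: "smooth g \<Longrightarrow> continuous_on UNIV g"
  unfolding smooth_def by (metis Ck_on.simps(1))

lemma smooth_partial_deriv: "smooth g \<Longrightarrow> smooth (partial_deriv i g)"
  unfolding smooth_def by (metis Ck_on.simps(2))

text \<open>The functions \<open>t \<mapsto> P (1 / t) * exp (- 1 / t)\<close> on the positive half-line, extended by zero,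
  are closed under differentiation, whence \<open>flat\<close> below is smooth.\<close>

definition flat_poly :: "real poly \<Rightarrow> real \<Rightarrow> real" where
  "flat_poly P t = (if t > 0 then poly P (1 / t) * exp (- (1 / t)) else 0)"

abbreviation flat :: "real \<Rightarrow> real" where
  "flat \<equiv> flat_poly 1"

text \<open>With x = 1 / t this is the decay of a polynomial divided by \<open>exp x\<close> at
  infinity.\<close>

lemma flat_poly_tendsto_0: "((\<lambda>t::real. poly P (1 / t) * exp (- (1 / t))) \<longlongrightarrow> 0) (at_right 0)"
proof -
  have "((\<lambda>x. \<Sum>i\<le>degree P. coeff P i * (x ^ i / exp x)) \<longlongrightarrow> (\<Sum>i\<le>degree P. coeff P i * 0)) at_top"
    by (intro tendsto_sum tendsto_mult tendsto_const tendsto_power_div_exp_0)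
  then have "((\<lambda>x. poly P x * exp (- x)) \<longlongrightarrow> 0) at_top"
    by (simp add: poly_altdef sum_divide_distrib exp_minus field_simps)
  from filterlim_compose[OF this filterlim_inverse_at_top_right] show ?thesis
    by (simp add: inverse_eq_divide)
qed


text \<open>For x = 1 / t one has dx/dt = - x^2, so \<open>poly P x * exp (- x)\<close> has
  derivative x^2 (P - P') (x) exp (- x); the polynomial \<open>[:0, 0, 1:]\<close> is this
  x^2.\<close>

lemma flat_poly_deriv:
  "(flat_poly P has_real_derivative flat_poly ([:0, 0, 1:] * (P - pderiv P)) t) (at t)"
proof -
  consider "t > 0" | "t < 0" | "t = 0" by linarith
  then show ?thesis
  proof cases
    case 1
    have inv: "((\<lambda>t. 1 / t) has_real_derivative - (1 / t\<^sup>2)) (at t)"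
      using 1 by (auto intro!: derivative_eq_intros simp: power2_eq_square)
    have "((\<lambda>t. poly P (1 / t) * exp (- (1 / t))) has_real_derivative
        poly (pderiv P) (1 / t) * - (1 / t\<^sup>2) * exp (- (1 / t)) +
        exp (- (1 / t)) * - (- (1 / t\<^sup>2)) * poly P (1 / t)) (at t)"
      by (rule DERIV_mult[OF DERIV_chain2[OF poly_DERIV inv] DERIV_chain2[OF DERIV_exp DERIV_minus[OF inv]]])
    also have "poly (pderiv P) (1 / t) * - (1 / t\<^sup>2) * exp (- (1 / t)) +
        exp (- (1 / t)) * - (- (1 / t\<^sup>2)) * poly P (1 / t) =
        flat_poly ([:0, 0, 1:] * (P - pderiv P)) t"
      using 1 by (simp add: flat_poly_def power2_eq_square algebra_simps)
    finally have "((\<lambda>t. poly P (1 / t) * exp (- (1 / t))) has_real_derivative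
        flat_poly ([:0, 0, 1:] * (P - pderiv P)) t) (at t)" .
    moreover have "eventually (\<lambda>u. u > 0) (nhds t)"
      using 1 by (simp add: eventually_nhds_in_open[of "{0<..}", simplified])
    then have "eventually (\<lambda>u. poly P (1 / u) * exp (- (1 / u)) = flat_poly P u) (nhds t)"
      by eventually_elim (simp add: flat_poly_def)
    ultimately show ?thesis by (subst (asm) DERIV_cong_ev) auto
  next
    case 2
    have "((\<lambda>t. 0) has_real_derivative flat_poly ([:0, 0, 1:] * (P - pderiv P)) t) (at t)"
      using 2 by (simp add: flat_poly_def)
    moreover have "eventually (\<lambda>u. u < 0) (nhds t)"
      using 2 by (simp add: eventually_nhds_in_open[of "{..<0}", simplified])
    then have "eventually (\<lambda>u. 0 = flat_poly P u) (nhds t)"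
      by eventually_elim (simp add: flat_poly_def)
    ultimately show ?thesis by (subst (asm) DERIV_cong_ev) auto
  next
    case 3
    \<comment> \<open>At the origin this is the difference quotient. Division by u multiplies P by
      the variable, so the preceding limit applies to the new polynomial.\<close>
    have "((\<lambda>u. flat_poly P u / u) \<longlongrightarrow> 0) (at_right 0)"
    proof (rule Lim_transform_eventually)
      show "((\<lambda>t. poly ([:0, 1:] * P) (1 / t) * exp (- (1 / t))) \<longlongrightarrow> 0) (at_right 0)"
        by (rule flat_poly_tendsto_0)
      show "\<forall>\<^sub>F u in at_right 0. poly ([:0, 1:] * P) (1 / u) * exp (- (1 / u)) = flat_poly P u / u"
        by (auto simp: eventually_at_filter flat_poly_def)
    qed
    moreover have "((\<lambda>u. flat_poly P u / u) \<longlongrightarrow> 0) (at_left 0)"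
      by (rule Lim_transform_eventually[OF tendsto_const]) (auto simp: eventually_at_filter flat_poly_def)
    ultimately have "((\<lambda>u. flat_poly P u / u) \<longlongrightarrow> 0) (at 0)"
      by (simp add: filterlim_split_at)
    then show ?thesis using 3 by (simp add: has_field_derivative_iff flat_poly_def)
  qed
qed

lemma smooth_flat: "smooth g \<Longrightarrow> smooth (\<lambda>x. flat (g x))"
  using smooth_compose[where F = "\<lambda>k. flat_poly (((\<lambda>P. [:0, 0, 1:] * (P - pderiv P)) ^^ k) 1)" and j = 0]
    flat_poly_deriv by simp

lemma flat_pos: "t > 0 \<Longrightarrow> flat t > 0"
  and flat_nonpos: "t \<le> 0 \<Longrightarrow> flat t = 0"
  and flat_nonneg: "flat t \<ge> 0"
  and flat_le_1: "flat t \<le> 1"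
  by (auto simp: flat_poly_def)

lemma flat_mono: "s \<le> t \<Longrightarrow> flat s \<le> flat t"
  by (auto simp: flat_poly_def frac_le)

text \<open>The limit is the indicator of the open half-line, since \<open>flat (m * t)\<close> is
  \<open>exp (- 1 / (m * t))\<close> for positive t. Composition with an affine function yields
  smooth approximations of half-spaces.\<close>

lemma flat_mult_nat_tendsto:
  "(\<lambda>m. flat (real m * t)) \<longlonglongrightarrow> (if t > 0 then 1 else 0)"
proof (cases "t > 0")
  case True
  have "(\<lambda>m. exp (- (inverse (real m) * (1 / t)))) \<longlonglongrightarrow> exp (- (0 * (1 / t)))"
    by (intro tendsto_intros lim_inverse_n)
  moreover have "\<forall>\<^sub>F m in sequentially. exp (- (inverse (real m) * (1 / t))) = flat (real m * t)"
    using eventually_gt_at_top[of "0::nat"]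
    by eventually_elim (use True in \<open>simp add: flat_poly_def field_simps\<close>)
  ultimately show ?thesis
    using True by (auto intro: Lim_transform_eventually)
next
  case False
  then show ?thesis by (simp add: flat_nonpos mult_nonneg_nonpos)
qed

section \<open>Test functions\<close>

text \<open>Any compact set outside of which the function vanishes may stand in for its topological
  support, so sums, products and derivatives require no computation with closures.\<close>

lemma test_functions_iff:
  "\<phi> \<in> test_functions U \<longleftrightarrow> smooth \<phi> \<and> (\<exists>K. compact K \<and> K \<subseteq> U \<and> (\<forall>x. x \<notin> K \<longrightarrow> \<phi> x = 0))"
proof
  assume "\<phi> \<in> test_functions U"
  moreover have "\<phi> x = 0" if "x \<notin> closure {x. \<phi> x \<noteq> 0}" for x
    using that closure_subset[of "{x. \<phi> x \<noteq> 0}"] by auto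
  ultimately show "smooth \<phi> \<and> (\<exists>K. compact K \<and> K \<subseteq> U \<and> (\<forall>x. x \<notin> K \<longrightarrow> \<phi> x = 0))"
    unfolding test_functions_def smooth_def by blast
next
  assume *: "smooth \<phi> \<and> (\<exists>K. compact K \<and> K \<subseteq> U \<and> (\<forall>x. x \<notin> K \<longrightarrow> \<phi> x = 0))"
  then obtain K where K: "compact K" "K \<subseteq> U" "\<And>x. x \<notin> K \<Longrightarrow> \<phi> x = 0" by blast
  then have "closure {x. \<phi> x \<noteq> 0} \<subseteq> K"
    by (intro closure_minimal compact_imp_closed) auto
  moreover have "compact (closure {x. \<phi> x \<noteq> 0})"
    using calculation K(1) by (meson bounded_subset compact_eq_bounded_closed closed_closure)
  ultimately show "\<phi> \<in> test_functions U"
    using * K unfolding test_functions_def smooth_def by blast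
qed

lemma test_smooth: "\<phi> \<in> test_functions U \<Longrightarrow> smooth \<phi>"
  by (simp add: test_functions_iff)

lemma borel_measurable_test [measurable_dest]:
  "\<phi> \<in> test_functions U \<Longrightarrow> \<phi> \<in> borel_measurable borel"
  using smooth_imp_continuous test_smooth borel_measurable_continuous_onI by blast

lemma test_functions_support:
  assumes "\<phi> \<in> test_functions U"
  obtains K where "compact K" "K \<subseteq> U" "\<And>x. x \<notin> K \<Longrightarrow> \<phi> x = 0"
  using assms unfolding test_functions_iff by blast

lemma test_functions_mono: "U \<subseteq> W \<Longrightarrow> test_functions U \<subseteq> test_functions W"
  unfolding test_functions_def by blast

lemma test_functions_add:
  assumes "\<phi> \<in> test_functions U" "\<psi> \<in> test_functions U"
  shows "(\<lambda>x. \<phi> x + \<psi> x) \<in> test_functions U"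
proof -
  obtain K where "compact K" "K \<subseteq> U" "\<And>x. x \<notin> K \<Longrightarrow> \<phi> x = 0"
    using test_functions_support[OF assms(1)] by blast
  moreover obtain L where "compact L" "L \<subseteq> U" "\<And>x. x \<notin> L \<Longrightarrow> \<psi> x = 0"
    using test_functions_support[OF assms(2)] by blast
  ultimately show ?thesis using assms unfolding test_functions_iff
    by (intro conjI smooth_add exI[of _ "K \<union> L"]) (auto intro: compact_Un)
qed

lemma test_functions_mult:
  assumes "smooth g" "\<phi> \<in> test_functions U"
  shows "(\<lambda>x. g x * \<phi> x) \<in> test_functions U"
proof -
  obtain K where "compact K" "K \<subseteq> U" "\<And>x. x \<notin> K \<Longrightarrow> \<phi> x = 0"
    using test_functions_support[OF assms(2)] by blast
  then show ?thesis using assms unfolding test_functions_iff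
    by (intro conjI smooth_mult exI[of _ K]) auto
qed

lemma test_functions_scale: "\<phi> \<in> test_functions U \<Longrightarrow> (\<lambda>x. a * \<phi> x) \<in> test_functions U"
  by (rule test_functions_mult[OF smooth_const])

lemma test_functions_0: "(\<lambda>x. 0) \<in> test_functions U"
  unfolding test_functions_iff using smooth_const by (intro conjI exI[of _ "{}"]) auto

lemma test_functions_sum:
  "finite I \<Longrightarrow> (\<And>i. i \<in> I \<Longrightarrow> \<phi> i \<in> test_functions U) \<Longrightarrow> (\<lambda>x. \<Sum>i\<in>I. \<phi> i x) \<in> test_functions U"
  by (induction I rule: finite_induct) (auto simp: test_functions_0 test_functions_add)

lemma test_functions_partial_deriv:
  assumes "\<phi> \<in> test_functions U"
  shows "partial_deriv i \<phi> \<in> test_functions U"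
proof -
  obtain K where K: "compact K" "K \<subseteq> U" "\<And>x. x \<notin> K \<Longrightarrow> \<phi> x = 0"
    using test_functions_support[OF assms] by blast
  have "partial_deriv i \<phi> x = 0" if "x \<notin> K" for x
  proof -
    have "open (- K)" using K compact_imp_closed by blast
    then have "(\<phi> has_derivative (\<lambda>h. 0)) (at x)"
      using has_derivative_transform_within_open[OF has_derivative_const[of 0 "at x"], of "- K" \<phi>] K(3) that
      by auto
    then show ?thesis using partial_deriv_eq by force
  qed
  then show ?thesis using assms K unfolding test_functions_iff
    by (intro conjI smooth_partial_deriv exI[of _ K]) auto
qed

lemma test_functions_bounded:
  assumes "\<phi> \<in> test_functions U"
  obtains C where "\<And>x. \<bar>\<phi> x\<bar> \<le> C" "C \<ge> 0"
proof -
  obtain K where K: "compact K" "K \<subseteq> U" "\<And>x. x \<notin> K \<Longrightarrow> \<phi> x = 0"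
    using test_functions_support[OF assms] by blast
  have "compact (\<phi> ` K)"
    using K smooth_imp_continuous[OF test_smooth[OF assms]] continuous_on_subset
    by (intro compact_continuous_image) blast+
  then obtain C where "\<And>x. x \<in> K \<Longrightarrow> \<bar>\<phi> x\<bar> \<le> C"
    by (metis bounded_iff compact_imp_bounded imageI real_norm_def)
  then have "\<bar>\<phi> x\<bar> \<le> max C 0" for x
    using K(3)[of x] by (cases "x \<in> K") (auto intro: max.coboundedI1)
  then show ?thesis by (intro that[of "max C 0"]) auto
qed

lemma ball_bump:
  assumes "cball p r \<subseteq> U" "r > 0"
  shows "(\<lambda>x. flat (r\<^sup>2 - (norm (x - p))\<^sup>2)) \<in> test_functions U"
proof -
  have "flat (r\<^sup>2 - (norm (x - p))\<^sup>2) = 0" if "x \<notin> cball p r" for x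
    using that assms(2) by (intro flat_nonpos) (simp add: dist_norm norm_minus_commute power_mono)
  then show ?thesis using assms unfolding test_functions_iff
    by (intro conjI smooth_flat smooth_diff smooth_const smooth_norm_diff_sq exI[of _ "cball p r"]) auto
qed

text \<open>A finite sum of rescaled bumps on balls suffices: only the lower bound 1 on K is asked
  for, so the values of the sum are never cut off.\<close>

lemma test_function_ge_1:
  assumes "compact K" "K \<subseteq> U" "open U"
  obtains \<eta> where "\<eta> \<in> test_functions U" "\<And>x. 0 \<le> \<eta> x" "\<And>x. x \<in> K \<Longrightarrow> 1 \<le> \<eta> x"
proof -
  have "\<exists>r>0. cball p r \<subseteq> U" if "p \<in> K" for p
    using that assms open_contains_cball by blast
  then obtain r where r: "\<And>p. p \<in> K \<Longrightarrow> r p > 0" "\<And>p. p \<in> K \<Longrightarrow> cball p (r p) \<subseteq> U" by metis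
  have "K \<subseteq> (\<Union>p\<in>K. ball p (r p / 2))" using r by force
  from compactE_image[OF assms(1) _ this] obtain F where F: "F \<subseteq> K" "finite F"
    "K \<subseteq> (\<Union>p\<in>F. ball p (r p / 2))" by auto
  define b where "b p x = flat ((r p)\<^sup>2 - (norm (x - p))\<^sup>2)" for p x
  \<comment> \<open>A lower bound for the bump on the ball of half the radius, where the squared
    distance to p is at most a quarter of the squared radius.\<close>
  define c where "c p = flat ((r p)\<^sup>2 / 2)" for p
  define \<eta> where "\<eta> x = (\<Sum>p\<in>F. inverse (c p) * b p x)" for x
  have c: "c p > 0" if "p \<in> F" for p
  proof -
    have "0 < r p" using that r F by auto
    then show ?thesis by (simp add: c_def flat_pos)
  qed
  have nn: "0 \<le> inverse (c p) * b p x" for p x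
    by (simp add: b_def c_def flat_nonneg)
  show ?thesis
  proof (rule that)
    show "\<eta> \<in> test_functions U"
      unfolding \<eta>_def b_def using F r(1) r(2)[THEN subsetD]
      by (intro test_functions_sum test_functions_scale ball_bump subsetI) auto
    show "0 \<le> \<eta> x" for x unfolding \<eta>_def using nn by (intro sum_nonneg) auto
    show "1 \<le> \<eta> x" if xK: "x \<in> K" for x
    proof -
      obtain p where p: "p \<in> F" "dist p x < r p / 2" using subsetD[OF F(3) xK] by (auto simp del: less_divide_eq_numeral1)
      have rp: "0 < r p" using p r F by auto
      have "(norm (x - p))\<^sup>2 \<le> (r p / 2)\<^sup>2"
        using p by (intro power_mono) (auto simp: dist_norm norm_minus_commute)
      then have "(norm (x - p))\<^sup>2 \<le> (r p)\<^sup>2 / 4" by (simp add: power_divide)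
      then have "c p \<le> b p x" unfolding c_def b_def
        using zero_le_power2[of "r p"] by (intro flat_mono) linarith
      then have "1 \<le> inverse (c p) * b p x" using c[OF p(1)] by (simp add: field_simps)
      also have "\<dots> \<le> \<eta> x" unfolding \<eta>_def using nn F(2) p(1) by (intro member_le_sum) auto
      finally show ?thesis .
    qed
  qed
qed

section \<open>Positive distributions are Radon measures\<close>

lemma simple_function_eq_sum:
  fixes s :: "'a \<Rightarrow> ennreal"
  assumes "finite (range s)"
  shows "s x = (\<Sum>y\<in>range s. y * indicator (s -` {y}) x)"
proof -
  have "(\<Sum>y\<in>range s. y * indicator (s -` {y}) x) = (\<Sum>y\<in>range s. if s x = y then y else 0)"
    by (intro sum.cong) (auto simp: indicator_def)
  then show ?thesis using assms by simp
qed

locale positive_functional =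
  fixes S :: "(real^'n::finite) set" and T :: "(real^'n \<Rightarrow> real) \<Rightarrow> real"
  assumes open_domain: "open S"
    and linear: "linear_on_space (test_functions S) T"
    and positive: "nonneg_distribution S T"
begin

definition nonneg_tests :: "(real^'n \<Rightarrow> real) set" where
  "nonneg_tests = {\<phi> \<in> test_functions S. \<forall>x. 0 \<le> \<phi> x}"

lemma T_add: "\<phi> \<in> test_functions S \<Longrightarrow> \<psi> \<in> test_functions S \<Longrightarrow> T (\<lambda>x. \<phi> x + \<psi> x) = T \<phi> + T \<psi>"
  using linear unfolding linear_on_space_def by blast

lemma T_scale: "\<phi> \<in> test_functions S \<Longrightarrow> T (\<lambda>x. a * \<phi> x) = a * T \<phi>"
  using linear unfolding linear_on_space_def by blast

lemma T_0: "T (\<lambda>x. 0) = 0"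
  using T_scale[OF test_functions_0, of 0] by simp

lemma T_sum:
  "finite I \<Longrightarrow> (\<And>i. i \<in> I \<Longrightarrow> \<phi> i \<in> test_functions S) \<Longrightarrow> T (\<lambda>x. \<Sum>i\<in>I. \<phi> i x) = (\<Sum>i\<in>I. T (\<phi> i))"
  by (induction I rule: finite_induct) (auto simp: T_0 T_add test_functions_sum)

lemma T_nonneg: "\<phi> \<in> nonneg_tests \<Longrightarrow> 0 \<le> T \<phi>"
  using positive unfolding nonneg_distribution_def nonneg_tests_def by blast

lemma T_mono:
  assumes "\<phi> \<in> test_functions S" "\<psi> \<in> test_functions S" "\<And>x. \<phi> x \<le> \<psi> x"
  shows "T \<phi> \<le> T \<psi>"
proof -
  have *: "(\<lambda>x. (-1) * \<phi> x) \<in> test_functions S" using assms by (intro test_functions_scale)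
  have "(\<lambda>x. \<psi> x + (-1) * \<phi> x) \<in> nonneg_tests"
    unfolding nonneg_tests_def using assms test_functions_add[OF assms(2) *] by auto
  then have "0 \<le> T (\<lambda>x. \<psi> x + (-1) * \<phi> x)" by (rule T_nonneg)
  then show ?thesis using T_add[OF assms(2) *] T_scale[OF assms(1), of "-1"] by simp
qed

section \<open>Upper integrals defined by covers with test functions\<close>

definition covers :: "(real^'n \<Rightarrow> ennreal) \<Rightarrow> (nat \<Rightarrow> real^'n \<Rightarrow> real) set" where
  "covers f = {\<phi>. (\<forall>k. \<phi> k \<in> nonneg_tests) \<and> (\<forall>x\<in>S. f x \<le> (\<Sum>k. ennreal (\<phi> k x)))}"

text \<open>Countable covers make countable subadditivity nearly automatic. The price is paid in
  \<open>upper_integral_test\<close>, where compactness has to lead back to finite sums.\<close>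

definition upper_integral :: "(real^'n \<Rightarrow> ennreal) \<Rightarrow> ennreal" where
  "upper_integral f = (INF \<phi>\<in>covers f. \<Sum>k. ennreal (T (\<phi> k)))"

lemma upper_integral_le: "\<phi> \<in> covers f \<Longrightarrow> upper_integral f \<le> (\<Sum>k. ennreal (T (\<phi> k)))"
  unfolding upper_integral_def by (rule INF_lower)

lemma upper_integral_mono: "(\<And>x. f x \<le> g x) \<Longrightarrow> upper_integral f \<le> upper_integral g"
  unfolding upper_integral_def covers_def by (rule INF_superset_mono) (auto intro: order_trans)

text \<open>Take for the i-th function a cover whose cost exceeds the infimum by less than e /
  2^(i+1), and enumerate the resulting double sequence as a single cover.\<close>

lemma upper_integral_suminf: "upper_integral (\<lambda>x. \<Sum>i. f i x) \<le> (\<Sum>i. upper_integral (f i))"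
proof (rule ennreal_le_epsilon)
  fix e :: real assume fin: "(\<Sum>i. upper_integral (f i)) < top" and e: "0 < e"
  have "\<exists>\<phi>\<in>covers (f i). (\<Sum>k. ennreal (T (\<phi> k))) < upper_integral (f i) + ennreal (e * (1/2) ^ Suc i)" for i
  proof -
    have "upper_integral (f i) < top" using ennreal_suminf_lessD[OF fin] .
    then have "upper_integral (f i) < upper_integral (f i) + ennreal (e * (1/2) ^ Suc i)"
      using e by (simp add: ennreal_zero_less_mult_iff)
    then show ?thesis unfolding upper_integral_def INF_less_iff by simp
  qed
  then obtain \<phi> where \<phi>: "\<And>i. \<phi> i \<in> covers (f i)"
    and less: "\<And>i. (\<Sum>k. ennreal (T (\<phi> i k))) < upper_integral (f i) + ennreal (e * (1/2) ^ Suc i)"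
    by metis
  define \<psi> where "\<psi> n = (case prod_decode n of (i, k) \<Rightarrow> \<phi> i k)" for n
  have \<psi>: "\<psi> \<in> covers (\<lambda>x. \<Sum>i. f i x)"
    unfolding covers_def
  proof (intro CollectI conjI allI ballI)
    fix n show "\<psi> n \<in> nonneg_tests" using \<phi> by (auto simp: \<psi>_def covers_def split: prod.split)
  next
    fix x assume "x \<in> S"
    then have "(\<Sum>i. f i x) \<le> (\<Sum>i. \<Sum>k. ennreal (\<phi> i k x))"
      using \<phi> by (intro suminf_le summableI) (auto simp: covers_def)
    also have "\<dots> = (\<Sum>n. (\<lambda>(i, k). ennreal (\<phi> i k x)) (prod_decode n))"
      by (subst suminf_ennreal_2dimen) auto
    also have "\<dots> = (\<Sum>n. ennreal (\<psi> n x))"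
      by (intro suminf_cong) (auto simp: \<psi>_def split: prod.split)
    finally show "(\<Sum>i. f i x) \<le> (\<Sum>n. ennreal (\<psi> n x))" .
  qed
  have "upper_integral (\<lambda>x. \<Sum>i. f i x) \<le> (\<Sum>n. ennreal (T (\<psi> n)))"
    by (rule upper_integral_le[OF \<psi>])
  also have "\<dots> = (\<Sum>n. (\<lambda>(i, k). ennreal (T (\<phi> i k))) (prod_decode n))"
    by (intro suminf_cong) (auto simp: \<psi>_def split: prod.split)
  also have "\<dots> = (\<Sum>i. \<Sum>k. ennreal (T (\<phi> i k)))"
    by (subst suminf_ennreal_2dimen) auto
  also have "\<dots> \<le> (\<Sum>i. upper_integral (f i) + ennreal (e * (1/2) ^ Suc i))"
    using less by (intro suminf_le summableI) (auto intro: less_imp_le)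
  also have "\<dots> = (\<Sum>i. upper_integral (f i)) + (\<Sum>i. ennreal (e * (1/2) ^ Suc i))"
    by (intro suminf_add[symmetric] summableI)
  also have "(\<Sum>i. ennreal (e * (1/2) ^ Suc i)) = ennreal e"
    using e sums_mult[OF power_half_series, of e] by (intro sums_unique[symmetric]) auto
  finally show "upper_integral (\<lambda>x. \<Sum>i. f i x) \<le> (\<Sum>i. upper_integral (f i)) + ennreal e" .
qed

text \<open>The lower bound is an argument in the manner of Dini. On the compact support, finitely
  many terms of a cover already exceed \<phi> up to an error e, and the error is absorbed by
  \<open>e * \<eta> x\<close>, where \<eta> is at least 1 on that support.\<close>

lemma upper_integral_test:
  assumes "\<phi> \<in> nonneg_tests"
  shows "upper_integral (\<lambda>x. ennreal (\<phi> x)) = ennreal (T \<phi>)"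
proof (rule antisym)
  define \<psi> :: "nat \<Rightarrow> real^'n \<Rightarrow> real" where "\<psi> k = (if k = 0 then \<phi> else (\<lambda>x. 0))" for k
  have "(\<Sum>k. ennreal (\<psi> k x)) = ennreal (\<phi> x)" for x
    by (subst suminf_finite[of "{0}"]) (auto simp: \<psi>_def)
  moreover have "(\<lambda>x. 0) \<in> nonneg_tests" by (simp add: nonneg_tests_def test_functions_0)
  ultimately have "\<psi> \<in> covers (\<lambda>x. ennreal (\<phi> x))"
    using assms by (auto simp: covers_def) (simp add: \<psi>_def)
  then have "upper_integral (\<lambda>x. ennreal (\<phi> x)) \<le> (\<Sum>k. ennreal (T (\<psi> k)))"
    by (rule upper_integral_le)
  also have "\<dots> = ennreal (T \<phi>)"
    by (subst suminf_finite[of "{0}"]) (auto simp: \<psi>_def T_0)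
  finally show "upper_integral (\<lambda>x. ennreal (\<phi> x)) \<le> ennreal (T \<phi>)" .
next
  show "ennreal (T \<phi>) \<le> upper_integral (\<lambda>x. ennreal (\<phi> x))"
    unfolding upper_integral_def
  proof (rule INF_greatest)
    fix \<psi> assume \<psi>: "\<psi> \<in> covers (\<lambda>x. ennreal (\<phi> x))"
    have \<phi>: "\<phi> \<in> test_functions S" "\<And>x. 0 \<le> \<phi> x" using assms by (auto simp: nonneg_tests_def)
    have \<psi>t: "\<psi> k \<in> test_functions S" "\<And>x. 0 \<le> \<psi> k x" "\<psi> k \<in> nonneg_tests" for k
      using \<psi> by (auto simp: covers_def nonneg_tests_def)
    obtain K where K: "compact K" "K \<subseteq> S" "\<And>x. x \<notin> K \<Longrightarrow> \<phi> x = 0"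
      using test_functions_support[OF \<phi>(1)] by blast
    obtain \<eta> where \<eta>: "\<eta> \<in> test_functions S" "\<And>x. 0 \<le> \<eta> x" "\<And>x. x \<in> K \<Longrightarrow> 1 \<le> \<eta> x"
      using test_function_ge_1[OF K(1,2) open_domain] by blast
    have step: "ennreal (T \<phi>) \<le> (\<Sum>k. ennreal (T (\<psi> k))) + ennreal (e * T \<eta>)" if e: "e > 0" for e
    proof -
      define O' where "O' N = {x. \<phi> x < (\<Sum>k<N. \<psi> k x) + e}" for N :: nat
      have "open (O' N)" for N
        unfolding O'_def using smooth_imp_continuous[OF test_smooth[OF \<phi>(1)]]
          smooth_imp_continuous[OF test_smooth[OF \<psi>t(1)]]
        by (intro open_Collect_less continuous_intros)
      moreover have "K \<subseteq> (\<Union>N\<in>UNIV. O' N)"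
      proof
        fix x assume "x \<in> K"
        then have 1: "ennreal (\<phi> x) \<le> (SUP N. \<Sum>k<N. ennreal (\<psi> k x))"
          using \<psi> K(2) by (auto simp: covers_def suminf_eq_SUP)
        have 2: "(\<Sum>k<N. ennreal (\<psi> k x)) = ennreal (\<Sum>k<N. \<psi> k x)" for N
          using \<psi>t(2) by (simp add: sum_ennreal)
        have 3: "x \<notin> O' N \<Longrightarrow> ennreal (\<Sum>k<N. \<psi> k x) \<le> ennreal (\<phi> x - e)" for N
          by (intro ennreal_leI) (simp add: O'_def)
        \<comment> \<open>This keeps \<open>\<phi> x - e\<close> nonnegative; otherwise
          \<open>ennreal\<close> would truncate it to 0 and the contradiction below would
          fail.\<close>
        have 4: "x \<notin> O' N \<Longrightarrow> \<phi> x \<ge> e" for N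
          using \<psi>t(2) sum_nonneg[of "{..<N}" "\<lambda>k. \<psi> k x"] by (auto simp: O'_def not_less)
        have "\<not> (\<forall>N. x \<notin> O' N)"
        proof
          assume none: "\<forall>N. x \<notin> O' N"
          then have "(SUP N. \<Sum>k<N. ennreal (\<psi> k x)) \<le> ennreal (\<phi> x - e)"
            unfolding 2 by (intro SUP_least 3) auto
          with 1 have "ennreal (\<phi> x) \<le> ennreal (\<phi> x - e)" by (rule order_trans)
          then show False using e 4 none by (auto simp: ennreal_le_iff)
        qed
        then show "x \<in> (\<Union>N\<in>UNIV. O' N)" by blast
      qed
      ultimately obtain F where F: "finite F" "K \<subseteq> (\<Union>N\<in>F. O' N)"
        by (rule compactE_image[OF K(1), of UNIV O'])
      \<comment> \<open>Inserting 0 gives the maximum a meaning when F is empty, which happens for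
        empty K.\<close>
      define N where "N = Max (insert 0 F)"
      have le: "\<phi> x \<le> (\<Sum>k<N. \<psi> k x) + e * \<eta> x" for x
      proof (cases "x \<in> K")
        case True
        then obtain M where M: "M \<in> F" "x \<in> O' M" using F by blast
        then have "M \<le> N" unfolding N_def using F by (intro Max_ge) auto
        then have "(\<Sum>k<M. \<psi> k x) \<le> (\<Sum>k<N. \<psi> k x)"
          using \<psi>t(2) by (intro sum_mono2) auto
        moreover have "e \<le> e * \<eta> x" using \<eta>(3)[OF True] e by simp
        ultimately show ?thesis using M(2) by (simp add: O'_def)
      next
        case False
        then show ?thesis using K(3) \<psi>t(2) \<eta>(2) e by (simp add: sum_nonneg)
      qed
      have "T \<phi> \<le> T (\<lambda>x. (\<Sum>k<N. \<psi> k x) + e * \<eta> x)"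
        using \<phi> \<psi>t \<eta> le by (intro T_mono test_functions_add test_functions_sum test_functions_scale) auto
      also have "\<dots> = (\<Sum>k<N. T (\<psi> k)) + e * T \<eta>"
        using \<psi>t \<eta> by (subst T_add) (auto intro!: test_functions_sum test_functions_scale simp: T_sum T_scale)
      finally have "ennreal (T \<phi>) \<le> ennreal (\<Sum>k<N. T (\<psi> k)) + ennreal (e * T \<eta>)"
        using T_nonneg \<psi>t \<eta> e
        by (subst ennreal_plus[symmetric]) (auto intro!: ennreal_leI sum_nonneg simp: nonneg_tests_def)
      also have "ennreal (\<Sum>k<N. T (\<psi> k)) = (\<Sum>k<N. ennreal (T (\<psi> k)))"
        using \<psi>t T_nonneg by (simp add: sum_ennreal)
      also have "\<dots> \<le> (\<Sum>k. ennreal (T (\<psi> k)))"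
        by (intro sum_le_suminf summableI) auto
      finally show ?thesis by (simp add: add_right_mono)
    qed
    show "ennreal (T \<phi>) \<le> (\<Sum>k. ennreal (T (\<psi> k)))"
    proof (rule ennreal_le_epsilon)
      fix e :: real assume e: "0 < e"
      have T\<eta>: "T \<eta> \<ge> 0" using T_nonneg \<eta> by (simp add: nonneg_tests_def)
      \<comment> \<open>The summand 1 in the denominator guards against
        \<open>T \<eta> = 0\<close>.\<close>
      have "e / (T \<eta> + 1) * T \<eta> \<le> e" using e T\<eta> by (simp add: field_simps)
      then have "ennreal (e / (T \<eta> + 1) * T \<eta>) \<le> ennreal e" by (rule ennreal_leI)
      then show "ennreal (T \<phi>) \<le> (\<Sum>k. ennreal (T (\<psi> k))) + ennreal e"
        using step[of "e / (T \<eta> + 1)"] e T\<eta> by (auto intro: order_trans add_left_mono)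
    qed
  qed
qed

lemma upper_integral_0: "upper_integral (\<lambda>x. 0) = 0"
  using upper_integral_test[of "\<lambda>x. 0"] by (simp add: nonneg_tests_def test_functions_0 T_0)

lemma upper_integral_add: "upper_integral (\<lambda>x. f x + g x) \<le> upper_integral f + upper_integral g"
proof -
  define h where "h i = (if i = 0 then f else if i = 1 then g else (\<lambda>x. 0))" for i :: nat
  have "(\<Sum>i. h i x) = f x + g x" for x
    by (subst suminf_finite[of "{0, 1}"]) (auto simp: h_def)
  moreover have "(\<Sum>i. upper_integral (h i)) = upper_integral f + upper_integral g"
    by (subst suminf_finite[of "{0, 1}"]) (auto simp: h_def upper_integral_0)
  ultimately show ?thesis using upper_integral_suminf[of h] by simp
qed

lemma upper_integral_sum:
  "finite I \<Longrightarrow> upper_integral (\<lambda>x. \<Sum>i\<in>I. f i x) \<le> (\<Sum>i\<in>I. upper_integral (f i))"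
proof (induction I rule: finite_induct)
  case (insert i I)
  then show ?case using upper_integral_add[of "f i" "\<lambda>x. \<Sum>i\<in>I. f i x"]
    by (auto intro: order_trans add_left_mono)
qed (simp add: upper_integral_0)

text \<open>Dividing a cover of the scaled function by c gives a cover of f, at a cost divided by
  c.\<close>

lemma upper_integral_scale_le:
  assumes "c > 0"
  shows "ennreal c * upper_integral f \<le> upper_integral (\<lambda>x. ennreal c * f x)"
  unfolding upper_integral_def[of "\<lambda>x. ennreal c * f x"]
proof (rule INF_greatest)
  fix \<phi> assume \<phi>: "\<phi> \<in> covers (\<lambda>x. ennreal c * f x)"
  define \<psi> where "\<psi> k x = inverse c * \<phi> k x" for k x
  have \<phi>t: "\<phi> k \<in> test_functions S" "\<And>x. 0 \<le> \<phi> k x" "\<phi> k \<in> nonneg_tests" for k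
    using \<phi> by (auto simp: covers_def nonneg_tests_def)
  have "\<psi> k \<in> nonneg_tests" for k
    unfolding \<psi>_def nonneg_tests_def using \<phi>t assms by (auto intro: test_functions_scale)
  moreover have "f x \<le> (\<Sum>k. ennreal (\<psi> k x))" if "x \<in> S" for x
  proof -
    have "f x = ennreal (inverse c) * (ennreal c * f x)"
      using assms by (simp add: mult.assoc[symmetric] ennreal_mult'[symmetric])
    also have "\<dots> \<le> ennreal (inverse c) * (\<Sum>k. ennreal (\<phi> k x))"
      using \<phi> that by (intro mult_left_mono) (auto simp: covers_def)
    also have "\<dots> = (\<Sum>k. ennreal (\<psi> k x))"
      using assms \<phi>t by (simp add: ennreal_suminf_cmult[symmetric] ennreal_mult'[symmetric] \<psi>_def
          del: ennreal_suminf_cmult)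
    finally show ?thesis .
  qed
  ultimately have "\<psi> \<in> covers f" by (simp add: covers_def)
  then have "ennreal c * upper_integral f \<le> ennreal c * (\<Sum>k. ennreal (T (\<psi> k)))"
    by (intro mult_left_mono upper_integral_le) auto
  also have "\<dots> = (\<Sum>k. ennreal (T (\<phi> k)))"
  proof -
    have "T (\<psi> k) = inverse c * T (\<phi> k)" for k
      using T_scale[OF \<phi>t(1)] by (simp add: \<psi>_def[abs_def])
    then show ?thesis
      using assms by (simp add: ennreal_suminf_cmult[symmetric] ennreal_mult'[symmetric] mult.assoc[symmetric]
          del: ennreal_suminf_cmult)
  qed
  finally show "ennreal c * upper_integral f \<le> (\<Sum>k. ennreal (T (\<phi> k)))" .
qed

lemma upper_integral_scale:
  assumes "c < top"
  shows "upper_integral (\<lambda>x. c * f x) = c * upper_integral f"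
proof (cases "c = 0")
  case True
  then show ?thesis by (simp add: upper_integral_0)
next
  case False
  then obtain r where r: "c = ennreal r" "r > 0"
    using assms by (cases c) (auto simp: ennreal_zero_less_mult_iff order_le_less)
  have inv: "ennreal r * ennreal (inverse r) = 1"
    using r by (simp add: ennreal_mult'[symmetric])
  \<comment> \<open>The opposite inequality is the previous lemma for the factor
    \<open>inverse r\<close>, applied to the function that is already scaled.\<close>
  have "ennreal (inverse r) * upper_integral (\<lambda>x. c * f x) \<le> upper_integral f"
    using upper_integral_scale_le[of "inverse r" "\<lambda>x. c * f x"] r inv
    by (simp add: mult.assoc[symmetric] mult.commute)
  then have "c * (ennreal (inverse r) * upper_integral (\<lambda>x. c * f x)) \<le> c * upper_integral f"
    by (rule mult_left_mono) simp
  then have "upper_integral (\<lambda>x. c * f x) \<le> c * upper_integral f"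
    using inv r by (simp add: mult.assoc[symmetric])
  then show ?thesis using upper_integral_scale_le[of r f] r by (intro antisym) auto
qed

text \<open>Multiplying a cover of \<open>f\<close> by a smooth partition of unity splits its cost exactly. This
  replaces the lattice operations of the classical Daniell construction, which smooth functions
  do not admit.\<close>

lemma upper_integral_partition:
  assumes J: "finite J" and p: "\<And>j. j \<in> J \<Longrightarrow> smooth (p j)" "\<And>j x. j \<in> J \<Longrightarrow> 0 \<le> p j x"
    and one: "\<And>x. (\<Sum>j\<in>J. p j x) = 1"
  shows "(\<Sum>j\<in>J. upper_integral (\<lambda>x. f x * ennreal (p j x))) \<le> upper_integral f"
  unfolding upper_integral_def[of f]
proof (rule INF_greatest)
  fix \<phi> assume \<phi>: "\<phi> \<in> covers f"
  have \<phi>t: "\<phi> k \<in> test_functions S" "\<And>x. 0 \<le> \<phi> k x" for k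
    using \<phi> by (auto simp: covers_def nonneg_tests_def)
  have pt: "(\<lambda>x. p j x * \<phi> k x) \<in> test_functions S" if "j \<in> J" for j k
    using p that \<phi>t by (intro test_functions_mult) auto
  have pn: "(\<lambda>x. p j x * \<phi> k x) \<in> nonneg_tests" if "j \<in> J" for j k
    using p that \<phi>t pt by (auto simp: nonneg_tests_def)
  have "upper_integral (\<lambda>x. f x * ennreal (p j x)) \<le> (\<Sum>k. ennreal (T (\<lambda>x. p j x * \<phi> k x)))" if j: "j \<in> J" for j
  proof (rule upper_integral_le)
    have "f x * ennreal (p j x) \<le> (\<Sum>k. ennreal (p j x * \<phi> k x))" if "x \<in> S" for x
    proof -
      have "f x * ennreal (p j x) \<le> (\<Sum>k. ennreal (\<phi> k x)) * ennreal (p j x)"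
        using \<phi> that by (intro mult_right_mono) (auto simp: covers_def)
      then show ?thesis
        using p(2)[OF j] \<phi>t(2)
        by (simp add: ennreal_mult mult.commute)
    qed
    then show "(\<lambda>k x. p j x * \<phi> k x) \<in> covers (\<lambda>x. f x * ennreal (p j x))"
      using pn[OF j] by (simp add: covers_def)
  qed
  then have "(\<Sum>j\<in>J. upper_integral (\<lambda>x. f x * ennreal (p j x)))
      \<le> (\<Sum>j\<in>J. \<Sum>k. ennreal (T (\<lambda>x. p j x * \<phi> k x)))"
    by (rule sum_mono)
  also have "\<dots> = (\<Sum>k. \<Sum>j\<in>J. ennreal (T (\<lambda>x. p j x * \<phi> k x)))"
    by (rule suminf_sum[symmetric]) (rule summableI)
  also have "\<dots> = (\<Sum>k. ennreal (T (\<phi> k)))"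
  proof (rule suminf_cong)
    fix k
    have "(\<Sum>j\<in>J. ennreal (T (\<lambda>x. p j x * \<phi> k x))) = ennreal (\<Sum>j\<in>J. T (\<lambda>x. p j x * \<phi> k x))"
      using T_nonneg[OF pn] by (simp add: sum_ennreal)
    also have "(\<Sum>j\<in>J. T (\<lambda>x. p j x * \<phi> k x)) = T (\<lambda>x. \<Sum>j\<in>J. p j x * \<phi> k x)"
      using T_sum[OF J pt] by simp
    also have "(\<lambda>x. \<Sum>j\<in>J. p j x * \<phi> k x) = \<phi> k"
      using one by (simp add: sum_distrib_right[symmetric])
    finally show "(\<Sum>j\<in>J. ennreal (T (\<lambda>x. p j x * \<phi> k x))) = ennreal (T (\<phi> k))" .
  qed
  finally show "(\<Sum>j\<in>J. upper_integral (\<lambda>x. f x * ennreal (p j x))) \<le> (\<Sum>k. ennreal (T (\<phi> k)))" .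
qed

text \<open>This is the nontrivial half of Caratheodory's condition for a half-space. The increments
  \<open>p m\<close> sum to the indicator of the open half-space; finitely many of them, together
  with a remainder that is 1 on the complement, form a smooth partition of unity.\<close>

lemma upper_integral_halfspace:
  "upper_integral (\<lambda>x. f x * indicator {x. a < x \<bullet> b} x) +
   upper_integral (\<lambda>x. f x * indicator {x. x \<bullet> b \<le> a} x) \<le> upper_integral f"
proof -
  define g where "g m x = flat (real m * (x \<bullet> b - a))" for m :: nat and x
  define p where "p m x = g (Suc m) x - g m x" for m x
  have g_smooth: "smooth (g m)" for m
    unfolding g_def by (intro smooth_flat smooth_mult smooth_const smooth_diff smooth_inner)
  have g_mono: "g m x \<le> g (Suc m) x" for m x
  proof (cases "x \<bullet> b \<le> a")
    case True
    then show ?thesis by (simp add: g_def flat_nonpos mult_nonneg_nonpos)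
  next
    case False
    then show ?thesis unfolding g_def by (intro flat_mono mult_right_mono) auto
  qed
  \<comment> \<open>There is no boundary term, because \<open>g 0\<close> is \<open>flat 0\<close>,
    which is 0.\<close>
  have tele: "(\<Sum>m<M. p m x) = g M x" for M x
    unfolding p_def by (subst sum_lessThan_telescope) (simp add: g_def flat_nonpos)
  have "(\<lambda>m. p m x) sums (if a < x \<bullet> b then 1 else 0)" for x
    unfolding sums_def tele g_def using flat_mult_nat_tendsto[of "x \<bullet> b - a"] by simp
  then have *: "(\<lambda>m. ennreal (p m x)) sums ennreal (if a < x \<bullet> b then 1 else 0)" for x
    using g_mono by (intro sums_ennreal[THEN iffD2]) (auto simp: p_def)
  then have sum1: "(\<Sum>m. ennreal (p m x)) = indicator {x. a < x \<bullet> b} x" for x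
    using sums_unique[OF *[of x]] by (cases "a < x \<bullet> b") auto
  have "upper_integral (\<lambda>x. f x * indicator {x. a < x \<bullet> b} x)
      = upper_integral (\<lambda>x. \<Sum>m. f x * ennreal (p m x))"
    by (simp add: sum1)
  also have "\<dots> \<le> (\<Sum>m. upper_integral (\<lambda>x. f x * ennreal (p m x)))"
    by (rule upper_integral_suminf)
  finally have 1: "upper_integral (\<lambda>x. f x * indicator {x. a < x \<bullet> b} x)
      \<le> (\<Sum>m. upper_integral (\<lambda>x. f x * ennreal (p m x)))" .
  have 2: "(\<Sum>m. upper_integral (\<lambda>x. f x * ennreal (p m x))) +
      upper_integral (\<lambda>x. f x * indicator {x. x \<bullet> b \<le> a} x) \<le> upper_integral f"
  proof (rule ennreal_suminf_bound_add)
    fix M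
    \<comment> \<open>Index M carries the remainder \<open>1 - g M x\<close>. It equals 1 on the
      closed half-space for every M, so its upper integral bounds the second term uniformly in
      M.\<close>
    define q where "q j x = (if j < M then p j x else 1 - g M x)" for j x
    have "(\<Sum>j\<in>{..M}. upper_integral (\<lambda>x. f x * ennreal (q j x))) \<le> upper_integral f"
    proof (rule upper_integral_partition)
      show "smooth (q j)" for j
        using g_smooth by (cases "j < M") (auto simp: q_def[abs_def] p_def intro!: smooth_diff smooth_const)
      show "0 \<le> q j x" for j x
        using g_mono flat_le_1 by (auto simp: q_def p_def g_def)
      have "(\<Sum>j\<le>M. q j x) = (\<Sum>j<M. p j x) + (1 - g M x)" for x
        by (simp add: lessThan_Suc_atMost[symmetric] q_def)
      then show "(\<Sum>j\<le>M. q j x) = 1" for x by (simp add: tele)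
    qed simp
    also have "(\<Sum>j\<in>{..M}. upper_integral (\<lambda>x. f x * ennreal (q j x))) =
        (\<Sum>m<M. upper_integral (\<lambda>x. f x * ennreal (p m x))) + upper_integral (\<lambda>x. f x * ennreal (1 - g M x))"
      by (simp add: lessThan_Suc_atMost[symmetric] q_def)
    finally have "(\<Sum>m<M. upper_integral (\<lambda>x. f x * ennreal (p m x))) +
        upper_integral (\<lambda>x. f x * ennreal (1 - g M x)) \<le> upper_integral f" .
    moreover have "upper_integral (\<lambda>x. f x * indicator {x. x \<bullet> b \<le> a} x)
        \<le> upper_integral (\<lambda>x. f x * ennreal (1 - g M x))"
      by (intro upper_integral_mono)
        (auto simp: indicator_def g_def flat_nonpos mult_nonneg_nonpos)
    ultimately show "(\<Sum>m<M. upper_integral (\<lambda>x. f x * ennreal (p m x))) +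
        upper_integral (\<lambda>x. f x * indicator {x. x \<bullet> b \<le> a} x) \<le> upper_integral f"
      by (meson add_left_mono order_trans)
  qed
  show ?thesis using add_right_mono[OF 1] 2 by (rule order_trans)
qed

section \<open>From the upper integral to Borel measures\<close>

definition upper_content :: "(real^'n \<Rightarrow> ennreal) \<Rightarrow> (real^'n) set \<Rightarrow> ennreal" where
  "upper_content f E = upper_integral (\<lambda>x. f x * indicator E x)"

text \<open>Caratheodory's construction, starting from an outer measure on all subsets. The
  half-space inequality, applied to f cut off to an arbitrary E, places the generators of the Borel
  sets in the lambda system.\<close>

lemma measure_space_upper_content: "measure_space UNIV (sets borel) (upper_content f)"
proof -
  interpret Pow: sigma_algebra UNIV "Pow (UNIV :: (real^'n) set)" by (rule sigma_algebra_Pow)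
  define L where "L = lambda_system UNIV (Pow UNIV) (upper_content f)"
  have "outer_measure_space (Pow UNIV) (upper_content f)"
    unfolding outer_measure_space_def
  proof (intro conjI)
    show "positive (Pow UNIV) (upper_content f)"
      by (simp add: positive_def upper_content_def upper_integral_0)
    show "increasing (Pow UNIV) (upper_content f)"
      by (auto simp: increasing_def upper_content_def intro!: upper_integral_mono mult_left_mono indicator_leI)
    show "countably_subadditive (Pow UNIV) (upper_content f)"
      unfolding countably_subadditive_def upper_content_def
    proof (intro allI impI)
      fix A :: "nat \<Rightarrow> (real^'n) set" assume "disjoint_family A"
      then have "f x * indicator (\<Union>i. A i) x = (\<Sum>i. f x * indicator (A i) x)" for x
        by (simp add: suminf_indicator)
      then show "upper_integral (\<lambda>x. f x * indicator (\<Union>i. A i) x)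
          \<le> (\<Sum>i. upper_integral (\<lambda>x. f x * indicator (A i) x))"
        using upper_integral_suminf[of "\<lambda>i x. f x * indicator (A i) x"] by simp
    qed
  qed
  then have L: "measure_space UNIV L (upper_content f)"
    unfolding L_def by (rule Pow.caratheodory_lemma)
  have "{x. a < x \<bullet> b} \<in> L" for a b
    unfolding L_def Pow.lambda_system_eq
  proof (intro CollectI conjI ballI)
    fix E :: "(real^'n) set"
    have "upper_content f (E \<inter> {x. a < x \<bullet> b}) + upper_content f (E - {x. a < x \<bullet> b}) \<le> upper_content f E"
    proof -
      have "f x * indicator (E \<inter> {x. a < x \<bullet> b}) x = f x * indicator E x * indicator {x. a < x \<bullet> b} x"
        "f x * indicator (E - {x. a < x \<bullet> b}) x = f x * indicator E x * indicator {x. x \<bullet> b \<le> a} x" for x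
        by (auto simp: indicator_def)
      then show ?thesis
        unfolding upper_content_def using upper_integral_halfspace[of "\<lambda>x. f x * indicator E x"] by simp
    qed
    moreover have "upper_content f E \<le> upper_content f (E \<inter> {x. a < x \<bullet> b}) + upper_content f (E - {x. a < x \<bullet> b})"
    proof -
      have "f x * indicator E x = f x * indicator (E \<inter> {x. a < x \<bullet> b}) x + f x * indicator (E - {x. a < x \<bullet> b}) x" for x
        by (auto simp: indicator_def)
      then show ?thesis unfolding upper_content_def
        using upper_integral_add[of "\<lambda>x. f x * indicator (E \<inter> {x. a < x \<bullet> b}) x"
            "\<lambda>x. f x * indicator (E - {x. a < x \<bullet> b}) x"] by simp
    qed
    ultimately show "upper_content f (E \<inter> {x. a < x \<bullet> b}) + upper_content f (E - {x. a < x \<bullet> b}) = upper_content f E"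
      by (rule antisym)
  qed simp
  then have "sets (borel :: (real^'n) measure) \<subseteq> L"
    using L unfolding measure_space_def
    by (subst borel_eq_halfspace_greater, simp, intro sigma_algebra.sigma_sets_subset) auto
  then show ?thesis
    using L unfolding measure_space_def
    by (auto simp: positive_def countably_additive_def sets.sigma_algebra_axioms[of borel, simplified])
qed

text \<open>There is one measure for each weight f. The weight 1 gives the representing measure; the
  other weights serve to bound its integrals by upper integrals.\<close>

definition upper_content_measure :: "(real^'n \<Rightarrow> ennreal) \<Rightarrow> (real^'n) measure" where
  "upper_content_measure f = measure_of UNIV (sets borel) (upper_content f)"

lemma sets_upper_content_measure [simp, measurable_cong]: "sets (upper_content_measure f) = sets borel"
  and space_upper_content_measure [simp]: "space (upper_content_measure f) = UNIV"
  and emeasure_upper_content_measure: "A \<in> sets borel \<Longrightarrow> emeasure (upper_content_measure f) A = upper_content f A"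
proof -
  show "sets (upper_content_measure f) = sets borel"
    unfolding upper_content_measure_def using sets.sigma_sets_eq[of "borel :: (real^'n) measure"]
    by simp
  show "space (upper_content_measure f) = UNIV"
    unfolding upper_content_measure_def by (simp add: space_measure_of_conv)
  show "A \<in> sets borel \<Longrightarrow> emeasure (upper_content_measure f) A = upper_content f A"
    using measure_space_upper_content[of f] unfolding upper_content_measure_def measure_space_def
    by (intro emeasure_measure_of_sigma) auto
qed

text \<open>It lives on the whole space. The complement of S has measure zero, since the zero
  sequence covers every function that vanishes on S.\<close>

definition riesz_measure :: "(real^'n) measure" where
  "riesz_measure = upper_content_measure (\<lambda>x. 1)"

lemma emeasure_riesz: "A \<in> sets borel \<Longrightarrow> emeasure riesz_measure A = upper_integral (indicator A)"
  unfolding riesz_measure_def by (simp add: emeasure_upper_content_measure upper_content_def[abs_def])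

text \<open>One direction is countable subadditivity along a series of simple functions with sum f.
  The other needs additivity, which the upper integral has only on Borel pieces of one fixed weight;
  the measure with weight f provides it.\<close>

lemma upper_integral_nn_integral:
  assumes f: "f \<in> borel_measurable borel"
  shows "upper_integral f = (\<integral>\<^sup>+x. f x \<partial>riesz_measure)"
proof (rule antisym)
  have [simp, measurable_cong]: "sets riesz_measure = sets borel" and [simp]: "space riesz_measure = UNIV"
    by (simp_all add: riesz_measure_def)
  have simple_ui: "y * upper_integral (indicator (s -` {y})) = y * emeasure riesz_measure (s -` {y})"
    if "simple_function riesz_measure s" for s and y :: ennreal
    using simple_functionD(2)[OF that, of "{y}"] by (simp add: emeasure_riesz)
  have simple: "upper_integral s \<le> (\<integral>\<^sup>+x. s x \<partial>riesz_measure)"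
    if s: "simple_function riesz_measure s" "\<And>x. s x < top" for s
  proof -
    have fin: "finite (range s)" using simple_functionD(1)[OF s(1)] by simp
    have "upper_integral s = upper_integral (\<lambda>x. \<Sum>y\<in>range s. y * indicator (s -` {y}) x)"
      by (subst simple_function_eq_sum[OF fin, abs_def]) (rule refl)
    also have "\<dots> \<le> (\<Sum>y\<in>range s. upper_integral (\<lambda>x. y * indicator (s -` {y}) x))"
      by (rule upper_integral_sum[OF fin])
    also have "\<dots> = (\<Sum>y\<in>range s. y * emeasure riesz_measure (s -` {y}))"
      using s(2) by (intro sum.cong refl) (auto simp: upper_integral_scale simple_ui[OF s(1), symmetric])
    also have "\<dots> = (\<integral>\<^sup>+x. s x \<partial>riesz_measure)"
      using s(1) by (simp add: nn_integral_eq_simple_integral simple_integral_def)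
    finally show ?thesis .
  qed
  show "upper_integral f \<le> (\<integral>\<^sup>+x. f x \<partial>riesz_measure)"
  proof -
    obtain s where s: "\<And>i. simple_function riesz_measure (s i)" "incseq s" "\<And>i x. s i x < top"
      "\<And>x. (SUP i. s i x) = f x"
      using borel_measurable_implies_simple_function_sequence'[of f riesz_measure] f by auto
    \<comment> \<open>The increments of the simple sequence, with \<open>s 0\<close> as the first.
      Finite values are inherited from \<open>s\<close>, and the scaling rule for upper integrals
      asks for them.\<close>
    define d where "d i x = (if i = 0 then s 0 x else s i x - s (i - 1) x)" for i x
    have d_simple: "simple_function riesz_measure (d i)" for i
      using s(1) by (cases "i = 0") (simp_all add: d_def[abs_def] simple_function_diff)
    have d_fin: "d i x < top" for i x
      using s(3) by (auto simp: d_def intro: le_less_trans[OF diff_le_self_ennreal])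
    have d_sum: "(\<Sum>i<Suc n. d i x) = s n x" for n x
    proof (induction n)
      case (Suc n)
      have "s n x \<le> s (Suc n) x" using s(2) by (simp add: incseq_Suc_iff le_fun_def)
      then show ?case using Suc by (simp add: d_def add_diff_inverse_ennreal)
    qed (simp add: d_def)
    have lim: "(\<lambda>n. \<Sum>i<Suc n. d i x) \<longlonglongrightarrow> f x" for x
      unfolding d_sum s(4)[symmetric] using s(2)
      by (intro LIMSEQ_SUP) (auto simp: incseq_def le_fun_def)
    then have "(\<lambda>i. d i x) sums f x" for x
      unfolding sums_def by (subst filterlim_sequentially_Suc[symmetric]) (rule lim)
    then have f_eq: "f x = (\<Sum>i. d i x)" for x by (rule sums_unique)
    have "upper_integral f = upper_integral (\<lambda>x. \<Sum>i. d i x)" by (simp add: f_eq[abs_def])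
    also have "\<dots> \<le> (\<Sum>i. upper_integral (d i))" by (rule upper_integral_suminf)
    also have "\<dots> \<le> (\<Sum>i. \<integral>\<^sup>+x. d i x \<partial>riesz_measure)"
      by (intro suminf_le summableI simple d_simple d_fin)
    also have "\<dots> = (\<integral>\<^sup>+x. (\<Sum>i. d i x) \<partial>riesz_measure)"
      using d_simple by (intro nn_integral_suminf[symmetric] borel_measurable_simple_function)
    finally show ?thesis by (simp add: f_eq[symmetric])
  qed
  show "(\<integral>\<^sup>+x. f x \<partial>riesz_measure) \<le> upper_integral f"
    unfolding nn_integral_def_finite
  proof (rule SUP_least, clarsimp)
    fix s assume s: "simple_function riesz_measure s" "s \<le> f" "\<forall>x. s x < top"
    have fin: "finite (range s)" using simple_functionD(1)[OF s(1)] by simp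
    have meas: "s -` {y} \<in> sets borel" for y
      using simple_functionD(2)[OF s(1), of "{y}"] by simp
    have "integral\<^sup>S riesz_measure s = (\<Sum>y\<in>range s. y * upper_integral (indicator (s -` {y})))"
      using simple_ui[OF s(1)] by (simp add: simple_integral_def)
    also have "\<dots> = (\<Sum>y\<in>range s. upper_integral (\<lambda>x. y * indicator (s -` {y}) x))"
      using s(3) by (intro sum.cong refl) (auto simp: upper_integral_scale)
    \<comment> \<open>On the level set of y the constant y is at most f. After passing to f, the
      level sets are disjoint pieces for one and the same measure and their contents add up.\<close>
    also have "\<dots> \<le> (\<Sum>y\<in>range s. upper_content f (s -` {y}))"
      unfolding upper_content_def using s(2)
      by (intro sum_mono upper_integral_mono) (auto simp: indicator_def le_fun_def, metis)
    also have "\<dots> = (\<Sum>y\<in>range s. emeasure (upper_content_measure f) (s -` {y}))"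
      using meas by (simp add: emeasure_upper_content_measure)
    also have "\<dots> = emeasure (upper_content_measure f) (\<Union>y\<in>range s. s -` {y})"
      using meas fin by (intro sum_emeasure) (auto simp: disjoint_family_on_def)
    also have "(\<Union>y\<in>range s. s -` {y}) = UNIV" by auto
    also have "emeasure (upper_content_measure f) UNIV = upper_integral f"
      by (simp add: emeasure_upper_content_measure upper_content_def)
    finally show "integral\<^sup>S riesz_measure s \<le> upper_integral f" .
  qed
qed

text \<open>The freedom in U serves two ends: U = S gives local finiteness, and a smaller U shows
  that the measure vanishes wherever the functional does.\<close>

lemma emeasure_riesz_compact:
  assumes "compact K" "K \<subseteq> U" "open U" "U \<subseteq> S"
  obtains \<eta> where "\<eta> \<in> test_functions U" "\<And>x. 0 \<le> \<eta> x" "\<And>x. x \<in> K \<Longrightarrow> 1 \<le> \<eta> x"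
    "emeasure riesz_measure K \<le> ennreal (T \<eta>)"
proof -
  obtain \<eta> where \<eta>: "\<eta> \<in> test_functions U" "\<And>x. 0 \<le> \<eta> x" "\<And>x. x \<in> K \<Longrightarrow> 1 \<le> \<eta> x"
    using test_function_ge_1[OF assms(1-3)] by blast
  have "emeasure riesz_measure K = upper_integral (indicator K)"
    using assms(1) by (simp add: emeasure_riesz borel_compact)
  also have "\<dots> \<le> upper_integral (\<lambda>x. ennreal (\<eta> x))"
    using \<eta> by (intro upper_integral_mono) (auto simp: indicator_def)
  also have "\<dots> = ennreal (T \<eta>)"
    using \<eta> test_functions_mono[OF assms(4)] by (intro upper_integral_test) (auto simp: nonneg_tests_def)
  finally show ?thesis using \<eta> that by blast
qed

lemma has_bochner_integral_riesz_nonneg: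
  assumes "\<phi> \<in> nonneg_tests"
  shows "has_bochner_integral riesz_measure \<phi> (T \<phi>)"
proof (rule has_bochner_integral_nn_integral)
  have \<phi>: "\<phi> \<in> test_functions S" "\<And>x. 0 \<le> \<phi> x" using assms by (auto simp: nonneg_tests_def)
  have m: "\<phi> \<in> borel_measurable borel" using borel_measurable_test[OF \<phi>(1)] .
  then show "\<phi> \<in> borel_measurable riesz_measure"
    by (simp add: riesz_measure_def cong: measurable_cong_sets)
  show "AE x in riesz_measure. 0 \<le> \<phi> x" using \<phi> by simp
  show "0 \<le> T \<phi>" using T_nonneg assms by simp
  show "(\<integral>\<^sup>+x. ennreal (\<phi> x) \<partial>riesz_measure) = ennreal (T \<phi>)"
    using upper_integral_nn_integral[of "\<lambda>x. ennreal (\<phi> x)"] upper_integral_test[OF assms] m by simp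
qed

text \<open>The positive part of a test function need not be smooth. Adding
  \<open>C * \<eta> x\<close>, with \<eta> at least 1 on the support, makes it nonnegative within
  the class, and linearity removes the addition again.\<close>

lemma has_bochner_integral_riesz:
  assumes \<phi>: "\<phi> \<in> test_functions S"
  shows "has_bochner_integral riesz_measure \<phi> (T \<phi>)"
proof -
  obtain K where K: "compact K" "K \<subseteq> S" "\<And>x. x \<notin> K \<Longrightarrow> \<phi> x = 0"
    using test_functions_support[OF \<phi>] by blast
  obtain \<eta> where \<eta>: "\<eta> \<in> test_functions S" "\<And>x. 0 \<le> \<eta> x" "\<And>x. x \<in> K \<Longrightarrow> 1 \<le> \<eta> x"
    using test_function_ge_1[OF K(1,2) open_domain] by blast
  obtain C where C: "\<And>x. \<bar>\<phi> x\<bar> \<le> C" "C \<ge> 0"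
    using test_functions_bounded[OF \<phi>] by blast
  have C\<eta>: "(\<lambda>x. C * \<eta> x) \<in> test_functions S" by (rule test_functions_scale[OF \<eta>(1)])
  have "0 \<le> \<phi> x + C * \<eta> x" for x
  proof (cases "x \<in> K")
    case True
    have "C * 1 \<le> C * \<eta> x" using \<eta>(3)[OF True] C(2) by (intro mult_left_mono) auto
    then show ?thesis using C(1)[of x] by linarith
  qed (use K(3) C \<eta> in simp)
  then have "(\<lambda>x. \<phi> x + C * \<eta> x) \<in> nonneg_tests"
    using test_functions_add[OF \<phi> C\<eta>] by (simp add: nonneg_tests_def)
  from has_bochner_integral_riesz_nonneg[OF this]
  have "has_bochner_integral riesz_measure (\<lambda>x. \<phi> x + C * \<eta> x) (T \<phi> + T (\<lambda>x. C * \<eta> x))"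
    by (simp add: T_add[OF \<phi> C\<eta>])
  moreover have "has_bochner_integral riesz_measure (\<lambda>x. C * \<eta> x) (T (\<lambda>x. C * \<eta> x))"
    using C \<eta> C\<eta> by (intro has_bochner_integral_riesz_nonneg) (simp add: nonneg_tests_def)
  ultimately show ?thesis
    using has_bochner_integral_diff by fastforce
qed

text \<open>The last clause is the form in which complementarity is used: U is exhausted by compact
  sets, and each is dominated by a test function supported in U on which the functional is
  0.\<close>

theorem riesz_representation:
  obtains \<mu> where "radon_measure_on S \<mu>" "\<And>\<phi>. \<phi> \<in> test_functions S \<Longrightarrow> T \<phi> = (LINT x|\<mu>. \<phi> x)"
    "\<And>U. open U \<Longrightarrow> U \<subseteq> S \<Longrightarrow> (\<And>\<eta>. \<eta> \<in> test_functions U \<Longrightarrow> (\<And>x. 0 \<le> \<eta> x) \<Longrightarrow> T \<eta> = 0) \<Longrightarrow> AE x in \<mu>. x \<notin> U"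
proof
  let ?\<mu> = "restrict_space riesz_measure S"
  have [simp]: "sets riesz_measure = sets borel" "space riesz_measure = UNIV"
    by (simp_all add: riesz_measure_def)
  have [simp]: "S \<in> sets borel" using open_domain by simp
  show "radon_measure_on S ?\<mu>"
    unfolding radon_measure_on_def
  proof (intro conjI allI impI)
    show "sets ?\<mu> = sets (restrict_space borel S)" by (simp add: sets_restrict_space)
    fix K assume K: "compact K \<and> K \<subseteq> S"
    obtain \<eta> where "emeasure riesz_measure K \<le> ennreal (T \<eta>)"
      using emeasure_riesz_compact[of K S] K open_domain by (metis order_refl)
    then have "emeasure riesz_measure K < \<infinity>" by (rule le_less_trans) simp
    then show "emeasure ?\<mu> K < \<infinity>" using K by (simp add: emeasure_restrict_space)
  qed
  show "T \<phi> = (LINT x|?\<mu>. \<phi> x)" if \<phi>: "\<phi> \<in> test_functions S" for \<phi>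
  proof -
    have "indicator S x *\<^sub>R \<phi> x = \<phi> x" for x
      using test_functions_support[OF \<phi>] by (metis indicator_simps(1) indicator_simps(2) scaleR_one scaleR_zero_right subsetD)
    then have "(LINT x|?\<mu>. \<phi> x) = (LINT x|riesz_measure. \<phi> x)"
      by (simp add: integral_restrict_space del: real_scaleR_def)
    then show ?thesis using has_bochner_integral_riesz[OF \<phi>] by (simp add: has_bochner_integral_integral_eq)
  qed
  show "AE x in ?\<mu>. x \<notin> U"
    if U: "open U" "U \<subseteq> S" and T0: "\<And>\<eta>. \<eta> \<in> test_functions U \<Longrightarrow> (\<And>x. 0 \<le> \<eta> x) \<Longrightarrow> T \<eta> = 0" for U
  proof -
    obtain C where C: "\<And>n::nat. compact (C n)" "\<And>n. C n \<subseteq> U" "\<Union>(range C) = U"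
      using open_Union_compact_subsets[OF U(1)] by metis
    have "emeasure riesz_measure (C n) = 0" for n
    proof -
      obtain \<eta> where \<eta>: "\<eta> \<in> test_functions U" "\<And>x. 0 \<le> \<eta> x" "emeasure riesz_measure (C n) \<le> ennreal (T \<eta>)"
        by (rule emeasure_riesz_compact[OF C(1,2) U, of n]) blast
      then have "T \<eta> = 0" by (intro T0) auto
      then show ?thesis using \<eta>(3) by simp
    qed
    then have "AE x in riesz_measure. x \<notin> C n" for n
      using C(1) by (intro AE_not_in) (auto simp: null_sets_def borel_compact)
    then have "AE x in riesz_measure. \<forall>n. x \<notin> C n" by (simp add: AE_all_countable)
    then have "AE x in riesz_measure. x \<notin> U" using C(3) by (auto elim!: eventually_mono)
    then show ?thesis by (subst AE_restrict_space_iff) auto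
  qed
qed

end

section \<open>Square-integrable functions\<close>

definition square_integrable :: "'a measure \<Rightarrow> ('a \<Rightarrow> real) \<Rightarrow> bool" where
  "square_integrable M f \<longleftrightarrow> f \<in> borel_measurable M \<and> integrable M (\<lambda>x. (f x)\<^sup>2)"

lemma L2_iff: "w \<in> L2 S \<longleftrightarrow> square_integrable (lebesgue_on S) w"
  by (simp add: L2_def square_integrable_def)

lemma square_integrable_measurable [measurable_dest]:
  "square_integrable M f \<Longrightarrow> f \<in> borel_measurable M"
  by (simp add: square_integrable_def)

lemma square_integrable_mult:
  assumes "square_integrable M f" "square_integrable M g"
  shows "integrable M (\<lambda>x. f x * g x)"
proof (rule Bochner_Integration.integrable_bound)
  show "integrable M (\<lambda>x. (f x)\<^sup>2 + (g x)\<^sup>2)"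
    using assms by (simp add: square_integrable_def)
  show "(\<lambda>x. f x * g x) \<in> borel_measurable M"
    using assms by (intro borel_measurable_times square_integrable_measurable)
  have "\<bar>a * b\<bar> \<le> a\<^sup>2 + b\<^sup>2" for a b :: real
    using sum_squares_bound[of "\<bar>a\<bar>" "\<bar>b\<bar>"] mult_nonneg_nonneg[of "\<bar>a\<bar>" "\<bar>b\<bar>"]
    unfolding abs_mult power2_abs by linarith
  then show "AE x in M. norm (f x * g x) \<le> norm ((f x)\<^sup>2 + (g x)\<^sup>2)" by (auto intro!: AE_I2)
qed

lemma square_integrable_add:
  assumes "square_integrable M f" "square_integrable M g"
  shows "square_integrable M (\<lambda>x. f x + g x)"
proof -
  have "integrable M (\<lambda>x. (f x)\<^sup>2 + (g x)\<^sup>2 + 2 * (f x * g x))"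
    using assms square_integrable_mult[OF assms] by (auto simp: square_integrable_def)
  moreover have "(\<lambda>x. f x + g x) \<in> borel_measurable M"
    using assms by (intro borel_measurable_add square_integrable_measurable)
  ultimately show ?thesis by (simp add: square_integrable_def power2_sum mult.assoc)
qed

lemma square_integrable_scale:
  "square_integrable M f \<Longrightarrow> square_integrable M (\<lambda>x. c * f x)"
  by (auto simp: square_integrable_def power_mult_distrib)

lemma square_integrable_diff:
  "square_integrable M f \<Longrightarrow> square_integrable M g \<Longrightarrow> square_integrable M (\<lambda>x. f x - g x)"
  using square_integrable_add[of M f "\<lambda>x. (-1) * g x"] square_integrable_scale[of M g "-1"] by simp

lemma square_integrable_bounded_mult:
  assumes "square_integrable M f" "h \<in> borel_measurable M" "\<And>x. x \<in> space M \<Longrightarrow> \<bar>h x\<bar> \<le> C"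
  shows "square_integrable M (\<lambda>x. h x * f x)"
proof -
  have "integrable M (\<lambda>x. (h x * f x)\<^sup>2)"
  proof (rule Bochner_Integration.integrable_bound)
    show "integrable M (\<lambda>x. C\<^sup>2 * (f x)\<^sup>2)" using assms by (simp add: square_integrable_def)
    show "(\<lambda>x. (h x * f x)\<^sup>2) \<in> borel_measurable M"
      using square_integrable_measurable[OF assms(1)] assms(2) by simp
    have "(h x)\<^sup>2 * (f x)\<^sup>2 \<le> C\<^sup>2 * (f x)\<^sup>2" if "x \<in> space M" for x
      using assms(3)[OF that] abs_le_square_iff[of "h x" C] by (intro mult_right_mono) (auto simp: abs_le_iff)
    then show "AE x in M. norm ((h x * f x)\<^sup>2) \<le> norm (C\<^sup>2 * (f x)\<^sup>2)"
      by (auto intro!: AE_I2 simp: power_mult_distrib)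
  qed
  moreover have "(\<lambda>x. h x * f x) \<in> borel_measurable M"
    using square_integrable_measurable[OF assms(1)] assms(2) by simp
  ultimately show ?thesis by (simp add: square_integrable_def)
qed

text \<open>The polynomial a + 2 t b + t^2 c, the integral of (f + t g)^2, is nonnegative for all t.
  For c > 0 it is evaluated at its minimum; for c = 0 the chosen t would give the value -1 unless b
  = 0.\<close>

lemma Cauchy_Schwarz_integral:
  assumes "square_integrable M f" "square_integrable M g"
  shows "\<bar>LINT x|M. f x * g x\<bar> \<le> sqrt (LINT x|M. (f x)\<^sup>2) * sqrt (LINT x|M. (g x)\<^sup>2)"
proof -
  define a where "a = (LINT x|M. (f x)\<^sup>2)"
  define b where "b = (LINT x|M. f x * g x)"
  define c where "c = (LINT x|M. (g x)\<^sup>2)"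
  have nn: "0 \<le> a + 2 * t * b + t\<^sup>2 * c" for t
  proof -
    have "0 \<le> (LINT x|M. (f x + t * g x)\<^sup>2)" by simp
    also have "\<dots> = (LINT x|M. (f x)\<^sup>2 + (2 * t) * (f x * g x) + t\<^sup>2 * (g x)\<^sup>2)"
      by (intro Bochner_Integration.integral_cong) (auto simp: power2_eq_square algebra_simps)
    also have "\<dots> = a + 2 * t * b + t\<^sup>2 * c"
      using assms square_integrable_mult[OF assms]
      by (simp add: square_integrable_def a_def b_def c_def)
    finally show ?thesis .
  qed
  have "c \<ge> 0" "a \<ge> 0" by (simp_all add: c_def a_def)
  have "b\<^sup>2 \<le> a * c"
  proof (cases "c = 0")
    case True
    have "b = 0"
    proof (rule ccontr)
      assume "b \<noteq> 0"
      then show False using nn[of "- (a + 1) / (2 * b)"] True by (simp add: field_simps)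
    qed
    then show ?thesis using True by simp
  next
    case False
    then have "c > 0" using \<open>c \<ge> 0\<close> by simp
    then show ?thesis using nn[of "- b / c"] by (simp add: field_simps power2_eq_square)
  qed
  then have "sqrt (b\<^sup>2) \<le> sqrt (a * c)" by (rule real_sqrt_le_mono)
  then show ?thesis by (simp add: real_sqrt_mult a_def b_def c_def)
qed

text \<open>Weaker than the triangle inequality but free of square roots; it comes from (f - g)^2
  \<ge> 0. The factor 2 reappears in the estimates of Sobolev norms.\<close>

lemma integral_square_add_le:
  assumes "square_integrable M f" "square_integrable M g"
  shows "(LINT x|M. (f x + g x)\<^sup>2) \<le> 2 * (LINT x|M. (f x)\<^sup>2) + 2 * (LINT x|M. (g x)\<^sup>2)"
proof -
  have "(LINT x|M. (f x + g x)\<^sup>2) \<le> (LINT x|M. 2 * (f x)\<^sup>2 + 2 * (g x)\<^sup>2)"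
  proof (rule integral_mono)
    show "integrable M (\<lambda>x. (f x + g x)\<^sup>2)"
      using square_integrable_add[OF assms] by (simp add: square_integrable_def)
    show "(f x + g x)\<^sup>2 \<le> 2 * (f x)\<^sup>2 + 2 * (g x)\<^sup>2" for x
      using sum_squares_bound[of "f x" "g x"] by (simp add: power2_sum)
  qed (use assms in \<open>simp add: square_integrable_def\<close>)
  then show ?thesis using assms by (simp add: square_integrable_def)
qed

section \<open>Integrals of test functions\<close>

lemma continuous_compact_support_integrable:
  fixes f :: "real^'n::finite \<Rightarrow> real"
  assumes "continuous_on UNIV f" "compact K" "\<And>x. x \<notin> K \<Longrightarrow> f x = 0"
  shows "integrable lborel f"
proof -
  have "integrable lborel (\<lambda>x. indicator K x *\<^sub>R f x)"
    using assms by (intro borel_integrable_compact) (auto intro: continuous_on_subset)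
  moreover have "(\<lambda>x. indicator K x *\<^sub>R f x) = f"
  proof
    show "indicator K x *\<^sub>R f x = f x" for x using assms(3) by (cases "x \<in> K") auto
  qed
  ultimately show ?thesis by simp
qed

lemma test_function_continuous: "\<phi> \<in> test_functions U \<Longrightarrow> continuous_on UNIV \<phi>"
  using smooth_imp_continuous test_smooth by blast

lemma test_function_integrable:
  assumes "\<phi> \<in> test_functions U"
  shows "integrable lborel \<phi>"
proof -
  obtain K where K: "compact K" "K \<subseteq> U" "\<And>x. x \<notin> K \<Longrightarrow> \<phi> x = 0"
    using test_functions_support[OF assms] by blast
  then show ?thesis using test_function_continuous[OF assms]
    by (intro continuous_compact_support_integrable)
qed

lemma test_function_square_integrable:
  assumes "\<phi> \<in> test_functions U"
  shows "square_integrable lborel \<phi>"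
  using test_function_integrable[OF test_functions_mult[OF test_smooth[OF assms] assms]]
    borel_measurable_test[OF assms]
  by (simp add: square_integrable_def power2_eq_square)

lemma has_derivative_along_line:
  assumes "g differentiable (at (x + t *\<^sub>R axis i 1))"
  shows "((\<lambda>t. g (x + t *\<^sub>R axis i 1)) has_real_derivative partial_deriv i g (x + t *\<^sub>R axis i 1)) (at t)"
proof -
  have 1: "((\<lambda>t. x + t *\<^sub>R axis i 1) has_derivative (\<lambda>h. h *\<^sub>R axis i 1)) (at t)"
    by (auto intro!: derivative_eq_intros)
  have lin: "linear (frechet_derivative g (at (x + t *\<^sub>R axis i 1)))"
    using differentiable_imp_frechet[OF assms] has_derivative_linear by blast
  have "((\<lambda>t. g (x + t *\<^sub>R axis i 1)) has_derivative
      (\<lambda>h. frechet_derivative g (at (x + t *\<^sub>R axis i 1)) (h *\<^sub>R axis i 1))) (at t)"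
    by (rule has_derivative_compose[OF 1 differentiable_imp_frechet[OF assms]])
  then show ?thesis
    using lin by (simp add: has_field_derivative_def linear_cmul partial_deriv_def mult_commute_abs)
qed

text \<open>Translation invariance makes every difference quotient integrate to zero.\<close>

lemma integral_partial_deriv_eq_0:
  fixes \<psi> :: "real^'n::finite \<Rightarrow> real"
  assumes \<psi>: "\<psi> \<in> test_functions U"
  shows "(LINT x|lborel. partial_deriv i \<psi> x) = 0"
proof -
  obtain K where K: "compact K" "K \<subseteq> U" "\<And>x. x \<notin> K \<Longrightarrow> \<psi> x = 0"
    using test_functions_support[OF \<psi>] by blast
  obtain R where R: "\<And>x. x \<in> K \<Longrightarrow> norm x \<le> R"
    using compact_imp_bounded[OF K(1)] unfolding bounded_iff by blast
  obtain C where C: "\<And>x. \<bar>partial_deriv i \<psi> x\<bar> \<le> C" "C \<ge> 0"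
    using test_functions_bounded[OF test_functions_partial_deriv[OF \<psi>]] by blast
  define e :: "real^'n" where "e = axis i 1"
  define h where "h n = inverse (real (Suc n))" for n
  have h: "0 < h n" "h n \<le> 1" for n by (auto simp: h_def field_simps)
  define d where "d n x = (\<psi> (x + h n *\<^sub>R e) - \<psi> x) / h n" for n x
  have [measurable]: "\<psi> \<in> borel_measurable borel" using borel_measurable_test[OF \<psi>] .
  have diff: "\<psi> differentiable (at x)" for x using smooth_imp_differentiable[OF test_smooth[OF \<psi>]] .
  have line: "((\<lambda>t. \<psi> (x + t *\<^sub>R e)) has_real_derivative partial_deriv i \<psi> (x + t *\<^sub>R e)) (at t)" for x t
    unfolding e_def by (rule has_derivative_along_line[OF diff])
  have shift: "(LINT x|lborel. \<psi> (x + v)) = (LINT x|lborel. \<psi> x)" "integrable lborel (\<lambda>x. \<psi> (x + v))" for v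
  proof -
    have "(LINT x|lborel. \<psi> x) = (LINT x|distr lborel borel ((+) v). \<psi> x)" by (simp add: lborel_distr_plus)
    also have "\<dots> = (LINT x|lborel. \<psi> (v + x))" by (rule integral_distr) auto
    finally show "(LINT x|lborel. \<psi> (x + v)) = (LINT x|lborel. \<psi> x)" by (simp add: add.commute)
    have "integrable (distr lborel borel ((+) v)) \<psi>"
      using test_function_integrable[OF \<psi>] by (simp add: lborel_distr_plus)
    then have "integrable lborel (\<lambda>x. \<psi> (v + x))" by (subst (asm) integrable_distr_eq) auto
    then show "integrable lborel (\<lambda>x. \<psi> (x + v))" by (simp add: add.commute)
  qed
  have d0: "(LINT x|lborel. d n x) = 0" for n
    unfolding d_def using shift test_function_integrable[OF \<psi>] by simp
  have "(\<lambda>n. LINT x|lborel. d n x) \<longlonglongrightarrow> (LINT x|lborel. partial_deriv i \<psi> x)"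
  proof (rule integral_dominated_convergence)
    show "partial_deriv i \<psi> \<in> borel_measurable lborel"
      using borel_measurable_test[OF test_functions_partial_deriv[OF \<psi>]] by simp
    show "d n \<in> borel_measurable lborel" for n unfolding d_def by measurable
    \<comment> \<open>Steps are at most 1, so every difference quotient vanishes outside the ball of
      radius R + 1; inside, the mean value theorem bounds it by C.\<close>
    show "integrable lborel (\<lambda>x :: real^'n. C * indicator (cball 0 (R + 1)) x :: real)"
      by (intro integrable_mult_right integrable_real_indicator)
        (use emeasure_lborel_cball_finite[of "0 :: real^'n" "R + 1"] in auto)
    have "(\<lambda>n. d n x) \<longlonglongrightarrow> partial_deriv i \<psi> x" for x
    proof -
      have "((\<lambda>t. (\<psi> (x + t *\<^sub>R e) - \<psi> x) / t) \<longlongrightarrow> partial_deriv i \<psi> x) (at 0)"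
        using line[of x 0] by (simp add: has_field_derivative_iff)
      moreover have "filterlim h (at 0) sequentially"
        unfolding filterlim_at using h LIMSEQ_inverse_real_of_nat
        by (auto simp: h_def[abs_def])
      ultimately show ?thesis unfolding d_def by (rule filterlim_compose)
    qed
    then show "AE x in lborel. (\<lambda>n. d n x) \<longlonglongrightarrow> partial_deriv i \<psi> x" by simp
    have "\<bar>d n x\<bar> \<le> C * indicator (cball 0 (R + 1)) x" for n x
    proof (cases "norm x \<le> R + 1")
      case True
      obtain z where "\<psi> (x + h n *\<^sub>R e) - \<psi> (x + 0 *\<^sub>R e) = (h n - 0) * partial_deriv i \<psi> (x + z *\<^sub>R e)"
        using MVT2[OF h(1)[of n] line] by blast
      then have "d n x = partial_deriv i \<psi> (x + z *\<^sub>R e)" using h(1)[of n] by (simp add: d_def)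
      then show ?thesis using C(1) True by simp
    next
      case False
      have "norm x \<le> norm (x + h n *\<^sub>R e) + norm (h n *\<^sub>R e)"
        using norm_triangle_ineq4[of "x + h n *\<^sub>R e" "h n *\<^sub>R e"] by simp
      moreover have "norm (h n *\<^sub>R e) \<le> 1" using h[of n] by (simp add: e_def norm_axis_1)
      ultimately have "x + h n *\<^sub>R e \<notin> K" using R False by force
      moreover have "x \<notin> K" using R False by force
      ultimately show ?thesis using K(3) False by (simp add: d_def)
    qed
    then show "AE x in lborel. norm (d n x) \<le> C * indicator (cball 0 (R + 1)) x" for n by simp
  qed
  then show ?thesis using d0 LIMSEQ_unique[OF _ tendsto_const] by auto
qed

lemma integral_lebesgue_on_test:
  assumes "open S" "f \<in> borel_measurable borel" "\<And>x. x \<notin> S \<Longrightarrow> f x = 0"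
  shows "(LINT x|lebesgue_on S. f x) = (LINT x|lborel. (f x :: real))"
    "integrable (lebesgue_on S) f \<longleftrightarrow> integrable lborel f"
proof -
  have *: "(\<lambda>x. indicator S x *\<^sub>R f x) = f"
  proof
    show "indicator S x *\<^sub>R f x = f x" for x using assms(3) by (cases "x \<in> S") auto
  qed
  have "S \<in> sets lebesgue" using assms(1) by auto
  then show "(LINT x|lebesgue_on S. f x) = (LINT x|lborel. f x)"
    "integrable (lebesgue_on S) f \<longleftrightarrow> integrable lborel f"
    using assms(2) by (simp_all add: integral_restrict_space integrable_restrict_space * integral_completion
        integrable_completion del: real_scaleR_def)
qed

lemma test_function_zero_outside: "\<phi> \<in> test_functions S \<Longrightarrow> x \<notin> S \<Longrightarrow> \<phi> x = 0"
  using test_functions_support by (metis subsetD)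

lemma test_function_L2:
  assumes "open S" "\<phi> \<in> test_functions S"
  shows "\<phi> \<in> L2 S"
proof -
  have [measurable]: "\<phi> \<in> borel_measurable borel" using borel_measurable_test[OF assms(2)] .
  have "\<phi> \<in> borel_measurable (lebesgue_on S)"
    by (intro measurable_restrict_space1 measurable_completion) simp
  moreover have "integrable (lebesgue_on S) (\<lambda>x. (\<phi> x)\<^sup>2)"
    using test_function_square_integrable[OF assms(2)] test_function_zero_outside[OF assms(2)]
    by (subst integral_lebesgue_on_test[OF assms(1)]) (auto simp: square_integrable_def)
  ultimately show ?thesis by (simp add: L2_def)
qed

section \<open>The fundamental lemma of the calculus of variations\<close>

text \<open>The sets \<open>A\<close> with \<open>\<integral>\<^sub>A g \<psi> = 0\<close> for all test functions \<open>\<psi>\<close> are stable under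
  intersection with half-spaces, because the smooth approximations of the indicator of a half-space
  can be absorbed into \<open>\<psi>\<close>; hence they are stable under intersection with all Borel sets.\<close>

lemma annihilated_borel:
  fixes g :: "real^'n::finite \<Rightarrow> real"
  assumes int: "\<And>\<psi>. \<psi> \<in> test_functions S \<Longrightarrow> integrable (lebesgue_on S) (\<lambda>x. g x * \<psi> x)"
    and zero: "\<And>\<psi>. \<psi> \<in> test_functions S \<Longrightarrow> (LINT x|lebesgue_on S. g x * \<psi> x) = 0"
    and B: "B \<in> sets borel" and \<psi>: "\<psi> \<in> test_functions S"
  shows "(LINT x|lebesgue_on S. g x * \<psi> x * indicator B x) = 0"
proof -
  let ?M = "lebesgue_on S"
  define D where "D = {A \<in> sets borel. \<forall>\<psi>\<in>test_functions S. (LINT x|?M. g x * \<psi> x * indicator A x) = 0}"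
  have ind [measurable]: "(indicator A :: _ \<Rightarrow> real) \<in> borel_measurable ?M" if "A \<in> sets borel" for A
    using that by (intro measurable_restrict_space1 measurable_completion) simp
  have inti: "integrable ?M (\<lambda>x. g x * \<psi> x * indicator A x)" if "\<psi> \<in> test_functions S" "A \<in> sets borel" for \<psi> A
  proof (rule Bochner_Integration.integrable_bound[OF int[OF that(1)]])
    show "(\<lambda>x. g x * \<psi> x * indicator A x) \<in> borel_measurable ?M"
      by (intro borel_measurable_times[OF borel_measurable_integrable[OF int[OF that(1)]] ind[OF that(2)]])
  qed (auto simp: indicator_def)
  have lim: "(LINT x|?M. g x * \<psi> x * indicator A x) = 0"
    if "\<psi> \<in> test_functions S" "A \<in> sets borel"
      and s: "\<And>n. s n \<in> borel_measurable ?M" "\<And>n x. \<bar>s n x\<bar> \<le> 1" "\<And>x. (\<lambda>n. s n x) \<longlonglongrightarrow> indicator A x"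
      and s0: "\<And>n. (LINT x|?M. g x * \<psi> x * s n x) = 0" for A \<psi> and s :: "nat \<Rightarrow> _ \<Rightarrow> real"
  proof -
    have "(\<lambda>n. LINT x|?M. g x * \<psi> x * s n x) \<longlonglongrightarrow> (LINT x|?M. g x * \<psi> x * indicator A x)"
    proof (rule integral_dominated_convergence)
      show "integrable ?M (\<lambda>x. \<bar>g x * \<psi> x\<bar>)" using int[OF that(1)] by simp
      show "AE x in ?M. (\<lambda>n. g x * \<psi> x * s n x) \<longlonglongrightarrow> g x * \<psi> x * indicator A x"
        using s(3) by (auto intro!: AE_I2 tendsto_mult)
      show "AE x in ?M. norm (g x * \<psi> x * s n x) \<le> \<bar>g x * \<psi> x\<bar>" for n
        using s(2) by (auto intro!: AE_I2 mult_left_le simp: abs_mult)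
    qed (use int[OF that(1)] ind[OF that(2)] s(1) in auto)
    then show ?thesis using s0 LIMSEQ_unique[OF _ tendsto_const] by auto
  qed
  have D_diff: "A - B \<in> D" if "A \<in> D" "A \<inter> B \<in> D" "B \<in> sets borel" for A B
  proof -
    have "(LINT x|?M. g x * \<psi> x * indicator (A - B) x) = 0" if \<psi>: "\<psi> \<in> test_functions S" for \<psi>
    proof -
      have "g x * \<psi> x * indicator (A - B) x = g x * \<psi> x * indicator A x - g x * \<psi> x * indicator (A \<inter> B) x" for x
        by (auto simp: indicator_def)
      then show ?thesis using \<open>A \<in> D\<close> \<open>A \<inter> B \<in> D\<close> \<psi> inti[OF \<psi>] by (simp add: D_def)
    qed
    then show ?thesis using that by (auto simp: D_def)
  qed
  have D_un: "A \<union> B \<in> D" if "A \<in> D" "B \<in> D" "A \<inter> B \<in> D" for A B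
  proof -
    have "(LINT x|?M. g x * \<psi> x * indicator (A \<union> B) x) = 0" if \<psi>: "\<psi> \<in> test_functions S" for \<psi>
    proof -
      have "g x * \<psi> x * indicator (A \<union> B) x =
          g x * \<psi> x * indicator A x + g x * \<psi> x * indicator B x - g x * \<psi> x * indicator (A \<inter> B) x" for x
        by (auto simp: indicator_def)
      then show ?thesis using \<open>A \<in> D\<close> \<open>B \<in> D\<close> \<open>A \<inter> B \<in> D\<close> \<psi> inti[OF \<psi>] by (simp add: D_def)
    qed
    then show ?thesis using that by (auto simp: D_def)
  qed
  have "B \<in> sigma_sets UNIV ((\<lambda>(a, i). {x::real^'n. a < x \<bullet> i}) ` (UNIV \<times> Basis))"
    using B by (subst (asm) borel_eq_halfspace_greater) simp
  \<comment> \<open>The induction shows that intersecting with B preserves \<open>D\<close>, which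
    is stronger than B belonging to \<open>D\<close>: stability of \<open>D\<close> under
    intersections is not known beforehand. The choice A = \<open>UNIV\<close> then recovers B
    itself.\<close>
  then have "\<forall>A\<in>D. A \<inter> B \<in> D \<and> B \<in> sets borel"
  proof (induction rule: sigma_sets.induct)
    case (Basic H)
    then obtain a b where H: "H = {x. a < x \<bullet> b}" by auto
    have Hb: "H \<in> sets borel" unfolding H by measurable
    have "A \<inter> H \<in> D" if A: "A \<in> D" for A
    proof -
      have Ab: "A \<in> sets borel" using A by (simp add: D_def)
      have "(LINT x|?M. g x * \<psi> x * indicator (A \<inter> H) x) = 0" if \<psi>: "\<psi> \<in> test_functions S" for \<psi>
      proof (rule lim[OF \<psi>])
        define q where "q n x = flat (real n * (x \<bullet> b - a))" for n :: nat and x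
        have q: "smooth (q n)" for n
          unfolding q_def by (intro smooth_flat smooth_mult smooth_const smooth_diff smooth_inner)
        show "A \<inter> H \<in> sets borel" using Ab Hb by simp
        have "q n \<in> borel_measurable ?M" for n
          using borel_measurable_continuous_onI[OF smooth_imp_continuous[OF q]]
          by (intro measurable_restrict_space1 measurable_completion) simp
        then show "(\<lambda>x. q n x * indicator A x) \<in> borel_measurable ?M" for n
          using ind[OF Ab] by simp
        show "\<bar>q n x * indicator A x\<bar> \<le> 1" for n x
          using flat_nonneg[of "real n * (x \<bullet> b - a)"] flat_le_1[of "real n * (x \<bullet> b - a)"]
          by (simp add: q_def indicator_def)
        show "(\<lambda>n. q n x * indicator A x) \<longlonglongrightarrow> indicator (A \<inter> H) x" for x
        proof -
          have "(\<lambda>n. q n x * indicator A x) \<longlonglongrightarrow> (if x \<bullet> b - a > 0 then 1 else 0) * indicator A x"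
            unfolding q_def by (intro tendsto_mult flat_mult_nat_tendsto tendsto_const)
          also have "(if x \<bullet> b - a > 0 then 1 else 0) * indicator A x = (indicator (A \<inter> H) x :: real)"
            by (auto simp: indicator_def H)
          finally show ?thesis .
        qed
        show "(LINT x|?M. g x * \<psi> x * (q n x * indicator A x)) = 0" for n
        proof -
          have "(LINT x|?M. g x * (q n x * \<psi> x) * indicator A x) = 0"
            using A test_functions_mult[OF q \<psi>, of n] by (simp add: D_def)
          then show ?thesis by (simp add: ac_simps)
        qed
      qed
      then show ?thesis using Ab Hb by (simp add: D_def)
    qed
    then show ?case using Hb by simp
  next
    case Empty
    then show ?case by (simp add: D_def)
  next
    case (Compl B)
    show ?case
    proof
      fix A assume A: "A \<in> D"
      then have "A - B \<in> D" using Compl by (intro D_diff) auto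
      then show "A \<inter> (UNIV - B) \<in> D \<and> UNIV - B \<in> sets borel"
        using Compl A by (auto simp: Diff_eq)
    qed
  next
    case (Union B)
    show ?case
    proof
      fix A assume A: "A \<in> D"
      then have Ab: "A \<in> sets borel" and Bb: "\<And>n. B n \<in> sets borel" using Union by (auto simp: D_def)
      \<comment> \<open>The sets are not assumed disjoint, so finite unions go through
        inclusion-exclusion; dominated convergence then reaches the countable union.\<close>
      have fin: "A \<inter> (\<Union>i<n. B i) \<in> D" for n
      proof (induction n)
        case (Suc n)
        have "(A \<inter> (\<Union>i<n. B i)) \<union> (A \<inter> B n) \<in> D"
        proof (rule D_un)
          show "(A \<inter> (\<Union>i<n. B i)) \<inter> (A \<inter> B n) \<in> D"
            using Union[of n] Suc by (metis Int_assoc Int_left_commute Int_absorb inf_left_idem)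
        qed (use Suc Union A in auto)
        moreover have "(A \<inter> (\<Union>i<n. B i)) \<union> (A \<inter> B n) = A \<inter> (\<Union>i<Suc n. B i)"
          by (auto simp: less_Suc_eq)
        ultimately show ?case by simp
      qed (simp add: D_def)
      have Ub: "A \<inter> (\<Union>n. B n) \<in> sets borel" using Ab Bb by auto
      have "(LINT x|?M. g x * \<psi> x * indicator (A \<inter> (\<Union>n. B n)) x) = 0" if \<psi>: "\<psi> \<in> test_functions S" for \<psi>
      proof (rule lim[OF \<psi> Ub, where s = "\<lambda>n. indicator (A \<inter> (\<Union>i<n. B i))"])
        show "(indicator (A \<inter> (\<Union>i<n. B i)) :: _ \<Rightarrow> real) \<in> borel_measurable ?M" for n
          using fin[of n] by (intro ind) (simp add: D_def)
        show "(\<lambda>n. indicator (A \<inter> (\<Union>i<n. B i)) x) \<longlonglongrightarrow> (indicator (A \<inter> (\<Union>n. B n)) x :: real)" for x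
          unfolding Int_UN_distrib by (rule LIMSEQ_indicator_UN)
        show "(LINT x|?M. g x * \<psi> x * indicator (A \<inter> (\<Union>i<n. B i)) x) = 0" for n
          using fin \<psi> by (simp add: D_def)
      qed (simp add: indicator_def)
      then show "A \<inter> (\<Union>i. B i) \<in> D \<and> (\<Union>i. B i) \<in> sets borel" using Ub Bb by (simp add: D_def)
    qed
  qed
  moreover have "UNIV \<in> D" using zero by (simp add: D_def)
  ultimately have "B \<in> D" by fastforce
  then show ?thesis using \<psi> by (simp add: D_def)
qed

text \<open>Integrating over the positivity set of a Borel version of g shows that g \<psi> vanishes
  almost everywhere there for each nonnegative \<psi>, and likewise on the negativity set. Functions
  \<psi> at least 1 on the members of a compact exhaustion then remove the factor \<psi>.\<close>

theorem fundamental_lemma_variations: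
  fixes g :: "real^'n::finite \<Rightarrow> real"
  assumes S: "open S" and meas: "g \<in> borel_measurable (lebesgue_on S)"
    and int: "\<And>\<psi>. \<psi> \<in> test_functions S \<Longrightarrow> integrable (lebesgue_on S) (\<lambda>x. g x * \<psi> x)"
    and zero: "\<And>\<psi>. \<psi> \<in> test_functions S \<Longrightarrow> (LINT x|lebesgue_on S. g x * \<psi> x) = 0"
  shows "AE x in lebesgue_on S. g x = 0"
proof -
  let ?M = "lebesgue_on S"
  have Ss: "S \<in> sets lebesgue" using S by auto
  have "(\<lambda>x. if x \<in> S then g x else 0) \<in> borel_measurable lebesgue"
    by (rule borel_measurable_if_I[OF meas Ss])
  then obtain g' where g': "g' \<in> borel_measurable lborel" "AE x in lborel. (if x \<in> S then g x else 0) = g' x"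
    using completion_ex_borel_measurable_real by blast
  then have "AE x in lebesgue. (if x \<in> S then g x else 0) = g' x" by (intro AE_completion)
  then have gg': "AE x in ?M. g x = g' x"
    using Ss by (subst AE_restrict_space_iff) (auto elim: eventually_mono)
  have pn: "AE x in ?M. g x * \<psi> x = 0" if \<psi>: "\<psi> \<in> test_functions S" "\<And>x. 0 \<le> \<psi> x" for \<psi>
  proof -
    \<comment> \<open>The values 1 and -1 of \<sigma> treat the two sign sets; in either case the
      integrand is nonnegative with integral zero.\<close>
    have half: "AE x in ?M. \<sigma> * (g x * \<psi> x * indicator {x. \<sigma> * g' x > 0} x) = 0" for \<sigma> :: real
    proof -
      have B: "{x. \<sigma> * g' x > 0} \<in> sets borel" using g'(1) by measurable
      have z: "(LINT x|?M. \<sigma> * (g x * \<psi> x * indicator {x. \<sigma> * g' x > 0} x)) = 0"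
        using annihilated_borel[OF int zero B \<psi>(1)] by simp
      have ind: "(indicator {x. \<sigma> * g' x > 0} :: _ \<Rightarrow> real) \<in> borel_measurable ?M"
        using B by (intro measurable_restrict_space1 measurable_completion) simp
      have "integrable ?M (\<lambda>x. g x * \<psi> x * indicator {x. \<sigma> * g' x > 0} x)"
      proof (rule Bochner_Integration.integrable_bound[OF int[OF \<psi>(1)]])
        show "(\<lambda>x. g x * \<psi> x * indicator {x. \<sigma> * g' x > 0} x) \<in> borel_measurable ?M"
          by (intro borel_measurable_times[OF borel_measurable_integrable[OF int[OF \<psi>(1)]] ind])
      qed (auto simp: indicator_def)
      then have i: "integrable ?M (\<lambda>x. \<sigma> * (g x * \<psi> x * indicator {x. \<sigma> * g' x > 0} x))" by simp
      have "AE x in ?M. 0 \<le> \<sigma> * (g x * \<psi> x * indicator {x. \<sigma> * g' x > 0} x)"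
        using gg' by eventually_elim (auto simp: indicator_def \<psi>(2) mult.assoc[symmetric])
      then show ?thesis using z integral_nonneg_eq_0_iff_AE[OF i] by simp
    qed
    show ?thesis using half[of 1] half[of "-1"] gg'
    proof eventually_elim
      case (elim x)
      then show ?case by (cases "g x" "0::real" rule: linorder_cases) (auto simp: indicator_def)
    qed
  qed
  obtain C where C: "\<And>n::nat. compact (C n)" "\<And>n. C n \<subseteq> S" "\<Union>(range C) = S"
    using open_Union_compact_subsets[OF S] by metis
  have "\<exists>\<eta>. \<eta> \<in> test_functions S \<and> (\<forall>x. 0 \<le> \<eta> x) \<and> (\<forall>x\<in>C n. 1 \<le> \<eta> x)" for n
    using test_function_ge_1[OF C(1,2) S] by metis
  then obtain \<eta> where \<eta>: "\<And>n. \<eta> n \<in> test_functions S" "\<And>n x. 0 \<le> \<eta> n x" "\<And>n x. x \<in> C n \<Longrightarrow> 1 \<le> \<eta> n x"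
    by metis
  have "AE x in ?M. \<forall>n. g x * \<eta> n x = 0"
    unfolding AE_all_countable using pn \<eta> by blast
  moreover have "AE x in ?M. x \<in> S" by (rule AE_I2) simp
  ultimately show ?thesis
  proof eventually_elim
    case (elim x)
    then obtain n where "x \<in> C n" using C(3) by blast
    then have "\<eta> n x \<noteq> 0" using \<eta>(3)[of x n] by auto
    then show ?case using elim(1) by auto
  qed
qed

section \<open>Weak gradients\<close>

lemma norm_vec_square: "(norm (v :: real^'n::finite))\<^sup>2 = (\<Sum>i\<in>UNIV. (v $ i)\<^sup>2)"
  unfolding power2_norm_eq_inner by (simp add: inner_vec_def power2_eq_square)

lemma integrable_norm_square_vec:
  fixes g :: "real^'n::finite \<Rightarrow> real^'n"
  assumes "\<And>i. (\<lambda>x. g x $ i) \<in> L2 S"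
  shows "integrable (lebesgue_on S) (\<lambda>x. (norm (g x))\<^sup>2)"
    "(LINT x|lebesgue_on S. (norm (g x))\<^sup>2) = (\<Sum>i\<in>UNIV. LINT x|lebesgue_on S. (g x $ i)\<^sup>2)"
  using assms by (simp_all add: norm_vec_square L2_def)

lemma partial_deriv_L2:
  "open S \<Longrightarrow> \<phi> \<in> test_functions S \<Longrightarrow> partial_deriv i \<phi> \<in> L2 S"
  by (intro test_function_L2 test_functions_partial_deriv)

lemma L2_mult_integrable: "f \<in> L2 S \<Longrightarrow> g \<in> L2 S \<Longrightarrow> integrable (lebesgue_on S) (\<lambda>x. f x * g x)"
  by (simp add: L2_iff square_integrable_mult)

lemma L2_add: "f \<in> L2 S \<Longrightarrow> g \<in> L2 S \<Longrightarrow> (\<lambda>x. f x + g x) \<in> L2 S"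
  by (simp add: L2_iff square_integrable_add)

lemma L2_scale: "f \<in> L2 S \<Longrightarrow> (\<lambda>x. a * f x) \<in> L2 S"
  by (simp add: L2_iff square_integrable_scale)

lemma L2_diff: "f \<in> L2 S \<Longrightarrow> g \<in> L2 S \<Longrightarrow> (\<lambda>x. f x - g x) \<in> L2 S"
  by (simp add: L2_iff square_integrable_diff)

lemma has_weak_gradient_unique:
  assumes "open S" "has_weak_gradient S w g" "has_weak_gradient S w h"
  shows "AE x in lebesgue_on S. g x = h x"
proof -
  have "AE x in lebesgue_on S. g x $ i - h x $ i = 0" for i
  proof (rule fundamental_lemma_variations[OF assms(1)])
    have L: "(\<lambda>x. g x $ i) \<in> L2 S" "(\<lambda>x. h x $ i) \<in> L2 S"
      using assms by (auto simp: has_weak_gradient_def)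
    have dL: "(\<lambda>x. g x $ i - h x $ i) \<in> L2 S" using L by (rule L2_diff)
    then show "(\<lambda>x. g x $ i - h x $ i) \<in> borel_measurable (lebesgue_on S)" by (simp add: L2_def)
    fix \<psi> assume \<psi>: "\<psi> \<in> test_functions S"
    then have \<psi>L: "\<psi> \<in> L2 S" using test_function_L2 assms(1) by blast
    show "integrable (lebesgue_on S) (\<lambda>x. (g x $ i - h x $ i) * \<psi> x)"
      using dL \<psi>L by (rule L2_mult_integrable)
    have "(LINT x|lebesgue_on S. g x $ i * \<psi> x) = (LINT x|lebesgue_on S. h x $ i * \<psi> x)"
    proof -
      have "- (LINT x|lebesgue_on S. g x $ i * \<psi> x) = (LINT x|lebesgue_on S. w x * partial_deriv i \<psi> x)"
        "(LINT x|lebesgue_on S. w x * partial_deriv i \<psi> x) = - (LINT x|lebesgue_on S. h x $ i * \<psi> x)"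
        using assms(2,3) \<psi> unfolding has_weak_gradient_def by auto
      then show ?thesis by simp
    qed
    then show "(LINT x|lebesgue_on S. (g x $ i - h x $ i) * \<psi> x) = 0"
      using L2_mult_integrable[OF L(1) \<psi>L] L2_mult_integrable[OF L(2) \<psi>L]
      by (simp add: left_diff_distrib)
  qed
  then have "AE x in lebesgue_on S. \<forall>i. g x $ i - h x $ i = 0"
    by (rule eventually_all_finite)
  then show ?thesis by (rule eventually_mono) (simp add: vec_eq_iff)
qed

lemma has_weak_gradient_add:
  assumes "open S" "v \<in> L2 S" "w \<in> L2 S" "has_weak_gradient S v g" "has_weak_gradient S w h"
  shows "has_weak_gradient S (\<lambda>x. v x + w x) (\<lambda>x. g x + h x)"
  unfolding has_weak_gradient_def
proof (intro conjI allI ballI)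
  fix i
  have L: "(\<lambda>x. g x $ i) \<in> L2 S" "(\<lambda>x. h x $ i) \<in> L2 S"
    using assms by (auto simp: has_weak_gradient_def)
  then show "(\<lambda>x. (g x + h x) $ i) \<in> L2 S" by (simp add: L2_add)
  fix \<phi> assume \<phi>: "\<phi> \<in> test_functions S"
  note \<phi>L = test_function_L2[OF assms(1) \<phi>] partial_deriv_L2[OF assms(1) \<phi>]
  show "(LINT x|lebesgue_on S. (v x + w x) * partial_deriv i \<phi> x) =
        - (LINT x|lebesgue_on S. (g x + h x) $ i * \<phi> x)"
    using assms(4,5) \<phi> L \<phi>L assms(2,3)
    by (simp add: distrib_right L2_mult_integrable has_weak_gradient_def)
qed

lemma has_weak_gradient_scale:
  assumes "open S" "w \<in> L2 S" "has_weak_gradient S w g"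
  shows "has_weak_gradient S (\<lambda>x. a * w x) (\<lambda>x. a *\<^sub>R g x)"
  using assms by (auto simp: has_weak_gradient_def L2_scale mult.assoc)

text \<open>The product \<open>e x * \<phi> x\<close> has compact support whatever e does near the
  boundary, so its partial derivatives integrate to zero. This generality lets trigonometric
  functions be inserted later.\<close>

lemma integral_by_parts_test:
  assumes "open S" "\<phi> \<in> test_functions S" "smooth e"
  shows "(LINT x|lebesgue_on S. \<phi> x * partial_deriv i e x) =
    - (LINT x|lebesgue_on S. partial_deriv i \<phi> x * e x)"
proof -
  have \<psi>: "(\<lambda>x. e x * \<phi> x) \<in> test_functions S" by (rule test_functions_mult[OF assms(3,2)])
  have eq: "partial_deriv i (\<lambda>x. e x * \<phi> x) = (\<lambda>x. \<phi> x * partial_deriv i e x + partial_deriv i \<phi> x * e x)"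
    using smooth_imp_differentiable[OF assms(3)] smooth_imp_differentiable[OF test_smooth[OF assms(2)]]
    by (auto simp: partial_deriv_mult)
  have t: "(\<lambda>x. partial_deriv i e x * \<phi> x) \<in> test_functions S"
    "(\<lambda>x. e x * partial_deriv i \<phi> x) \<in> test_functions S"
    using assms by (auto intro!: test_functions_mult smooth_partial_deriv test_functions_partial_deriv)
  have on: "(LINT x|lebesgue_on S. f x) = (LINT x|lborel. f x)" if "f \<in> test_functions S" for f
    using integral_lebesgue_on_test(1)[OF assms(1) borel_measurable_test[OF that]]
      test_function_zero_outside[OF that] by blast
  have "0 = (LINT x|lborel. partial_deriv i (\<lambda>x. e x * \<phi> x) x)"
    using integral_partial_deriv_eq_0[OF \<psi>] by simp
  also have "\<dots> = (LINT x|lborel. partial_deriv i e x * \<phi> x) + (LINT x|lborel. e x * partial_deriv i \<phi> x)"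
    using test_function_integrable[OF t(1)] test_function_integrable[OF t(2)]
    unfolding eq by (simp add: mult.commute)
  finally show ?thesis using on[OF t(1)] on[OF t(2)] by (simp add: mult.commute)
qed

lemma has_weak_gradient_test:
  assumes "open S" "\<phi> \<in> test_functions S"
  shows "has_weak_gradient S \<phi> (gradient \<phi>)"
  unfolding has_weak_gradient_def
proof (intro conjI allI ballI)
  show "(\<lambda>x. gradient \<phi> x $ i) \<in> L2 S" for i
    using partial_deriv_L2[OF assms] by (simp add: gradient_def)
  show "(LINT x|lebesgue_on S. \<phi> x * partial_deriv i \<psi> x) = - (LINT x|lebesgue_on S. gradient \<phi> x $ i * \<psi> x)"
    if "\<psi> \<in> test_functions S" for \<psi> i
    using integral_by_parts_test[OF assms test_smooth[OF that]] by (simp add: gradient_def)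
qed

lemma weak_gradient_works: "w \<in> H1 S \<Longrightarrow> has_weak_gradient S w (weak_gradient S w)"
  unfolding H1_def weak_gradient_def by (metis (mono_tags, lifting) mem_Collect_eq someI_ex)

lemma weak_gradient_AE_eq:
  assumes "open S" "has_weak_gradient S w g"
  shows "AE x in lebesgue_on S. weak_gradient S w x = g x"
  using has_weak_gradient_unique[OF assms(1) _ assms(2)] assms(2) unfolding weak_gradient_def
  by (metis someI_ex)

lemma weak_gradient_L2: "w \<in> H1 S \<Longrightarrow> (\<lambda>x. weak_gradient S w x $ i) \<in> L2 S"
  using weak_gradient_works by (auto simp: has_weak_gradient_def)

lemma H1_imp_L2: "w \<in> H1 S \<Longrightarrow> w \<in> L2 S"
  by (simp add: H1_def)

lemma H1_add: "open S \<Longrightarrow> v \<in> H1 S \<Longrightarrow> w \<in> H1 S \<Longrightarrow> (\<lambda>x. v x + w x) \<in> H1 S"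
  unfolding H1_def using has_weak_gradient_add by (auto intro!: L2_add) blast

lemma H1_scale: "open S \<Longrightarrow> w \<in> H1 S \<Longrightarrow> (\<lambda>x. a * w x) \<in> H1 S"
  unfolding H1_def using has_weak_gradient_scale by (auto intro!: L2_scale) blast

lemma H1_diff: "open S \<Longrightarrow> v \<in> H1 S \<Longrightarrow> w \<in> H1 S \<Longrightarrow> (\<lambda>x. v x - w x) \<in> H1 S"
  using H1_add[of S v "\<lambda>x. (-1) * w x"] H1_scale[of S w "-1"] by simp

lemma H1_test: "open S \<Longrightarrow> \<phi> \<in> test_functions S \<Longrightarrow> \<phi> \<in> H1 S"
  unfolding H1_def using has_weak_gradient_test test_function_L2 by blast

text \<open>Equality holds only almost everywhere, because \<open>weak_gradient\<close> chooses a
  representative separately for each function.\<close>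

lemma weak_gradient_add:
  assumes "open S" "v \<in> H1 S" "w \<in> H1 S"
  shows "AE x in lebesgue_on S. weak_gradient S (\<lambda>x. v x + w x) x = weak_gradient S v x + weak_gradient S w x"
  using assms by (intro weak_gradient_AE_eq has_weak_gradient_add weak_gradient_works H1_imp_L2)

lemma weak_gradient_scale:
  assumes "open S" "w \<in> H1 S"
  shows "AE x in lebesgue_on S. weak_gradient S (\<lambda>x. a * w x) x = a *\<^sub>R weak_gradient S w x"
  using assms by (intro weak_gradient_AE_eq has_weak_gradient_scale weak_gradient_works H1_imp_L2)

section \<open>Norm estimates and linearity of the Sobolev spaces\<close>

lemma H10_norm_square: "(H10_norm S w)\<^sup>2 = (LINT x|lebesgue_on S. (norm (weak_gradient S w x))\<^sup>2)"
  by (simp add: H10_norm_def)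

lemma H1_norm_square: "(H1_norm S w)\<^sup>2 = (LINT x|lebesgue_on S. (w x)\<^sup>2) + (H10_norm S w)\<^sup>2"
  by (simp add: H1_norm_def)

lemma H10_norm_square_eq:
  assumes "w \<in> H1 S"
  shows "(H10_norm S w)\<^sup>2 = (\<Sum>i\<in>UNIV. LINT x|lebesgue_on S. (weak_gradient S w x $ i)\<^sup>2)"
  using integrable_norm_square_vec(2)[OF weak_gradient_L2[OF assms]] by (simp add: H10_norm_square)

lemma L2_square_le_sum:
  assumes "w \<in> H1 S"
  shows "(LINT x|lebesgue_on S. (weak_gradient S w x $ i)\<^sup>2) \<le> (H10_norm S w)\<^sup>2"
  unfolding H10_norm_square_eq[OF assms] by (rule member_le_sum) auto

lemma L2_measurable: "w \<in> L2 S \<Longrightarrow> w \<in> borel_measurable (lebesgue_on S)"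
  by (simp add: L2_def)

lemma integral_square_AE_cong:
  assumes "f \<in> L2 S" "g \<in> L2 S" "AE x in lebesgue_on S. f x = g x"
  shows "(LINT x|lebesgue_on S. (f x)\<^sup>2) = (LINT x|lebesgue_on S. (g x)\<^sup>2)"
proof (rule integral_cong_AE)
  show "(\<lambda>x. (f x)\<^sup>2) \<in> borel_measurable (lebesgue_on S)" "(\<lambda>x. (g x)\<^sup>2) \<in> borel_measurable (lebesgue_on S)"
    using L2_measurable assms by (auto intro: borel_measurable_power)
  show "AE x in lebesgue_on S. (f x)\<^sup>2 = (g x)\<^sup>2" using assms(3) by (rule eventually_mono) simp
qed

lemma AE_vec_nth: "AE x in M. f x = g x \<Longrightarrow> AE x in M. f x $ i = g x $ i"
  by (rule eventually_mono) auto

lemma H10_norm_add: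
  assumes "open S" "v \<in> H1 S" "w \<in> H1 S"
  shows "(H10_norm S (\<lambda>x. v x + w x))\<^sup>2 \<le> 2 * (H10_norm S v)\<^sup>2 + 2 * (H10_norm S w)\<^sup>2"
proof -
  let ?v = "\<lambda>i x. weak_gradient S v x $ i" and ?w = "\<lambda>i x. weak_gradient S w x $ i"
  have "(LINT x|lebesgue_on S. (weak_gradient S (\<lambda>x. v x + w x) x $ i)\<^sup>2)
      = (LINT x|lebesgue_on S. (?v i x + ?w i x)\<^sup>2)" for i
    using weak_gradient_L2[OF H1_add[OF assms]] L2_add[OF weak_gradient_L2[OF assms(2)] weak_gradient_L2[OF assms(3)]]
      AE_vec_nth[OF weak_gradient_add[OF assms], of i]
    by (intro integral_square_AE_cong) auto
  then have "(LINT x|lebesgue_on S. (weak_gradient S (\<lambda>x. v x + w x) x $ i)\<^sup>2)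
      \<le> 2 * (LINT x|lebesgue_on S. (?v i x)\<^sup>2) + 2 * (LINT x|lebesgue_on S. (?w i x)\<^sup>2)" for i
    using weak_gradient_L2[OF assms(2)] weak_gradient_L2[OF assms(3)]
    by (simp add: L2_iff integral_square_add_le)
  then show ?thesis
    unfolding H10_norm_square_eq[OF H1_add[OF assms]] H10_norm_square_eq[OF assms(2)] H10_norm_square_eq[OF assms(3)]
    by (simp add: sum_distrib_left sum.distrib[symmetric] sum_mono)
qed

lemma H10_norm_scale:
  assumes "open S" "w \<in> H1 S"
  shows "(H10_norm S (\<lambda>x. a * w x))\<^sup>2 = a\<^sup>2 * (H10_norm S w)\<^sup>2"
proof -
  have "(LINT x|lebesgue_on S. (weak_gradient S (\<lambda>x. a * w x) x $ i)\<^sup>2)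
      = (LINT x|lebesgue_on S. (a * weak_gradient S w x $ i)\<^sup>2)" for i
    using weak_gradient_L2[OF H1_scale[OF assms]] L2_scale[OF weak_gradient_L2[OF assms(2)]]
      AE_vec_nth[OF weak_gradient_scale[OF assms, of a], of i]
    by (intro integral_square_AE_cong) auto
  then show ?thesis
    unfolding H10_norm_square_eq[OF H1_scale[OF assms]] H10_norm_square_eq[OF assms(2)]
    by (simp add: power_mult_distrib sum_distrib_left)
qed

lemma H1_norm_add:
  assumes "open S" "v \<in> H1 S" "w \<in> H1 S"
  shows "(H1_norm S (\<lambda>x. v x + w x))\<^sup>2 \<le> 2 * (H1_norm S v)\<^sup>2 + 2 * (H1_norm S w)\<^sup>2"
  using H10_norm_add[OF assms] integral_square_add_le[of "lebesgue_on S" v w] assms(2,3)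
  by (simp add: H1_norm_square H1_def L2_iff)

lemma H1_norm_scale:
  assumes "open S" "w \<in> H1 S"
  shows "(H1_norm S (\<lambda>x. a * w x))\<^sup>2 = a\<^sup>2 * (H1_norm S w)\<^sup>2"
  using H10_norm_scale[OF assms] by (simp add: H1_norm_square power_mult_distrib distrib_left)

lemma tendsto_0_square_iff:
  fixes f :: "'a \<Rightarrow> real"
  shows "(f \<longlongrightarrow> 0) F \<longleftrightarrow> ((\<lambda>x. (f x)\<^sup>2) \<longlongrightarrow> 0) F"
proof
  assume "((\<lambda>x. (f x)\<^sup>2) \<longlongrightarrow> 0) F"
  then have "((\<lambda>x. sqrt ((f x)\<^sup>2)) \<longlongrightarrow> sqrt 0) F" by (rule tendsto_real_sqrt)
  then show "(f \<longlongrightarrow> 0) F" by (simp add: tendsto_rabs_zero_iff)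
qed (use tendsto_power[of f 0 F 2] in simp)

text \<open>Convergence of squared norms is the form that fits the quadratic estimates with factor
  2.\<close>

lemma H10_iff:
  "w \<in> H10 S \<longleftrightarrow> w \<in> H1 S \<and> (\<exists>\<phi>. (\<forall>k::nat. \<phi> k \<in> test_functions S) \<and>
     (\<lambda>k. (H1_norm S (\<lambda>x. w x - \<phi> k x))\<^sup>2) \<longlonglongrightarrow> 0)"
  by (simp add: H10_def tendsto_0_square_iff[of "\<lambda>k. H1_norm S (\<lambda>x. w x - _ k x)", symmetric])

lemma H10_imp_H1: "w \<in> H10 S \<Longrightarrow> w \<in> H1 S"
  by (simp add: H10_def)

lemma H10_add:
  assumes S: "open S" and "v \<in> H10 S" "w \<in> H10 S"
  shows "(\<lambda>x. v x + w x) \<in> H10 S"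
proof -
  obtain \<phi> where \<phi>: "\<And>k::nat. \<phi> k \<in> test_functions S" "(\<lambda>k. (H1_norm S (\<lambda>x. v x - \<phi> k x))\<^sup>2) \<longlonglongrightarrow> 0"
    using assms(2) unfolding H10_iff by blast
  obtain \<psi> where \<psi>: "\<And>k::nat. \<psi> k \<in> test_functions S" "(\<lambda>k. (H1_norm S (\<lambda>x. w x - \<psi> k x))\<^sup>2) \<longlonglongrightarrow> 0"
    using assms(3) unfolding H10_iff by blast
  have H: "v \<in> H1 S" "w \<in> H1 S" using assms H10_imp_H1 by blast+
  have "(\<lambda>k. (H1_norm S (\<lambda>x. (v x + w x) - (\<phi> k x + \<psi> k x)))\<^sup>2) \<longlonglongrightarrow> 0"
  proof (rule tendsto_sandwich[OF _ _ tendsto_const])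
    show "\<forall>\<^sub>F k in sequentially. (H1_norm S (\<lambda>x. (v x + w x) - (\<phi> k x + \<psi> k x)))\<^sup>2 \<le>
        2 * (H1_norm S (\<lambda>x. v x - \<phi> k x))\<^sup>2 + 2 * (H1_norm S (\<lambda>x. w x - \<psi> k x))\<^sup>2"
      using H1_norm_add[OF S H1_diff[OF S H(1) H1_test[OF S \<phi>(1)]] H1_diff[OF S H(2) H1_test[OF S \<psi>(1)]]]
      by (simp add: algebra_simps)
    show "(\<lambda>k. 2 * (H1_norm S (\<lambda>x. v x - \<phi> k x))\<^sup>2 + 2 * (H1_norm S (\<lambda>x. w x - \<psi> k x))\<^sup>2) \<longlonglongrightarrow> 0"
      using tendsto_add[OF tendsto_mult_right_zero[OF \<phi>(2)] tendsto_mult_right_zero[OF \<psi>(2)], of 2 2] by simp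
  qed auto
  then show ?thesis
    unfolding H10_iff using H1_add[OF S H] \<phi>(1) \<psi>(1)
    by (intro conjI exI[of _ "\<lambda>k x. \<phi> k x + \<psi> k x"]) (auto intro: test_functions_add)
qed

lemma H10_scale:
  assumes S: "open S" and "w \<in> H10 S"
  shows "(\<lambda>x. a * w x) \<in> H10 S"
proof -
  obtain \<phi> where \<phi>: "\<And>k::nat. \<phi> k \<in> test_functions S" "(\<lambda>k. (H1_norm S (\<lambda>x. w x - \<phi> k x))\<^sup>2) \<longlonglongrightarrow> 0"
    using assms(2) unfolding H10_iff by blast
  have H: "w \<in> H1 S" using assms H10_imp_H1 by blast
  have "(\<lambda>k. (H1_norm S (\<lambda>x. a * w x - a * \<phi> k x))\<^sup>2) = (\<lambda>k. a\<^sup>2 * (H1_norm S (\<lambda>x. w x - \<phi> k x))\<^sup>2)"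
    using H1_norm_scale[OF S H1_diff[OF S H H1_test[OF S \<phi>(1)]]] by (simp add: algebra_simps)
  then have "(\<lambda>k. (H1_norm S (\<lambda>x. a * w x - a * \<phi> k x))\<^sup>2) \<longlonglongrightarrow> 0"
    using tendsto_mult_right_zero[OF \<phi>(2)] by simp
  then show ?thesis
    unfolding H10_iff using H1_scale[OF S H] \<phi>(1)
    by (intro conjI exI[of _ "\<lambda>k x. a * \<phi> k x"]) (auto intro: test_functions_scale)
qed

lemma H10_test:
  assumes S: "open S" and \<phi>: "\<phi> \<in> test_functions S"
  shows "\<phi> \<in> H10 S"
proof -
  have "(H1_norm S (\<lambda>x. \<phi> x - \<phi> x))\<^sup>2 = 0"
    using H1_norm_scale[OF S H1_test[OF S \<phi>], of 0] by simp
  then show ?thesis unfolding H10_iff using H1_test[OF S \<phi>] \<phi> by (intro conjI exI[of _ "\<lambda>k. \<phi>"]) auto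
qed

section \<open>Integration by parts up to the boundary and Poincare's inequality\<close>

lemma smooth_L2:
  assumes "open S" "bounded S" "smooth e"
  shows "e \<in> L2 S"
proof -
  have c: "continuous_on UNIV e" using smooth_imp_continuous[OF assms(3)] .
  have Ss: "S \<in> sets lebesgue" using assms(1) by auto
  have [measurable]: "e \<in> borel_measurable borel" using c by (rule borel_measurable_continuous_onI)
  have "integrable lborel (\<lambda>x. indicator (closure S) x *\<^sub>R (e x)\<^sup>2)"
    using assms(2) c by (intro borel_integrable_compact continuous_intros) (auto intro: continuous_on_subset)
  then have "integrable lebesgue (\<lambda>x. indicator (closure S) x *\<^sub>R (e x)\<^sup>2)"
    by (subst integrable_completion) auto
  from integrable_mult_indicator[OF Ss this]
  have "integrable lebesgue (\<lambda>x. indicator S x *\<^sub>R (indicator (closure S) x *\<^sub>R (e x)\<^sup>2))" .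
  moreover have "(\<lambda>x. indicator S x *\<^sub>R (indicator (closure S) x *\<^sub>R (e x)\<^sup>2)) = (\<lambda>x. indicator S x *\<^sub>R (e x)\<^sup>2)"
    using closure_subset[of S] by (fastforce simp: indicator_def)
  ultimately have "integrable lebesgue (\<lambda>x. indicator S x *\<^sub>R (e x)\<^sup>2)" by simp
  then have "integrable (lebesgue_on S) (\<lambda>x. (e x)\<^sup>2)"
    using Ss by (simp add: integrable_restrict_space del: real_scaleR_def)
  moreover have "e \<in> borel_measurable (lebesgue_on S)"
    by (intro measurable_restrict_space1 measurable_completion) simp
  ultimately show ?thesis by (simp add: L2_def)
qed

lemma integral_diff_tendsto_L2:
  assumes "f \<in> L2 S" "\<And>k. g k \<in> L2 S" "e \<in> L2 S"
    and lim: "(\<lambda>k. LINT x|lebesgue_on S. (f x - g k x)\<^sup>2) \<longlonglongrightarrow> 0"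
  shows "(\<lambda>k. LINT x|lebesgue_on S. g k x * e x) \<longlonglongrightarrow> (LINT x|lebesgue_on S. f x * e x)"
proof -
  have "(\<lambda>k. (LINT x|lebesgue_on S. f x * e x) - (LINT x|lebesgue_on S. g k x * e x)) \<longlonglongrightarrow> 0"
  proof (rule Lim_null_comparison)
    have "\<bar>(LINT x|lebesgue_on S. f x * e x) - (LINT x|lebesgue_on S. g k x * e x)\<bar> \<le>
        sqrt (LINT x|lebesgue_on S. (f x - g k x)\<^sup>2) * sqrt (LINT x|lebesgue_on S. (e x)\<^sup>2)" for k
    proof -
      have "(LINT x|lebesgue_on S. f x * e x) - (LINT x|lebesgue_on S. g k x * e x) =
          (LINT x|lebesgue_on S. (f x - g k x) * e x)"
        using assms by (simp add: left_diff_distrib L2_mult_integrable)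
      then show ?thesis
        using Cauchy_Schwarz_integral[of "lebesgue_on S" "\<lambda>x. f x - g k x" e] L2_diff[OF assms(1,2)] assms(3)
        by (simp add: L2_iff)
    qed
    then show "\<forall>\<^sub>F k in sequentially. norm ((LINT x|lebesgue_on S. f x * e x) - (LINT x|lebesgue_on S. g k x * e x)) \<le>
        sqrt (LINT x|lebesgue_on S. (f x - g k x)\<^sup>2) * sqrt (LINT x|lebesgue_on S. (e x)\<^sup>2)" by simp
    show "(\<lambda>k. sqrt (LINT x|lebesgue_on S. (f x - g k x)\<^sup>2) * sqrt (LINT x|lebesgue_on S. (e x)\<^sup>2)) \<longlonglongrightarrow> 0"
      using tendsto_mult_left_zero[OF tendsto_real_sqrt[OF lim, simplified]] by simp
  qed
  from tendsto_diff[OF tendsto_const[of "LINT x|lebesgue_on S. f x * e x"] this] show ?thesis by simp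
qed

text \<open>Here e may be nonzero on the boundary. The approximating test functions have compact
  support and produce no boundary term, and both sides pass to the limit in L2.\<close>

lemma H10_integral_by_parts:
  assumes S: "open S" "bounded S" and w: "w \<in> H10 S" and e: "smooth e"
  shows "(LINT x|lebesgue_on S. w x * partial_deriv i e x) =
    - (LINT x|lebesgue_on S. weak_gradient S w x $ i * e x)"
proof -
  obtain \<phi> where \<phi>: "\<And>k::nat. \<phi> k \<in> test_functions S" "(\<lambda>k. (H1_norm S (\<lambda>x. w x - \<phi> k x))\<^sup>2) \<longlonglongrightarrow> 0"
    using w unfolding H10_iff by blast
  have H: "w \<in> H1 S" using w by (rule H10_imp_H1)
  have d: "(\<lambda>x. w x - \<phi> k x) \<in> H1 S" for k using H1_diff[OF S(1) H H1_test[OF S(1) \<phi>(1)]] .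
  have "has_weak_gradient S (\<lambda>x. w x + (-1) * \<phi> k x) (\<lambda>x. weak_gradient S w x + (-1) *\<^sub>R gradient (\<phi> k) x)" for k
    by (intro has_weak_gradient_add has_weak_gradient_scale S has_weak_gradient_test \<phi>
        weak_gradient_works H H1_imp_L2 L2_scale test_function_L2)
  then have wg: "AE x in lebesgue_on S. weak_gradient S (\<lambda>x. w x - \<phi> k x) x = weak_gradient S w x - gradient (\<phi> k) x" for k
    using weak_gradient_AE_eq[OF S(1)] by fastforce
  have eq: "(LINT x|lebesgue_on S. (weak_gradient S w x $ i - partial_deriv i (\<phi> k) x)\<^sup>2) =
      (LINT x|lebesgue_on S. (weak_gradient S (\<lambda>x. w x - \<phi> k x) x $ i)\<^sup>2)" for k
    using wg[of k] L2_diff[OF weak_gradient_L2[OF H] partial_deriv_L2[OF S(1) \<phi>(1)]] weak_gradient_L2[OF d]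
    by (intro integral_square_AE_cong) (auto elim!: eventually_mono simp: gradient_def)
  have 1: "(\<lambda>k. LINT x|lebesgue_on S. (w x - \<phi> k x)\<^sup>2) \<longlonglongrightarrow> 0"
    by (rule tendsto_sandwich[OF _ _ tendsto_const \<phi>(2)]) (auto simp: H1_norm_square)
  have 2: "(\<lambda>k. LINT x|lebesgue_on S. (weak_gradient S w x $ i - partial_deriv i (\<phi> k) x)\<^sup>2) \<longlonglongrightarrow> 0"
    unfolding eq
  proof (rule tendsto_sandwich[OF _ _ tendsto_const \<phi>(2)])
    have "(LINT x|lebesgue_on S. (weak_gradient S (\<lambda>x. w x - \<phi> k x) x $ i)\<^sup>2) \<le> (H1_norm S (\<lambda>x. w x - \<phi> k x))\<^sup>2" for k
      unfolding H1_norm_square by (rule order_trans[OF L2_square_le_sum[OF d]]) simp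
    then show "\<forall>\<^sub>F k in sequentially. (LINT x|lebesgue_on S. (weak_gradient S (\<lambda>x. w x - \<phi> k x) x $ i)\<^sup>2)
        \<le> (H1_norm S (\<lambda>x. w x - \<phi> k x))\<^sup>2" by simp
  qed simp
  have 3: "(\<lambda>k. LINT x|lebesgue_on S. \<phi> k x * partial_deriv i e x) \<longlonglongrightarrow> (LINT x|lebesgue_on S. w x * partial_deriv i e x)"
    by (intro integral_diff_tendsto_L2 1 H1_imp_L2 H test_function_L2 S \<phi> smooth_L2 smooth_partial_deriv e)
  have 4: "(\<lambda>k. LINT x|lebesgue_on S. partial_deriv i (\<phi> k) x * e x) \<longlonglongrightarrow> (LINT x|lebesgue_on S. weak_gradient S w x $ i * e x)"
    by (intro integral_diff_tendsto_L2[where f = "\<lambda>x. weak_gradient S w x $ i"] 2 weak_gradient_L2 H partial_deriv_L2 S \<phi> smooth_L2 e)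
  have "(\<lambda>k. LINT x|lebesgue_on S. \<phi> k x * partial_deriv i e x) =
      (\<lambda>k. - (LINT x|lebesgue_on S. partial_deriv i (\<phi> k) x * e x))"
    using integral_by_parts_test[OF S(1) \<phi>(1) e] by simp
  then show ?thesis using LIMSEQ_unique[OF 3] tendsto_minus[OF 4] by simp
qed

text \<open>Obtained by integrating \<open>\<partial>\<^sub>i (x\<^sub>i \<phi>\<^sup>2)\<close> for an arbitrary coordinate direction \<open>i\<close>.\<close>

lemma Poincare_test:
  fixes S :: "(real^'n::finite) set"
  assumes S: "open S" and R: "\<And>x. x \<in> S \<Longrightarrow> norm x \<le> R" and \<phi>: "\<phi> \<in> test_functions S"
  shows "(LINT x|lebesgue_on S. (\<phi> x)\<^sup>2) \<le> 4 * R\<^sup>2 * (H10_norm S \<phi>)\<^sup>2"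
proof -
  let ?M = "lebesgue_on S"
  define i :: 'n where "i = undefined"
  define d where "d = partial_deriv i \<phi>"
  define q where "q x = x \<bullet> axis i 1" for x :: "real^'n"
  have q: "smooth q" unfolding q_def by (rule smooth_inner)
  have s: "smooth \<phi>" using test_smooth[OF \<phi>] .
  have L: "\<phi> \<in> L2 S" "d \<in> L2 S"
    unfolding d_def using test_function_L2[OF S \<phi>] partial_deriv_L2[OF S \<phi>] by auto
  have t: "(\<lambda>x. q x * (\<phi> x * d x)) \<in> test_functions S"
    unfolding d_def by (intro test_functions_mult q s test_functions_partial_deriv \<phi>)
  have qd: "(\<lambda>x. q x * d x) \<in> L2 S"
    unfolding d_def by (intro test_function_L2 S test_functions_mult q test_functions_partial_deriv \<phi>)
  have "partial_deriv i (\<lambda>x. q x * \<phi> x) = (\<lambda>x. \<phi> x + q x * d x)"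
  proof
    fix x
    have "partial_deriv i q x = 1" unfolding q_def by (simp add: partial_deriv_inner)
    then show "partial_deriv i (\<lambda>x. q x * \<phi> x) x = \<phi> x + q x * d x"
      using partial_deriv_mult[OF smooth_imp_differentiable[OF q] smooth_imp_differentiable[OF s]]
      by (simp add: d_def)
  qed
  then have "(LINT x|?M. \<phi> x * (\<phi> x + q x * d x)) = - (LINT x|?M. d x * (q x * \<phi> x))"
    using integral_by_parts_test[OF S \<phi> smooth_mult[OF q s], of i] by (simp add: d_def)
  then have "(LINT x|?M. (\<phi> x)\<^sup>2) = - 2 * (LINT x|?M. \<phi> x * (q x * d x))"
    using L2_mult_integrable[OF L(1) L(1)] L2_mult_integrable[OF L(1) qd]
    by (simp add: distrib_left power2_eq_square ac_simps)
  also have "\<dots> = (LINT x|?M. - 2 * (\<phi> x * (q x * d x)))" by simp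
  \<comment> \<open>Expanding \<open>0 \<le> (\<phi> x + 2 * (q x * d x))\<^sup>2\<close> gives this
    bound. Half of the left-hand side is then absorbed, which doubles the remaining constant to 4
    R^2.\<close>
  also have "\<dots> \<le> (LINT x|?M. (1/2) * (\<phi> x)\<^sup>2 + 2 * R\<^sup>2 * (d x)\<^sup>2)"
  proof (rule integral_mono)
    show "integrable ?M (\<lambda>x. - 2 * (\<phi> x * (q x * d x)))"
      using L2_mult_integrable[OF L(1) qd] by simp
    show "integrable ?M (\<lambda>x. (1/2) * (\<phi> x)\<^sup>2 + 2 * R\<^sup>2 * (d x)\<^sup>2)" using L by (simp add: L2_def)
    fix x assume "x \<in> space ?M"
    then have x: "norm x \<le> R" using R by simp
    have "\<bar>q x\<bar> \<le> R" unfolding q_def using Cauchy_Schwarz_ineq2[of x "axis i 1"] x by simp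
    then have "(q x)\<^sup>2 \<le> R\<^sup>2" by (metis abs_ge_zero power2_abs power_mono)
    then have "(q x)\<^sup>2 * (d x)\<^sup>2 \<le> R\<^sup>2 * (d x)\<^sup>2" by (rule mult_right_mono) simp
    moreover have "0 \<le> (\<phi> x + 2 * (q x * d x))\<^sup>2" by simp
    ultimately show "- 2 * (\<phi> x * (q x * d x)) \<le> (1/2) * (\<phi> x)\<^sup>2 + 2 * R\<^sup>2 * (d x)\<^sup>2"
      by (simp add: power2_eq_square algebra_simps)
  qed
  also have "\<dots> = (1/2) * (LINT x|?M. (\<phi> x)\<^sup>2) + 2 * R\<^sup>2 * (LINT x|?M. (d x)\<^sup>2)"
    using L by (simp add: L2_def)
  finally have 1: "(LINT x|?M. (\<phi> x)\<^sup>2) \<le> 4 * R\<^sup>2 * (LINT x|?M. (d x)\<^sup>2)" by simp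
  have "AE x in ?M. d x = weak_gradient S \<phi> x $ i"
    using weak_gradient_AE_eq[OF S has_weak_gradient_test[OF S \<phi>]]
    by (rule eventually_mono) (simp add: d_def gradient_def)
  then have "(LINT x|?M. (d x)\<^sup>2) = (LINT x|?M. (weak_gradient S \<phi> x $ i)\<^sup>2)"
    by (intro integral_square_AE_cong L weak_gradient_L2 H1_test S \<phi>)
  then have "(LINT x|?M. (d x)\<^sup>2) \<le> (H10_norm S \<phi>)\<^sup>2"
    using L2_square_le_sum[OF H1_test[OF S \<phi>]] by simp
  then have "4 * R\<^sup>2 * (LINT x|?M. (d x)\<^sup>2) \<le> 4 * R\<^sup>2 * (H10_norm S \<phi>)\<^sup>2"
    by (rule mult_left_mono) simp
  with 1 show ?thesis by (rule order_trans)
qed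

lemma Poincare_H10:
  fixes S :: "(real^'n::finite) set"
  assumes S: "open S" "bounded S"
  obtains C where "C \<ge> 0" "\<And>w. w \<in> H10 S \<Longrightarrow> (LINT x|lebesgue_on S. (w x)\<^sup>2) \<le> C * (H10_norm S w)\<^sup>2"
proof -
  obtain R where R: "\<And>x. x \<in> S \<Longrightarrow> norm x \<le> R" using S(2) unfolding bounded_iff by blast
  \<comment> \<open>The constant is 2 * 4 R^2 * 2: the inner factor is the one for test functions,
    and each factor 2 comes from separating w and its approximant, once for the functions and once
    for the gradients.\<close>
  have "(LINT x|lebesgue_on S. (w x)\<^sup>2) \<le> 16 * R\<^sup>2 * (H10_norm S w)\<^sup>2" if w: "w \<in> H10 S" for w
  proof -
    obtain \<phi> where \<phi>: "\<And>k::nat. \<phi> k \<in> test_functions S" "(\<lambda>k. (H1_norm S (\<lambda>x. w x - \<phi> k x))\<^sup>2) \<longlonglongrightarrow> 0"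
      using w unfolding H10_iff by blast
    have H: "w \<in> H1 S" using w by (rule H10_imp_H1)
    define N where "N k = (H1_norm S (\<lambda>x. w x - \<phi> k x))\<^sup>2" for k
    have le: "(LINT x|lebesgue_on S. (w x)\<^sup>2) \<le> 2 * N k + 2 * (4 * R\<^sup>2 * (2 * N k + 2 * (H10_norm S w)\<^sup>2))" for k
    proof -
      have d: "(\<lambda>x. w x - \<phi> k x) \<in> H1 S" using H1_diff[OF S(1) H H1_test[OF S(1) \<phi>(1)]] .
      have "(LINT x|lebesgue_on S. ((w x - \<phi> k x) + \<phi> k x)\<^sup>2) \<le>
          2 * (LINT x|lebesgue_on S. (w x - \<phi> k x)\<^sup>2) + 2 * (LINT x|lebesgue_on S. (\<phi> k x)\<^sup>2)"
        using H1_imp_L2[OF d] test_function_L2[OF S(1) \<phi>(1)]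
        by (intro integral_square_add_le) (auto simp: L2_iff)
      moreover have "(LINT x|lebesgue_on S. (w x - \<phi> k x)\<^sup>2) \<le> N k" by (simp add: N_def H1_norm_square)
      moreover have "(LINT x|lebesgue_on S. (\<phi> k x)\<^sup>2) \<le> 4 * R\<^sup>2 * (H10_norm S (\<phi> k))\<^sup>2"
        by (rule Poincare_test[OF S(1) R \<phi>(1)])
      moreover have "(H10_norm S (\<phi> k))\<^sup>2 \<le> 2 * N k + 2 * (H10_norm S w)\<^sup>2"
      proof -
        have "(H10_norm S (\<lambda>x. (-1) * (w x - \<phi> k x) + w x))\<^sup>2 \<le>
            2 * (H10_norm S (\<lambda>x. (-1) * (w x - \<phi> k x)))\<^sup>2 + 2 * (H10_norm S w)\<^sup>2"
          by (rule H10_norm_add[OF S(1) H1_scale[OF S(1) d] H])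
        moreover have "(H10_norm S (\<lambda>x. (-1) * (w x - \<phi> k x)))\<^sup>2 = (H10_norm S (\<lambda>x. w x - \<phi> k x))\<^sup>2"
          using H10_norm_scale[OF S(1) d, of "-1"] by simp
        ultimately have "(H10_norm S (\<phi> k))\<^sup>2 \<le> 2 * (H10_norm S (\<lambda>x. w x - \<phi> k x))\<^sup>2 + 2 * (H10_norm S w)\<^sup>2"
          by simp
        then show ?thesis by (simp add: N_def H1_norm_square) (smt (verit) integral_nonneg_AE zero_le_power2 Bochner_Integration.integral_nonneg)
      qed
      then have "4 * R\<^sup>2 * (H10_norm S (\<phi> k))\<^sup>2 \<le> 4 * R\<^sup>2 * (2 * N k + 2 * (H10_norm S w)\<^sup>2)"
        by (rule mult_left_mono) simp
      ultimately show ?thesis by simp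
    qed
    have "(\<lambda>k. 2 * N k + 2 * (4 * R\<^sup>2 * (2 * N k + 2 * (H10_norm S w)\<^sup>2)))
        \<longlonglongrightarrow> 2 * 0 + 2 * (4 * R\<^sup>2 * (2 * 0 + 2 * (H10_norm S w)\<^sup>2))"
      unfolding N_def by (intro tendsto_intros \<phi>(2))
    then have "(LINT x|lebesgue_on S. (w x)\<^sup>2) \<le> 2 * 0 + 2 * (4 * R\<^sup>2 * (2 * 0 + 2 * (H10_norm S w)\<^sup>2))"
      by (rule LIMSEQ_le_const) (use le in blast)
    then show ?thesis by simp
  qed
  then show ?thesis by (intro that[of "16 * R\<^sup>2"]) auto
qed

section \<open>The Fourier transform of a square-integrable function\<close>

lemma borel_measurable_cis [measurable (raw)]:
  "f \<in> borel_measurable M \<Longrightarrow> (\<lambda>x. cis (f x)) \<in> borel_measurable M"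
  by (rule borel_measurable_continuous_on[OF continuous_on_cis[OF continuous_on_id]])

section \<open>Gaussians and their Fourier transforms\<close>

lemma lborel_integral_prod:
  fixes f :: "'a::euclidean_space \<Rightarrow> real \<Rightarrow> complex"
  assumes "\<And>b. b \<in> Basis \<Longrightarrow> integrable lborel (f b)"
  shows "(LINT x|lborel. (\<Prod>b\<in>Basis. f b (x \<bullet> b))) = (\<Prod>b\<in>Basis. (LINT t|lborel. f b t))"
proof -
  interpret product_sigma_finite "\<lambda>_::'a. lborel :: real measure" by standard
  have [measurable]: "f b \<in> borel_measurable borel" if "b \<in> Basis" for b
    using borel_measurable_integrable[OF assms[OF that]] by simp
  have "(LINT x|lborel. (\<Prod>b\<in>Basis. f b (x \<bullet> b))) =
      (LINT x|(\<Pi>\<^sub>M b\<in>Basis. lborel). (\<Prod>b\<in>Basis. f b ((\<Sum>c\<in>Basis. x c *\<^sub>R c) \<bullet> b)))"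
    by (subst lborel_eq, rule integral_distr) measurable
  also have "\<dots> = (LINT x|(\<Pi>\<^sub>M b\<in>Basis. lborel). (\<Prod>b\<in>Basis. f b (x b)))"
    by (intro Bochner_Integration.integral_cong prod.cong) auto
  also have "\<dots> = (\<Prod>b\<in>Basis. (LINT t|lborel. f b t))"
    by (rule product_integral_prod) (use assms in auto)
  finally show ?thesis .
qed

text \<open>Rescaling by \<sigma> reduces this to the characteristic function of the standard normal
  distribution.\<close>

lemma normal_density_fourier:
  assumes "\<sigma> > 0"
  shows "(LINT t|lborel. normal_density 0 \<sigma> t *\<^sub>R cis (t * z)) = complex_of_real (exp (- (\<sigma> * z)\<^sup>2 / 2))"
proof -
  have "(LINT t|lborel. normal_density 0 \<sigma> t *\<^sub>R cis (t * z)) =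
      \<bar>\<sigma>\<bar> *\<^sub>R (LINT t|lborel. normal_density 0 \<sigma> (0 + \<sigma> * t) *\<^sub>R cis ((0 + \<sigma> * t) * z))"
    using assms by (intro lborel_integral_real_affine) auto
  also have "\<dots> = (LINT t|lborel. \<bar>\<sigma>\<bar> *\<^sub>R (normal_density 0 \<sigma> (0 + \<sigma> * t) *\<^sub>R cis ((0 + \<sigma> * t) * z)))"
    by (rule integral_scaleR_right[symmetric])
  also have "\<dots> = (LINT t|lborel. std_normal_density t *\<^sub>R iexp ((\<sigma> * z) * t))"
  proof (rule Bochner_Integration.integral_cong[OF refl])
    fix t
    have "\<sigma> * normal_density 0 \<sigma> (\<sigma> * t) = std_normal_density t"
      using assms by (simp add: normal_density_def real_sqrt_mult power_mult_distrib)
    then show "\<bar>\<sigma>\<bar> *\<^sub>R (normal_density 0 \<sigma> (0 + \<sigma> * t) *\<^sub>R cis ((0 + \<sigma> * t) * z)) =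
        std_normal_density t *\<^sub>R iexp ((\<sigma> * z) * t)"
      using assms by (simp add: cis_conv_exp ac_simps)
  qed
  also have "\<dots> = char std_normal_distribution (\<sigma> * z)"
    unfolding char_def by (subst integral_density) auto
  finally show ?thesis by (simp add: char_std_normal_distribution)
qed

definition gauss :: "real \<Rightarrow> 'a::euclidean_space \<Rightarrow> real" where
  "gauss \<sigma> x = (\<Prod>b\<in>Basis. normal_density 0 \<sigma> (x \<bullet> b))"

text \<open>This is exp (- \<sigma>^2 |x|^2 / 2). The product over the basis lets its integral
  factor into one-dimensional ones.\<close>

definition gauss_hat :: "real \<Rightarrow> 'a::euclidean_space \<Rightarrow> real" where
  "gauss_hat \<sigma> x = (\<Prod>b\<in>Basis. exp (- (\<sigma> * (x \<bullet> b))\<^sup>2 / 2))"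

lemma gauss_measurable [measurable]: "gauss \<sigma> \<in> borel_measurable borel"
  unfolding gauss_def[abs_def] by measurable

lemma gauss_hat_measurable [measurable]: "gauss_hat \<sigma> \<in> borel_measurable borel"
  unfolding gauss_hat_def[abs_def] by measurable

lemma gauss_nonneg: "0 \<le> gauss \<sigma> x" and gauss_hat_nonneg: "0 \<le> gauss_hat \<sigma> x"
  by (auto simp: gauss_def gauss_hat_def intro!: prod_nonneg)

lemma nn_integral_gauss: "\<sigma> > 0 \<Longrightarrow> (\<integral>\<^sup>+x. gauss \<sigma> (x :: 'a::euclidean_space) \<partial>lborel) = 1"
proof -
  assume "\<sigma> > 0"
  then have 1: "(\<integral>\<^sup>+t. normal_density 0 \<sigma> t \<partial>lborel) = 1"
    by (simp add: nn_integral_eq_integral)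
  have "(\<integral>\<^sup>+x. gauss \<sigma> (x :: 'a) \<partial>lborel) =
      (\<integral>\<^sup>+x. (\<Prod>b\<in>(Basis :: 'a set). ennreal (normal_density 0 \<sigma> (x \<bullet> b))) \<partial>lborel)"
    by (simp add: gauss_def prod_ennreal)
  also have "\<dots> = 1"
    by (subst nn_integral_lborel_prod) (auto simp: 1)
  finally show ?thesis .
qed

lemma integrable_gauss: "\<sigma> > 0 \<Longrightarrow> integrable lborel (gauss \<sigma>)"
  by (rule integrableI_nonneg) (auto simp: gauss_nonneg nn_integral_gauss)

lemma nn_integral_gauss_hat:
  assumes "\<sigma> > 0"
  shows "(\<integral>\<^sup>+x. gauss_hat \<sigma> (x :: 'a::euclidean_space) \<partial>lborel) = ennreal ((sqrt (2 * pi) / \<sigma>) ^ DIM('a))"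
proof -
  have "exp (- (\<sigma> * t)\<^sup>2 / 2) = sqrt (2 * pi) / \<sigma> * normal_density 0 (1 / \<sigma>) t" for t
    using assms by (simp add: normal_density_def real_sqrt_divide power_divide power_mult_distrib)
  then have 1: "(\<integral>\<^sup>+t. exp (- (\<sigma> * t)\<^sup>2 / 2) \<partial>lborel) = ennreal (sqrt (2 * pi) / \<sigma>)"
    using assms by (simp add: nn_integral_eq_integral)
  have "(\<integral>\<^sup>+x. gauss_hat \<sigma> (x :: 'a) \<partial>lborel) =
      (\<integral>\<^sup>+x. (\<Prod>b\<in>(Basis :: 'a set). ennreal (exp (- (\<sigma> * (x \<bullet> b))\<^sup>2 / 2))) \<partial>lborel)"
    by (simp add: gauss_hat_def prod_ennreal)
  also have "\<dots> = (\<Prod>b\<in>(Basis :: 'a set). (\<integral>\<^sup>+t. exp (- (\<sigma> * t)\<^sup>2 / 2) \<partial>lborel))"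
    by (rule nn_integral_lborel_prod) auto
  also have "\<dots> = ennreal ((sqrt (2 * pi) / \<sigma>) ^ DIM('a))"
    using assms by (simp only: 1) (simp add: ennreal_power)
  finally show ?thesis .
qed

lemma gauss_fourier:
  assumes "\<sigma> > 0"
  shows "(LINT \<xi>|lborel. gauss \<sigma> \<xi> *\<^sub>R cis (\<xi> \<bullet> z)) = complex_of_real (gauss_hat \<sigma> z)"
proof -
  have cis_prod: "cis (\<xi> \<bullet> z) = (\<Prod>b\<in>Basis. cis ((\<xi> \<bullet> b) * (z \<bullet> b)))" for \<xi>
    by (subst euclidean_inner) (simp add: cis_conv_exp sum_distrib_left exp_sum)
  have "gauss \<sigma> \<xi> *\<^sub>R cis (\<xi> \<bullet> z) = (\<Prod>b\<in>Basis. normal_density 0 \<sigma> (\<xi> \<bullet> b) *\<^sub>R cis ((\<xi> \<bullet> b) * (z \<bullet> b)))" for \<xi>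
    by (simp add: gauss_def cis_prod scaleR_conv_of_real prod.distrib)
  then have "(LINT \<xi>|lborel. gauss \<sigma> \<xi> *\<^sub>R cis (\<xi> \<bullet> z)) =
      (LINT \<xi>|lborel. (\<Prod>b\<in>Basis. normal_density 0 \<sigma> (\<xi> \<bullet> b) *\<^sub>R cis ((\<xi> \<bullet> b) * (z \<bullet> b))))"
    by simp
  also have "\<dots> = (\<Prod>b\<in>Basis. (LINT t|lborel. normal_density 0 \<sigma> t *\<^sub>R cis (t * (z \<bullet> b))))"
  proof (rule lborel_integral_prod)
    show "integrable lborel (\<lambda>t. normal_density 0 \<sigma> t *\<^sub>R cis (t * (z \<bullet> b)))" for b
      by (rule Bochner_Integration.integrable_bound[OF integrable_normal_density[of \<sigma> 0]]) (use assms in auto)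
  qed
  also have "\<dots> = complex_of_real (gauss_hat \<sigma> z)"
    by (simp add: normal_density_fourier[OF assms] gauss_hat_def)
  finally show ?thesis .
qed

text \<open>The exponential has modulus 1, so the integrand is dominated by a product of two
  integrable functions. The value c = -1 belongs to the transform and c = 1 to its
  conjugate.\<close>

lemma fourier_Fubini:
  fixes W :: "'a::euclidean_space \<Rightarrow> real" and g :: "'a \<Rightarrow> complex"
  assumes W: "integrable lborel W" and g: "integrable lborel g"
  shows "(LINT \<xi>|lborel. g \<xi> * (LINT x|lborel. complex_of_real (W x) * cis (c * (\<xi> \<bullet> x)))) =
    (LINT x|lborel. complex_of_real (W x) * (LINT \<xi>|lborel. g \<xi> * cis (c * (\<xi> \<bullet> x))))"
proof -
  have [measurable]: "W \<in> borel_measurable borel" "g \<in> borel_measurable borel" using W g by auto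
  define F where "F \<xi> x = complex_of_real (W x) * (g \<xi> * cis (c * (\<xi> \<bullet> x)))" for \<xi> x
  have F_meas: "case_prod F \<in> borel_measurable (lborel \<Otimes>\<^sub>M lborel)"
    unfolding F_def by measurable
  have nF: "norm (F \<xi> x) = \<bar>W x\<bar> * cmod (g \<xi>)" for \<xi> x by (simp add: F_def norm_mult)
  have "integrable (lborel \<Otimes>\<^sub>M lborel) (case_prod F)"
  proof (rule lborel_pair.Fubini_integrable[OF F_meas])
    show "integrable lborel (\<lambda>\<xi>. LINT x|lborel. norm (case_prod F (\<xi>, x)))"
      using W g by (simp add: nF)
    have "integrable lborel (\<lambda>x. F \<xi> x)" for \<xi>
      by (rule Bochner_Integration.integrable_bound[of _ "\<lambda>x. W x * cmod (g \<xi>)"])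
        (use W in \<open>auto simp: nF abs_mult\<close>, simp add: F_def)
    then show "AE \<xi> in lborel. integrable lborel (\<lambda>x. case_prod F (\<xi>, x))" by simp
  qed
  then have "(LINT x|lborel. LINT \<xi>|lborel. F \<xi> x) = (LINT \<xi>|lborel. LINT x|lborel. F \<xi> x)"
    by (rule lborel_pair.Fubini_integral)
  moreover have "(LINT \<xi>|lborel. F \<xi> x) = complex_of_real (W x) * (LINT \<xi>|lborel. g \<xi> * cis (c * (\<xi> \<bullet> x)))" for x
    unfolding F_def by (rule integral_mult_right_zero)
  moreover have "(LINT x|lborel. F \<xi> x) = g \<xi> * (LINT x|lborel. complex_of_real (W x) * cis (c * (\<xi> \<bullet> x)))" for \<xi>
    unfolding F_def by (subst integral_mult_right_zero[symmetric]) (simp add: ac_simps)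
  ultimately show ?thesis by simp
qed

text \<open>Integrability is not assumed: otherwise the Bochner integral is 0 by convention.\<close>

lemma norm_integral_le_nn_integral:
  fixes f :: "'a \<Rightarrow> 'b::{banach, second_countable_topology}"
  shows "ennreal (norm (integral\<^sup>L M f)) \<le> (\<integral>\<^sup>+x. norm (f x) \<partial>M)"
  by (cases "integrable M f") (auto simp: integral_norm_bound_ennreal not_integrable_integral_eq)

text \<open>The Gaussian weight makes all integrals absolutely convergent. Its transform is a
  nonnegative kernel, so \<open>2 |W x W y| \<le> (W x)\<^sup>2 + (W y)\<^sup>2\<close> suffices.\<close>

lemma fourier_gauss_bound:
  fixes W :: "'a::euclidean_space \<Rightarrow> real"
  assumes W: "integrable lborel W" and W2: "integrable lborel (\<lambda>x. (W x)\<^sup>2)" and \<sigma>: "\<sigma> > 0"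
  defines "F \<equiv> \<lambda>\<xi>. LINT x|lborel. complex_of_real (W x) * cis (- (\<xi> \<bullet> x))"
  shows "(\<integral>\<^sup>+\<xi>. ennreal ((cmod (F \<xi>))\<^sup>2 * gauss \<sigma> \<xi>) \<partial>lborel) \<le>
    ennreal ((LINT x|lborel. (W x)\<^sup>2) * (sqrt (2 * pi) / \<sigma>) ^ DIM('a))"
proof -
  let ?J = "\<lambda>y. LINT x|lborel. complex_of_real (W x) * complex_of_real (gauss_hat \<sigma> (y - x))"
  let ?h = "\<lambda>y x. ennreal (1/2 * (W y)\<^sup>2 * gauss_hat \<sigma> (y - x) + 1/2 * (W x)\<^sup>2 * gauss_hat \<sigma> (y - x))"
  have [measurable]: "W \<in> borel_measurable borel" using W by auto
  have F_meas [measurable]: "F \<in> borel_measurable borel" unfolding F_def by measurable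
  define B where "B = (LINT x|lborel. \<bar>W x\<bar>)"
  have F_bound: "cmod (F \<xi>) \<le> B" for \<xi>
    unfolding F_def B_def by (rule order_trans[OF integral_norm_bound]) (simp add: norm_mult)
  have B0: "0 \<le> B" by (simp add: B_def)
  have F_cnj: "cnj (F \<xi>) = (LINT x|lborel. complex_of_real (W x) * cis (\<xi> \<bullet> x))" for \<xi>
    unfolding F_def by (subst Bochner_Integration.integral_cnj[symmetric]) (simp add: cis_cnj)
  have int1: "integrable lborel (\<lambda>\<xi>. gauss \<sigma> \<xi> *\<^sub>R F \<xi>)"
    by (rule Bochner_Integration.integrable_bound[OF integrable_mult_left[OF integrable_gauss[OF \<sigma>], of B]])
      (auto simp: gauss_nonneg B0 abs_mult intro!: mult_left_mono F_bound)
  have int2: "integrable lborel (\<lambda>\<xi>. (cmod (F \<xi>))\<^sup>2 * gauss \<sigma> \<xi>)"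
    by (rule Bochner_Integration.integrable_bound[OF integrable_mult_right[OF integrable_gauss[OF \<sigma>], of "B\<^sup>2"]])
      (auto simp: gauss_nonneg B0 abs_mult intro!: mult_right_mono power_mono F_bound)
  have int3: "integrable lborel (\<lambda>\<xi>. gauss \<sigma> \<xi> *\<^sub>R cis (\<xi> \<bullet> y))" for y :: 'a
    by (rule Bochner_Integration.integrable_bound[OF integrable_gauss[OF \<sigma>]]) (auto simp: gauss_nonneg)
  have inner: "(LINT \<xi>|lborel. (gauss \<sigma> \<xi> *\<^sub>R F \<xi>) * cis (\<xi> \<bullet> y)) =
      ?J y" for y
  proof -
    have "(LINT \<xi>|lborel. (gauss \<sigma> \<xi> *\<^sub>R F \<xi>) * cis (\<xi> \<bullet> y)) =
      (LINT \<xi>|lborel. (gauss \<sigma> \<xi> *\<^sub>R cis (\<xi> \<bullet> y)) * (LINT x|lborel. complex_of_real (W x) * cis ((-1) * (\<xi> \<bullet> x))))"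
      by (simp add: F_def mult.commute)
    also have "\<dots> = (LINT x|lborel. complex_of_real (W x) * (LINT \<xi>|lborel. (gauss \<sigma> \<xi> *\<^sub>R cis (\<xi> \<bullet> y)) * cis ((-1) * (\<xi> \<bullet> x))))"
      by (rule fourier_Fubini[OF W int3])
    also have "\<dots> = (LINT x|lborel. complex_of_real (W x) * (LINT \<xi>|lborel. gauss \<sigma> \<xi> *\<^sub>R cis (\<xi> \<bullet> (y - x))))"
      by (simp add: cis_mult inner_diff_right)
    finally show ?thesis by (simp add: gauss_fourier[OF \<sigma>])
  qed
  \<comment> \<open>Write the squared modulus as F times its conjugate. Two exchanges of integrals
    turn the weighted integral into the double integral of W y W x against the kernel
    \<open>gauss_hat \<sigma> (y - x)\<close>.\<close>
  have "complex_of_real (LINT \<xi>|lborel. (cmod (F \<xi>))\<^sup>2 * gauss \<sigma> \<xi>) =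
      (LINT \<xi>|lborel. complex_of_real ((cmod (F \<xi>))\<^sup>2 * gauss \<sigma> \<xi>))"
    by (rule integral_complex_of_real[symmetric])
  also have "\<dots> = (LINT \<xi>|lborel. (gauss \<sigma> \<xi> *\<^sub>R F \<xi>) * (LINT x|lborel. complex_of_real (W x) * cis (1 * (\<xi> \<bullet> x))))"
    by (intro Bochner_Integration.integral_cong refl)
      (simp add: F_cnj[symmetric] complex_norm_square scaleR_conv_of_real mult.commute del: of_real_power)
  also have "\<dots> = (LINT y|lborel. complex_of_real (W y) * (LINT \<xi>|lborel. (gauss \<sigma> \<xi> *\<^sub>R F \<xi>) * cis (1 * (\<xi> \<bullet> y))))"
    by (rule fourier_Fubini[OF W int1])
  also have "\<dots> = (LINT y|lborel. complex_of_real (W y) * ?J y)"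
    unfolding mult_1_left inner ..
  finally have eq: "complex_of_real (LINT \<xi>|lborel. (cmod (F \<xi>))\<^sup>2 * gauss \<sigma> \<xi>) = \<dots>" .
  define K where "K = (\<integral>\<^sup>+x. gauss_hat \<sigma> (x::'a) \<partial>lborel)"
  have trans: "(\<integral>\<^sup>+x. gauss_hat \<sigma> (y - x) \<partial>lborel) = K" "(\<integral>\<^sup>+x. gauss_hat \<sigma> (x - y) \<partial>lborel) = K" for y :: 'a
  proof -
    have "K = (\<integral>\<^sup>+x. gauss_hat \<sigma> x \<partial>distr lborel borel ((+) (- y)))" by (simp add: K_def lborel_distr_plus)
    also have "\<dots> = (\<integral>\<^sup>+x. gauss_hat \<sigma> (- y + x) \<partial>lborel)" by (rule nn_integral_distr) auto
    finally show "(\<integral>\<^sup>+x. gauss_hat \<sigma> (x - y) \<partial>lborel) = K" by simp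
    moreover have "gauss_hat \<sigma> (x - y) = gauss_hat \<sigma> (y - x)" for x
      unfolding gauss_hat_def by (intro prod.cong refl) (simp add: inner_diff_left power2_commute power_mult_distrib)
    ultimately show "(\<integral>\<^sup>+x. gauss_hat \<sigma> (y - x) \<partial>lborel) = K" by simp
  qed
  define I where "I = (\<integral>\<^sup>+x. (W x)\<^sup>2 \<partial>lborel)"
  have "(\<integral>\<^sup>+\<xi>. ennreal ((cmod (F \<xi>))\<^sup>2 * gauss \<sigma> \<xi>) \<partial>lborel) = ennreal (LINT \<xi>|lborel. (cmod (F \<xi>))\<^sup>2 * gauss \<sigma> \<xi>)"
    by (rule nn_integral_eq_integral[OF int2]) (simp add: gauss_nonneg)
  also have "\<dots> \<le> ennreal (cmod (complex_of_real (LINT \<xi>|lborel. (cmod (F \<xi>))\<^sup>2 * gauss \<sigma> \<xi>)))"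
    by (intro ennreal_leI) simp
  also have "\<dots> \<le> (\<integral>\<^sup>+y. cmod (complex_of_real (W y) * ?J y) \<partial>lborel)"
    unfolding eq by (rule norm_integral_le_nn_integral)
  also have "\<dots> \<le> (\<integral>\<^sup>+y. \<integral>\<^sup>+x. ?h y x \<partial>lborel \<partial>lborel)"
  proof (rule nn_integral_mono)
    fix y
    have "ennreal (cmod (complex_of_real (W y) * ?J y)) =
        ennreal (cmod (LINT x|lborel. complex_of_real (W y) * (complex_of_real (W x) * complex_of_real (gauss_hat \<sigma> (y - x)))))"
      by simp
    also have "\<dots> \<le> (\<integral>\<^sup>+x. cmod (complex_of_real (W y) * (complex_of_real (W x) * complex_of_real (gauss_hat \<sigma> (y - x)))) \<partial>lborel)"
      by (rule norm_integral_le_nn_integral)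
    also have "\<dots> \<le> (\<integral>\<^sup>+x. ?h y x \<partial>lborel)"
    proof (intro nn_integral_mono ennreal_leI)
      fix x
      have "\<bar>W y\<bar> * \<bar>W x\<bar> \<le> 1/2 * (W y)\<^sup>2 + 1/2 * (W x)\<^sup>2"
        using sum_squares_bound[of "\<bar>W y\<bar>" "\<bar>W x\<bar>"] by simp
      then have "(\<bar>W y\<bar> * \<bar>W x\<bar>) * gauss_hat \<sigma> (y - x) \<le> (1/2 * (W y)\<^sup>2 + 1/2 * (W x)\<^sup>2) * gauss_hat \<sigma> (y - x)"
        by (rule mult_right_mono) (rule gauss_hat_nonneg)
      then show "cmod (complex_of_real (W y) * (complex_of_real (W x) * complex_of_real (gauss_hat \<sigma> (y - x)))) \<le>
          1/2 * (W y)\<^sup>2 * gauss_hat \<sigma> (y - x) + 1/2 * (W x)\<^sup>2 * gauss_hat \<sigma> (y - x)"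
        by (simp add: norm_mult gauss_hat_nonneg distrib_right mult.assoc)
    qed
    finally show "ennreal (cmod (complex_of_real (W y) * ?J y))
      \<le> (\<integral>\<^sup>+x. ?h y x \<partial>lborel)" .
  qed
  also have "\<dots> = (\<integral>\<^sup>+y. \<integral>\<^sup>+x. ennreal (1/2) * (ennreal ((W y)\<^sup>2) * ennreal (gauss_hat \<sigma> (y - x))) \<partial>lborel \<partial>lborel) +
      (\<integral>\<^sup>+y. \<integral>\<^sup>+x. ennreal (1/2) * (ennreal ((W x)\<^sup>2) * ennreal (gauss_hat \<sigma> (y - x))) \<partial>lborel \<partial>lborel)"
  proof -
    have split: "ennreal (c * a * h + c * b * h) = ennreal c * (ennreal a * ennreal h) + ennreal c * (ennreal b * ennreal h)"
      if "0 \<le> a" "0 \<le> b" "0 \<le> h" "0 \<le> c" for a b c h :: real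
      using that by (simp add: ennreal_plus ennreal_mult mult.assoc)
    have half: "0 \<le> (1/2 :: real)" by simp
    show ?thesis
      unfolding split[OF zero_le_power2 zero_le_power2 gauss_hat_nonneg half]
      by (simp add: nn_integral_add)
  qed
  also have "(\<integral>\<^sup>+y. \<integral>\<^sup>+x. ennreal (1/2) * (ennreal ((W y)\<^sup>2) * ennreal (gauss_hat \<sigma> (y - x))) \<partial>lborel \<partial>lborel) = ennreal (1/2) * (I * K)"
    by (simp add: nn_integral_cmult trans nn_integral_multc I_def)
  also have "(\<integral>\<^sup>+y. \<integral>\<^sup>+x. ennreal (1/2) * (ennreal ((W x)\<^sup>2) * ennreal (gauss_hat \<sigma> (y - x))) \<partial>lborel \<partial>lborel) =
      (\<integral>\<^sup>+x. \<integral>\<^sup>+y. ennreal (1/2) * (ennreal ((W x)\<^sup>2) * ennreal (gauss_hat \<sigma> (y - x))) \<partial>lborel \<partial>lborel)"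
    by (rule lborel_pair.Fubini') measurable
  also have "\<dots> = ennreal (1/2) * (I * K)"
    by (simp add: nn_integral_cmult trans nn_integral_multc I_def)
  also have "ennreal (1/2) * (I * K) + ennreal (1/2) * (I * K) = I * K"
  proof -
    have "ennreal (1/2) + ennreal (1/2) = 1" by (subst ennreal_plus[symmetric]) simp_all
    then show ?thesis by (metis distrib_right mult_1)
  qed
  also have "I * K = ennreal ((LINT x|lborel. (W x)\<^sup>2) * (sqrt (2 * pi) / \<sigma>) ^ DIM('a))"
    using W2 \<sigma> by (simp add: I_def K_def nn_integral_eq_integral nn_integral_gauss_hat ennreal_mult)
  finally show ?thesis .
qed

text \<open>Gaussians rescaled to have height 1 tend to 1 pointwise as their width grows, while the
  weighted integrals stay below a bound free of the width; Fatou's lemma concludes.\<close>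

lemma fourier_integral_square_integrable:
  fixes W :: "'a::euclidean_space \<Rightarrow> real"
  assumes W: "integrable lborel W" and W2: "integrable lborel (\<lambda>x. (W x)\<^sup>2)"
  defines "F \<equiv> \<lambda>\<xi>. LINT x|lborel. complex_of_real (W x) * cis (- (\<xi> \<bullet> x))"
  shows "F \<in> borel_measurable borel" "integrable lborel (\<lambda>\<xi>. (cmod (F \<xi>))\<^sup>2)"
proof -
  have [measurable]: "W \<in> borel_measurable borel" using W by auto
  show F_meas [measurable]: "F \<in> borel_measurable borel" unfolding F_def by measurable
  define C where "C = (LINT x|lborel. (W x)\<^sup>2) * (2 * pi) ^ DIM('a)"
  define r where "r k = real (Suc k)" for k
  define g where "g k \<xi> = (\<Prod>b\<in>Basis. exp (- (\<xi> \<bullet> b)\<^sup>2 / (2 * (r k)\<^sup>2)))" for k and \<xi> :: 'a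
  have r: "r k > 0" for k by (simp add: r_def)
  have [measurable]: "g k \<in> borel_measurable borel" for k unfolding g_def[abs_def] by measurable
  have g_eq: "g k \<xi> = (r k * sqrt (2 * pi)) ^ DIM('a) * gauss (r k) \<xi>" for k \<xi>
  proof -
    have "exp (- t\<^sup>2 / (2 * (r k)\<^sup>2)) = (r k * sqrt (2 * pi)) * normal_density 0 (r k) t" for t
      using r[of k] by (simp add: normal_density_def real_sqrt_mult)
    then show ?thesis unfolding g_def gauss_def by (simp add: prod.distrib)
  qed
  have le: "(\<integral>\<^sup>+\<xi>. ennreal ((cmod (F \<xi>))\<^sup>2 * g k \<xi>) \<partial>lborel) \<le> ennreal C" for k
  proof -
    have "(\<integral>\<^sup>+\<xi>. ennreal ((cmod (F \<xi>))\<^sup>2 * g k \<xi>) \<partial>lborel) =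
        (\<integral>\<^sup>+\<xi>. ennreal ((r k * sqrt (2 * pi)) ^ DIM('a)) * ennreal ((cmod (F \<xi>))\<^sup>2 * gauss (r k) \<xi>) \<partial>lborel)"
      using r[of k] by (intro nn_integral_cong) (simp add: g_eq ennreal_mult'[symmetric] gauss_nonneg ac_simps)
    also have "\<dots> = ennreal ((r k * sqrt (2 * pi)) ^ DIM('a)) * (\<integral>\<^sup>+\<xi>. ennreal ((cmod (F \<xi>))\<^sup>2 * gauss (r k) \<xi>) \<partial>lborel)"
      by (rule nn_integral_cmult) measurable
    also have "\<dots> \<le> ennreal ((r k * sqrt (2 * pi)) ^ DIM('a)) *
        ennreal ((LINT x|lborel. (W x)\<^sup>2) * (sqrt (2 * pi) / r k) ^ DIM('a))"
      unfolding F_def by (intro mult_left_mono fourier_gauss_bound W W2 r) simp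
    also have "\<dots> = ennreal C"
    proof -
      \<comment> \<open>The width cancels here. What is left, (2 pi)^d, is the Plancherel constant
        of the transform without its normalising factor.\<close>
      have "(r k * sqrt (2 * pi)) * (sqrt (2 * pi) / r k) = 2 * pi" using r[of k] by simp
      then have "(r k * sqrt (2 * pi)) ^ DIM('a) * (sqrt (2 * pi) / r k) ^ DIM('a) = (2 * pi) ^ DIM('a)"
        by (metis power_mult_distrib)
      then have "(r k * sqrt (2 * pi)) ^ DIM('a) * ((LINT x|lborel. (W x)\<^sup>2) * (sqrt (2 * pi) / r k) ^ DIM('a)) = C"
        by (simp add: C_def ac_simps)
      then show ?thesis using r[of k] by (simp add: ennreal_mult'[symmetric])
    qed
    finally show ?thesis .
  qed
  have lim: "(\<lambda>k. ennreal ((cmod (F \<xi>))\<^sup>2 * g k \<xi>)) \<longlonglongrightarrow> ennreal ((cmod (F \<xi>))\<^sup>2)" for \<xi>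
  proof -
    have "(\<lambda>k. inverse (r k)) \<longlonglongrightarrow> 0" unfolding r_def by (rule LIMSEQ_inverse_real_of_nat)
    then have "(\<lambda>k. \<Prod>b\<in>Basis. exp (- (\<xi> \<bullet> b)\<^sup>2 / 2 * (inverse (r k))\<^sup>2)) \<longlonglongrightarrow>
        (\<Prod>b\<in>(Basis :: 'a set). exp (- (\<xi> \<bullet> b)\<^sup>2 / 2 * 0\<^sup>2))"
      by (intro tendsto_intros)
    moreover have "g k \<xi> = (\<Prod>b\<in>Basis. exp (- (\<xi> \<bullet> b)\<^sup>2 / 2 * (inverse (r k))\<^sup>2))" for k
      unfolding g_def by (intro prod.cong refl arg_cong[of _ _ exp]) (simp add: field_simps)
    ultimately have "(\<lambda>k. g k \<xi>) \<longlonglongrightarrow> 1"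
      by simp
    from tendsto_mult[OF tendsto_const this] show ?thesis by (intro tendsto_ennrealI) simp
  qed
  have "(\<integral>\<^sup>+\<xi>. ennreal ((cmod (F \<xi>))\<^sup>2) \<partial>lborel) =
      (\<integral>\<^sup>+\<xi>. liminf (\<lambda>k. ennreal ((cmod (F \<xi>))\<^sup>2 * g k \<xi>)) \<partial>lborel)"
    using lim_imp_Liminf[OF _ lim] by simp
  also have "\<dots> \<le> liminf (\<lambda>k. \<integral>\<^sup>+\<xi>. ennreal ((cmod (F \<xi>))\<^sup>2 * g k \<xi>) \<partial>lborel)"
    by (rule nn_integral_liminf) measurable
  also have "\<dots> \<le> limsup (\<lambda>k. \<integral>\<^sup>+\<xi>. ennreal ((cmod (F \<xi>))\<^sup>2 * g k \<xi>) \<partial>lborel)"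
    by (rule Liminf_le_Limsup) simp
  also have "\<dots> \<le> ennreal C"
    by (rule Limsup_bounded) (simp add: le)
  finally have "(\<integral>\<^sup>+\<xi>. ennreal ((cmod (F \<xi>))\<^sup>2) \<partial>lborel) < \<infinity>"
    by (rule le_less_trans) simp
  then show "integrable lborel (\<lambda>\<xi>. (cmod (F \<xi>))\<^sup>2)"
    by (intro integrableI_nonneg) auto
qed

text \<open>Fubini's theorem was applied over \<open>lborel\<close>, whereas w is only Lebesgue
  measurable. A Borel function equal to w almost everywhere has the same transform at every
  frequency.\<close>

lemma fourier_square_integrable:
  fixes w :: "real^'n::finite \<Rightarrow> real"
  assumes "integrable lebesgue w" "integrable lebesgue (\<lambda>x. (w x)\<^sup>2)"
  shows "fourier w \<in> borel_measurable borel" "integrable lebesgue (\<lambda>\<xi>. (cmod (fourier w \<xi>))\<^sup>2)"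
proof -
  have w_meas: "w \<in> borel_measurable lebesgue" using assms by auto
  then obtain W where W: "W \<in> borel_measurable lborel" and "AE x in lborel. w x = W x"
    using completion_ex_borel_measurable_real by blast
  then have ae: "AE x in lebesgue. w x = W x" by (intro AE_completion)
  have W_meas: "W \<in> borel_measurable lebesgue" using W by (rule measurable_completion)
  have "integrable lebesgue W"
    using integrable_cong_AE_imp[OF assms(1) W_meas] ae by (auto elim: eventually_mono)
  then have i1: "integrable lborel W" using W by (subst (asm) integrable_completion) auto
  have "integrable lebesgue (\<lambda>x. (W x)\<^sup>2)"
    by (rule integrable_cong_AE_imp[OF assms(2)]) (use ae W_meas in \<open>auto elim: eventually_mono\<close>)
  then have i2: "integrable lborel (\<lambda>x. (W x)\<^sup>2)" using W by (subst (asm) integrable_completion) auto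
  define F where "F \<xi> = (LINT x|lborel. complex_of_real (W x) * cis (- (\<xi> \<bullet> x)))" for \<xi>
  have cis_leb: "(\<lambda>x. cis (- (\<xi> \<bullet> x))) \<in> borel_measurable lebesgue" for \<xi> :: "real^'n"
    by (rule measurable_completion) measurable
  have F_eq: "fourier w \<xi> = complex_of_real ((2 * pi) powr (- real CARD('n) / 2)) * F \<xi>" for \<xi>
  proof -
    have "(LINT x|lebesgue. complex_of_real (w x) * cis (- (\<xi> \<bullet> x))) =
        (LINT x|lebesgue. complex_of_real (W x) * cis (- (\<xi> \<bullet> x)))"
    proof (rule integral_cong_AE)
      show "(\<lambda>x. complex_of_real (w x) * cis (- (\<xi> \<bullet> x))) \<in> borel_measurable lebesgue"
        "(\<lambda>x. complex_of_real (W x) * cis (- (\<xi> \<bullet> x))) \<in> borel_measurable lebesgue"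
        using w_meas W_meas cis_leb by (auto intro!: borel_measurable_times)
      show "AE x in lebesgue. complex_of_real (w x) * cis (- (\<xi> \<bullet> x)) = complex_of_real (W x) * cis (- (\<xi> \<bullet> x))"
        using ae by (rule eventually_mono) simp
    qed
    also have "\<dots> = F \<xi>"
    proof -
      have [measurable]: "W \<in> borel_measurable borel" using W by simp
      show ?thesis unfolding F_def by (rule integral_completion) simp
    qed
    finally show ?thesis by (simp add: fourier_def)
  qed
  note F = fourier_integral_square_integrable[OF i1 i2, folded F_def]
  show "fourier w \<in> borel_measurable borel"
    using F(1) by (subst F_eq[abs_def]) simp
  have "integrable lborel (\<lambda>\<xi>. (cmod (fourier w \<xi>))\<^sup>2)"
    using F(2) by (simp add: F_eq norm_mult power_mult_distrib)
  then show "integrable lebesgue (\<lambda>\<xi>. (cmod (fourier w \<xi>))\<^sup>2)"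
    by (subst integrable_completion) auto
qed

section \<open>The energy space\<close>

lemma zero_extension_eq: "zero_extension S w = (\<lambda>x. indicator S x *\<^sub>R w x)"
  by (auto simp: zero_extension_def indicator_def)

context
  fixes S :: "(real^'n::finite) set"
  assumes open_S: "open S" and bounded_S: "bounded S"
begin

abbreviation hat :: "(real^'n \<Rightarrow> real) \<Rightarrow> real^'n \<Rightarrow> complex" where
  "hat w \<equiv> fourier (zero_extension S w)"

abbreviation weight :: "real \<Rightarrow> real^'n \<Rightarrow> real" where
  "weight s \<xi> \<equiv> 1 + norm \<xi> powr (2 * s)"

lemma S_lebesgue: "S \<inter> space lebesgue \<in> sets lebesgue"
  using open_S by auto

section \<open>Fourier transforms of zero extensions from S\<close>

lemma integral_zero_extension:
  "(LINT x|lebesgue. zero_extension S w x) = (LINT x|lebesgue_on S. w x)"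
  "integrable lebesgue (zero_extension S w) \<longleftrightarrow> integrable (lebesgue_on S) w"
  unfolding zero_extension_eq
  by (simp_all add: integral_restrict_space[OF S_lebesgue] integrable_restrict_space[OF S_lebesgue] del: real_scaleR_def)

lemma L2_integrable: "w \<in> L2 S \<Longrightarrow> integrable (lebesgue_on S) w"
  using L2_mult_integrable[of w S "\<lambda>x. 1"] smooth_L2[OF open_S bounded_S smooth_const] by simp

lemma L2_cos: "(\<lambda>x. cos (x \<bullet> \<xi>)) \<in> L2 S" and L2_sin: "(\<lambda>x. sin (x \<bullet> \<xi>)) \<in> L2 S"
  by (intro smooth_L2 open_S bounded_S smooth_cos_inner smooth_sin_inner)+

text \<open>Splitting into integrals against cosine and sine makes the transform accessible to
  integration by parts for real functions.\<close>

lemma fourier_zero_extension: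
  assumes w: "w \<in> L2 S"
  shows "hat w \<xi> = complex_of_real ((2 * pi) powr (- real CARD('n) / 2)) *
    Complex (LINT x|lebesgue_on S. w x * cos (x \<bullet> \<xi>)) (- (LINT x|lebesgue_on S. w x * sin (x \<bullet> \<xi>)))"
proof -
  let ?c = "zero_extension S (\<lambda>x. w x * cos (x \<bullet> \<xi>))" and ?s = "zero_extension S (\<lambda>x. w x * sin (x \<bullet> \<xi>))"
  have i: "integrable lebesgue ?c" "integrable lebesgue ?s"
    unfolding integral_zero_extension by (intro L2_mult_integrable w L2_cos L2_sin)+
  have "complex_of_real (zero_extension S w x) * cis (- (\<xi> \<bullet> x)) = complex_of_real (?c x) - \<i> * complex_of_real (?s x)" for x
    by (auto simp: zero_extension_def complex_eq_iff inner_commute)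
  then have "(LINT x|lebesgue. complex_of_real (zero_extension S w x) * cis (- (\<xi> \<bullet> x))) =
      (LINT x|lebesgue. complex_of_real (?c x)) - \<i> * (LINT x|lebesgue. complex_of_real (?s x))"
    using i by (simp add: Bochner_Integration.integral_diff)
  also have "\<dots> = Complex (LINT x|lebesgue_on S. w x * cos (x \<bullet> \<xi>)) (- (LINT x|lebesgue_on S. w x * sin (x \<bullet> \<xi>)))"
    by (simp add: integral_zero_extension complex_eq_iff)
  finally show ?thesis by (simp add: fourier_def)
qed

lemma fourier_zero_extension_add:
  assumes "v \<in> L2 S" "w \<in> L2 S"
  shows "hat (\<lambda>x. v x + w x) \<xi> = hat v \<xi> + hat w \<xi>"
  using assms L2_mult_integrable[OF _ L2_cos] L2_mult_integrable[OF _ L2_sin]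
  by (simp add: fourier_zero_extension L2_add distrib_right complex_eq_iff algebra_simps)

lemma fourier_zero_extension_scale:
  assumes "w \<in> L2 S"
  shows "hat (\<lambda>x. a * w x) \<xi> = complex_of_real a * hat w \<xi>"
  using assms by (simp add: fourier_zero_extension L2_scale complex_eq_iff mult.assoc)

lemma fourier_L2:
  assumes w: "w \<in> L2 S"
  shows "hat w \<in> borel_measurable borel"
    "integrable lebesgue (\<lambda>\<xi>. (cmod (hat w \<xi>))\<^sup>2)"
proof -
  have 1: "integrable lebesgue (zero_extension S w)"
    using L2_integrable[OF w] by (simp add: integral_zero_extension)
  have "(\<lambda>x. (zero_extension S w x)\<^sup>2) = zero_extension S (\<lambda>x. (w x)\<^sup>2)"
    by (auto simp: zero_extension_def)
  then have 2: "integrable lebesgue (\<lambda>x. (zero_extension S w x)\<^sup>2)"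
    using w by (simp add: integral_zero_extension L2_def)
  show "hat w \<in> borel_measurable borel"
    "integrable lebesgue (\<lambda>\<xi>. (cmod (hat w \<xi>))\<^sup>2)"
    by (rule fourier_square_integrable[OF 1 2])+
qed

lemma fourier_partial_H10:
  assumes w: "w \<in> H10 S"
  shows "hat (\<lambda>x. weak_gradient S w x $ i) \<xi> =
    \<i> * complex_of_real (\<xi> $ i) * hat w \<xi>"
proof -
  note parts = H10_integral_by_parts[OF open_S bounded_S w]
  have d: "(\<lambda>x. x \<bullet> \<xi>) differentiable (at x)" for x
    by (rule smooth_imp_differentiable[OF smooth_inner])
  have "partial_deriv i (\<lambda>x. cos (x \<bullet> \<xi>)) x = - sin (x \<bullet> \<xi>) * \<xi> $ i" for x
    using partial_deriv_compose[OF DERIV_cos d] by (simp add: partial_deriv_inner)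
  then have c: "(LINT x|lebesgue_on S. weak_gradient S w x $ i * cos (x \<bullet> \<xi>)) = \<xi> $ i * (LINT x|lebesgue_on S. w x * sin (x \<bullet> \<xi>))"
    using parts[OF smooth_cos_inner, of i \<xi>] by (simp add: mult.assoc[symmetric] mult.commute[of "\<xi> $ i"])
  have "partial_deriv i (\<lambda>x. sin (x \<bullet> \<xi>)) x = cos (x \<bullet> \<xi>) * \<xi> $ i" for x
    using partial_deriv_compose[OF DERIV_sin d] by (simp add: partial_deriv_inner)
  then have s: "(LINT x|lebesgue_on S. weak_gradient S w x $ i * sin (x \<bullet> \<xi>)) = - \<xi> $ i * (LINT x|lebesgue_on S. w x * cos (x \<bullet> \<xi>))"
    using parts[OF smooth_sin_inner, of i \<xi>] by (simp add: mult.assoc[symmetric] mult.commute[of "\<xi> $ i"])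
  show ?thesis
    unfolding fourier_zero_extension[OF weak_gradient_L2[OF H10_imp_H1[OF w]]]
      fourier_zero_extension[OF H1_imp_L2[OF H10_imp_H1[OF w]]] c s
    by (simp add: complex_eq_iff)
qed

lemma fourier_weighted_measurable:
  assumes "w \<in> L2 S"
  shows "(\<lambda>\<xi>. weight s \<xi> * (cmod (hat w \<xi>))\<^sup>2) \<in> borel_measurable lebesgue"
proof (rule measurable_completion)
  have [measurable]: "hat w \<in> borel_measurable borel" using fourier_L2(1)[OF assms] .
  show "(\<lambda>\<xi>. weight s \<xi> * (cmod (hat w \<xi>))\<^sup>2) \<in> borel_measurable lborel"
    by measurable
qed

section \<open>The fractional space and its bilinear form\<close>

lemma Ht_tilde_L2: "w \<in> Ht_tilde s S \<Longrightarrow> w \<in> L2 S"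
  by (simp add: Ht_tilde_def)

lemma Ht_tilde_integrable: "w \<in> Ht_tilde s S \<Longrightarrow> integrable lebesgue
     (\<lambda>\<xi>. weight s \<xi> * (cmod (hat w \<xi>))\<^sup>2)"
  by (simp add: Ht_tilde_def)

lemma Ht_tilde_add:
  assumes v: "v \<in> Ht_tilde s S" and w: "w \<in> Ht_tilde s S"
  shows "(\<lambda>x. v x + w x) \<in> Ht_tilde s S"
proof -
  note L = Ht_tilde_L2[OF v] Ht_tilde_L2[OF w]
  let ?v = "hat v" and ?w = "hat w"
  have "integrable lebesgue (\<lambda>\<xi>. weight s \<xi> * (cmod (hat (\<lambda>x. v x + w x) \<xi>))\<^sup>2)"
  proof (rule Bochner_Integration.integrable_bound)
    show "integrable lebesgue (\<lambda>\<xi>. 2 * (weight s \<xi> * (cmod (?v \<xi>))\<^sup>2) +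
        2 * (weight s \<xi> * (cmod (?w \<xi>))\<^sup>2))"
      using Ht_tilde_integrable[OF v] Ht_tilde_integrable[OF w] by simp
    show "(\<lambda>\<xi>. weight s \<xi> * (cmod (hat (\<lambda>x. v x + w x) \<xi>))\<^sup>2) \<in> borel_measurable lebesgue"
      by (rule fourier_weighted_measurable[OF L2_add[OF L]])
    have "weight s \<xi> * (cmod (?v \<xi> + ?w \<xi>))\<^sup>2 \<le>
        2 * (weight s \<xi> * (cmod (?v \<xi>))\<^sup>2) + 2 * (weight s \<xi> * (cmod (?w \<xi>))\<^sup>2)" for \<xi>
    proof -
      have "(cmod (?v \<xi> + ?w \<xi>))\<^sup>2 \<le> (cmod (?v \<xi>) + cmod (?w \<xi>))\<^sup>2"
        by (intro power_mono norm_triangle_ineq) auto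
      also have "\<dots> \<le> 2 * (cmod (?v \<xi>))\<^sup>2 + 2 * (cmod (?w \<xi>))\<^sup>2"
        using sum_squares_bound[of "cmod (?v \<xi>)" "cmod (?w \<xi>)"] by (simp add: power2_sum)
      finally have "weight s \<xi> * (cmod (?v \<xi> + ?w \<xi>))\<^sup>2 \<le>
          weight s \<xi> * (2 * (cmod (?v \<xi>))\<^sup>2 + 2 * (cmod (?w \<xi>))\<^sup>2)"
        by (rule mult_left_mono) simp
      then show ?thesis by (simp add: algebra_simps)
    qed
    then show "AE \<xi> in lebesgue. norm (weight s \<xi> * (cmod (hat (\<lambda>x. v x + w x) \<xi>))\<^sup>2) \<le>
        norm (2 * (weight s \<xi> * (cmod (?v \<xi>))\<^sup>2) + 2 * (weight s \<xi> * (cmod (?w \<xi>))\<^sup>2))"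
      by (simp add: fourier_zero_extension_add[OF L] abs_mult)
  qed
  then show ?thesis using L2_add[OF L] by (simp add: Ht_tilde_def)
qed

lemma Ht_tilde_scale: "w \<in> Ht_tilde s S \<Longrightarrow> (\<lambda>x. a * w x) \<in> Ht_tilde s S"
proof -
  assume w: "w \<in> Ht_tilde s S"
  note L = Ht_tilde_L2[OF w]
  have "weight s \<xi> * (cmod (hat (\<lambda>x. a * w x) \<xi>))\<^sup>2 =
      a\<^sup>2 * (weight s \<xi> * (cmod (hat w \<xi>))\<^sup>2)" for \<xi>
    by (simp add: fourier_zero_extension_scale[OF L] norm_mult power_mult_distrib)
  then have "(\<lambda>\<xi>. weight s \<xi> * (cmod (hat (\<lambda>x. a * w x) \<xi>))\<^sup>2) =
      (\<lambda>\<xi>. a\<^sup>2 * (weight s \<xi> * (cmod (hat w \<xi>))\<^sup>2))" by (rule ext)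
  moreover have "integrable lebesgue (\<lambda>\<xi>. a\<^sup>2 * (weight s \<xi> * (cmod (hat w \<xi>))\<^sup>2))"
    using Ht_tilde_integrable[OF w] by simp
  ultimately show ?thesis
    using L2_scale[OF L] by (simp add: Ht_tilde_def)
qed

lemma H10_subset_Ht_tilde:
  assumes "0 < s" "s < 1" and w: "w \<in> H10 S"
  shows "w \<in> Ht_tilde s S"
proof -
  have wH: "w \<in> H1 S" and wL: "w \<in> L2 S" using w H10_imp_H1 H1_imp_L2 by blast+
  let ?w = "hat w"
  have "integrable lebesgue (\<lambda>\<xi>. (\<xi> $ i)\<^sup>2 * (cmod (?w \<xi>))\<^sup>2)" for i
    using fourier_L2(2)[OF weak_gradient_L2[OF wH]]
    by (simp add: fourier_partial_H10[OF w] norm_mult power_mult_distrib)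
  then have "integrable lebesgue (\<lambda>\<xi>. 2 * (cmod (?w \<xi>))\<^sup>2 + (\<Sum>i\<in>UNIV. (\<xi> $ i)\<^sup>2 * (cmod (?w \<xi>))\<^sup>2))"
    using fourier_L2(2)[OF wL] by simp
  then have "integrable lebesgue (\<lambda>\<xi>. weight s \<xi> * (cmod (?w \<xi>))\<^sup>2)"
  proof (rule Bochner_Integration.integrable_bound)
    show "(\<lambda>\<xi>. weight s \<xi> * (cmod (?w \<xi>))\<^sup>2) \<in> borel_measurable lebesgue"
      by (rule fourier_weighted_measurable[OF wL])
    have "weight s \<xi> * (cmod (?w \<xi>))\<^sup>2 \<le>
        2 * (cmod (?w \<xi>))\<^sup>2 + (\<Sum>i\<in>UNIV. (\<xi> $ i)\<^sup>2 * (cmod (?w \<xi>))\<^sup>2)" for \<xi>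
    proof -
      \<comment> \<open>Low frequencies use s > 0 and high frequencies s < 1.\<close>
      have "norm \<xi> powr (2 * s) \<le> 1 + (norm \<xi>)\<^sup>2"
      proof (cases "norm \<xi> \<le> 1")
        case True
        then have "norm \<xi> powr (2 * s) \<le> 1 powr (2 * s)" using assms by (intro powr_mono2) auto
        then show ?thesis using zero_le_power2[of "norm \<xi>"] by (auto simp: add_increasing2)
      next
        case False
        then have "norm \<xi> powr (2 * s) \<le> norm \<xi> powr 2" using assms by (intro powr_mono) auto
        also have "\<dots> = (norm \<xi>)\<^sup>2" using False by (subst powr_numeral) auto
        finally show ?thesis by simp
      qed
      then have "weight s \<xi> * (cmod (?w \<xi>))\<^sup>2 \<le> (2 + (norm \<xi>)\<^sup>2) * (cmod (?w \<xi>))\<^sup>2"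
        by (intro mult_right_mono) auto
      then show ?thesis by (simp add: distrib_right norm_vec_square sum_distrib_right)
    qed
    then show "AE \<xi> in lebesgue. norm (weight s \<xi> * (cmod (?w \<xi>))\<^sup>2) \<le>
        norm (2 * (cmod (?w \<xi>))\<^sup>2 + (\<Sum>i\<in>UNIV. (\<xi> $ i)\<^sup>2 * (cmod (?w \<xi>))\<^sup>2))"
      by (intro AE_I2) (simp add: abs_mult sum_nonneg)
  qed
  then show ?thesis using wL by (simp add: Ht_tilde_def)
qed

text \<open>Splitting the weight into two square roots turns \<open>Ht_norm\<close> into an L2 norm,
  so that Cauchy-Schwarz bounds the fractional form.\<close>

lemma Ht_norm_square_integrable:
  assumes w: "w \<in> Ht_tilde s S"
  shows "square_integrable lebesgue (\<lambda>\<xi>. sqrt (weight s \<xi>) * cmod (hat w \<xi>))"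
    "Ht_norm s (zero_extension S w) =
      sqrt (LINT \<xi>|lebesgue. (sqrt (weight s \<xi>) * cmod (hat w \<xi>))\<^sup>2)"
proof -
  have [measurable]: "hat w \<in> borel_measurable borel" using fourier_L2(1)[OF Ht_tilde_L2[OF w]] .
  have "(\<lambda>\<xi>. sqrt (weight s \<xi>) * cmod (hat w \<xi>)) \<in> borel_measurable lebesgue"
    by (rule measurable_completion) measurable
  then show "square_integrable lebesgue (\<lambda>\<xi>. sqrt (weight s \<xi>) * cmod (hat w \<xi>))"
    using Ht_tilde_integrable[OF w] by (simp add: square_integrable_def power_mult_distrib)
  show "Ht_norm s (zero_extension S w) =
      sqrt (LINT \<xi>|lebesgue. (sqrt (weight s \<xi>) * cmod (hat w \<xi>))\<^sup>2)"
    by (simp add: Ht_norm_def power_mult_distrib)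
qed

lemma frac_form_integrable:
  assumes v: "v \<in> Ht_tilde s S" and w: "w \<in> Ht_tilde s S"
  shows "integrable lebesgue (\<lambda>\<xi>. complex_of_real (norm \<xi> powr (2 * s)) *
     hat v \<xi> * cnj (hat w \<xi>))" (is "integrable _ ?f")
    "\<bar>frac_form s S v w\<bar> \<le> Ht_norm s (zero_extension S v) * Ht_norm s (zero_extension S w)"
proof -
  let ?v = "\<lambda>\<xi>. sqrt (weight s \<xi>) * cmod (hat v \<xi>)"
  let ?w = "\<lambda>\<xi>. sqrt (weight s \<xi>) * cmod (hat w \<xi>)"
  have [measurable]: "hat v \<in> borel_measurable borel" "hat w \<in> borel_measurable borel"
    using fourier_L2(1) Ht_tilde_L2 v w by blast+
  have prod: "?v \<xi> * ?w \<xi> = weight s \<xi> * (cmod (hat v \<xi>) * cmod (hat w \<xi>))" for \<xi>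
    by (simp add: algebra_simps real_sqrt_mult[symmetric] flip: power2_eq_square)
  have le: "cmod (?f \<xi>) \<le> ?v \<xi> * ?w \<xi>" for \<xi>
    unfolding prod by (simp add: norm_mult distrib_right mult.assoc)
  have int: "integrable lebesgue (\<lambda>\<xi>. ?v \<xi> * ?w \<xi>)"
    by (intro square_integrable_mult Ht_norm_square_integrable v w)
  show f: "integrable lebesgue ?f"
  proof (rule Bochner_Integration.integrable_bound[OF int])
    have [measurable]: "(\<lambda>\<xi>. cnj (hat w \<xi>)) \<in> borel_measurable borel"
      by (rule borel_measurable_continuous_on[OF continuous_on_cnj[OF continuous_on_id]]) simp
    show "?f \<in> borel_measurable lebesgue" by (rule measurable_completion) measurable
    show "AE \<xi> in lebesgue. norm (?f \<xi>) \<le> norm (?v \<xi> * ?w \<xi>)"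
    proof (rule AE_I2)
      show "norm (?f \<xi>) \<le> norm (?v \<xi> * ?w \<xi>)" for \<xi>
        using order_trans[OF le abs_ge_self] by (simp only: real_norm_def)
    qed
  qed
  have "\<bar>frac_form s S v w\<bar> \<le> cmod (LINT \<xi>|lebesgue. ?f \<xi>)"
    unfolding frac_form_def by (rule abs_Re_le_cmod)
  also have "\<dots> \<le> (LINT \<xi>|lebesgue. cmod (?f \<xi>))" by (rule integral_norm_bound)
  also have "\<dots> \<le> (LINT \<xi>|lebesgue. ?v \<xi> * ?w \<xi>)"
    using f int le by (intro integral_mono) auto
  also have "\<dots> \<le> \<bar>LINT \<xi>|lebesgue. ?v \<xi> * ?w \<xi>\<bar>" by simp
  also have "\<dots> \<le> Ht_norm s (zero_extension S v) * Ht_norm s (zero_extension S w)"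
    unfolding Ht_norm_square_integrable(2)[OF v] Ht_norm_square_integrable(2)[OF w]
    by (intro Cauchy_Schwarz_integral Ht_norm_square_integrable v w)
  finally show "\<bar>frac_form s S v w\<bar> \<le> Ht_norm s (zero_extension S v) * Ht_norm s (zero_extension S w)" .
qed

lemma frac_form_add:
  assumes "u \<in> Ht_tilde s S" "v \<in> Ht_tilde s S" "w \<in> Ht_tilde s S"
  shows "frac_form s S u (\<lambda>x. v x + w x) = frac_form s S u v + frac_form s S u w"
  using frac_form_integrable(1)[OF assms(1,2)] frac_form_integrable(1)[OF assms(1,3)]
  by (simp add: frac_form_def fourier_zero_extension_add[OF Ht_tilde_L2[OF assms(2)] Ht_tilde_L2[OF assms(3)]] distrib_left)

lemma frac_form_scale:
  assumes "w \<in> Ht_tilde s S"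
  shows "frac_form s S u (\<lambda>x. a * w x) = a * frac_form s S u w"
proof -
  have "complex_of_real (norm \<xi> powr (2 * s)) * hat u \<xi> * cnj (hat (\<lambda>x. a * w x) \<xi>) =
      complex_of_real a * (complex_of_real (norm \<xi> powr (2 * s)) * hat u \<xi> * cnj (hat w \<xi>))" for \<xi>
    by (simp add: fourier_zero_extension_scale[OF Ht_tilde_L2[OF assms]])
  then show ?thesis
    unfolding frac_form_def by (simp only: integral_mult_right_zero) simp
qed

lemma continuous_L2_mult:
  assumes "continuous_on (closure S) h" "w \<in> L2 S"
  shows "(\<lambda>x. h x * w x) \<in> L2 S"
proof -
  have "compact (h ` closure S)"
    using assms(1) bounded_S by (intro compact_continuous_image) auto
  from compact_imp_bounded[OF this] obtain C where C: "\<And>x. x \<in> closure S \<Longrightarrow> \<bar>h x\<bar> \<le> C"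
    unfolding bounded_iff by auto
  have "continuous_on S h" using assms(1) by (rule continuous_on_subset[OF _ closure_subset])
  then have "h \<in> borel_measurable (lebesgue_on S)"
    using open_S by (intro continuous_imp_measurable_on_sets_lebesgue) auto
  then show ?thesis
    unfolding L2_iff using assms(2) C closure_subset[of S]
    by (intro square_integrable_bounded_mult[where C = C]) (auto simp: L2_iff)
qed

lemma L2_sum: "finite I \<Longrightarrow> (\<And>i. i \<in> I \<Longrightarrow> f i \<in> L2 S) \<Longrightarrow> (\<lambda>x. \<Sum>i\<in>I. f i x) \<in> L2 S"
proof (induction I rule: finite_induct)
  case empty
  show ?case using smooth_L2[OF open_S bounded_S smooth_const[of 0]] by simp
qed (auto intro: L2_add)

section \<open>The elliptic form with its first argument fixed\<close>

context
  fixes A :: "real^'n \<Rightarrow> real^'n^'n" and c v :: "real^'n \<Rightarrow> real"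
  assumes A_cont: "continuous_on (closure S) A" and c_cont: "continuous_on (closure S) c"
    and v: "v \<in> H1 S"
begin

text \<open>With v fixed, the components of A grad v are fixed L2 functions, and the leading part of
  \<open>L_form\<close> is a sum of L2 pairings with the components of the gradient of w.\<close>

definition flux :: "'n \<Rightarrow> real^'n \<Rightarrow> real" where
  "flux i x = (A x *v weak_gradient S v x) $ i"

lemma flux_L2: "flux i \<in> L2 S"
proof -
  have "continuous_on (closure S) (\<lambda>x. A x $ i $ j)" for j
    by (intro continuous_intros A_cont)
  then have "(\<lambda>x. \<Sum>j\<in>UNIV. A x $ i $ j * weak_gradient S v x $ j) \<in> L2 S"
    by (intro L2_sum continuous_L2_mult weak_gradient_L2 v) auto
  then show ?thesis by (simp add: flux_def[abs_def] matrix_vector_mult_def)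
qed

lemma reaction_L2: "(\<lambda>x. c x * v x) \<in> L2 S"
  by (intro continuous_L2_mult c_cont H1_imp_L2 v)

lemma L_form_eq:
  assumes w: "w \<in> H1 S"
  shows "L_form S A c v w = (\<Sum>i\<in>UNIV. LINT x|lebesgue_on S. flux i x * weak_gradient S w x $ i) +
    (LINT x|lebesgue_on S. c x * v x * w x)"
proof -
  have "weak_gradient S w x \<bullet> (A x *v weak_gradient S v x) = (\<Sum>i\<in>UNIV. flux i x * weak_gradient S w x $ i)" for x
    by (simp add: flux_def inner_vec_def mult.commute)
  moreover have "integrable (lebesgue_on S) (\<lambda>x. flux i x * weak_gradient S w x $ i)" for i
    by (intro L2_mult_integrable flux_L2 weak_gradient_L2 w)
  moreover have "integrable (lebesgue_on S) (\<lambda>x. c x * v x * w x)"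
    by (intro L2_mult_integrable reaction_L2 H1_imp_L2 w)
  ultimately show ?thesis by (simp add: L_form_def)
qed

lemma integral_flux_cong:
  assumes "AE x in lebesgue_on S. g x = h x" "\<And>i. (\<lambda>x. g x $ i) \<in> L2 S" "\<And>i. (\<lambda>x. h x $ i) \<in> L2 S"
  shows "(LINT x|lebesgue_on S. flux i x * g x $ i) = (LINT x|lebesgue_on S. flux i x * h x $ i)"
proof (rule integral_cong_AE)
  show "(\<lambda>x. flux i x * g x $ i) \<in> borel_measurable (lebesgue_on S)"
    "(\<lambda>x. flux i x * h x $ i) \<in> borel_measurable (lebesgue_on S)"
    by (intro borel_measurable_times L2_measurable flux_L2 assms)+
  show "AE x in lebesgue_on S. flux i x * g x $ i = flux i x * h x $ i"
    using assms(1) by (rule eventually_mono) simp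
qed

lemma L_form_add:
  assumes w: "w \<in> H1 S" and z: "z \<in> H1 S"
  shows "L_form S A c v (\<lambda>x. w x + z x) = L_form S A c v w + L_form S A c v z"
proof -
  have "(LINT x|lebesgue_on S. flux i x * weak_gradient S (\<lambda>x. w x + z x) x $ i) =
      (LINT x|lebesgue_on S. flux i x * (weak_gradient S w x + weak_gradient S z x) $ i)" for i
    using L2_add[OF weak_gradient_L2[OF w] weak_gradient_L2[OF z]]
    by (intro integral_flux_cong weak_gradient_add weak_gradient_L2 H1_add open_S w z) simp
  moreover have "integrable (lebesgue_on S) (\<lambda>x. flux i x * weak_gradient S u x $ i)" if "u \<in> H1 S" for i u
    by (intro L2_mult_integrable flux_L2 weak_gradient_L2 that)
  moreover have "integrable (lebesgue_on S) (\<lambda>x. c x * v x * u x)" if "u \<in> H1 S" for u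
    by (intro L2_mult_integrable reaction_L2 H1_imp_L2 that)
  ultimately show ?thesis
    using w z by (simp add: L_form_eq H1_add open_S distrib_left sum.distrib)
qed

lemma L_form_scale:
  assumes w: "w \<in> H1 S"
  shows "L_form S A c v (\<lambda>x. a * w x) = a * L_form S A c v w"
proof -
  have "(LINT x|lebesgue_on S. flux i x * weak_gradient S (\<lambda>x. a * w x) x $ i) =
      (LINT x|lebesgue_on S. flux i x * (a *\<^sub>R weak_gradient S w x) $ i)" for i
    using L2_scale[OF weak_gradient_L2[OF w]]
    by (intro integral_flux_cong weak_gradient_scale weak_gradient_L2 H1_scale open_S w) simp
  then show ?thesis
    using w by (simp add: L_form_eq H1_scale open_S distrib_left sum_distrib_left mult.left_commute[of _ a])
qed

text \<open>Bounding the L2 norm of w through its Fourier transform would take the Plancherel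
  estimate in the direction opposite to the one above. Poincare's inequality leaves only the
  gradient norm on the right.\<close>

lemma L_form_bounded:
  obtains C where "\<And>w. w \<in> H10 S \<Longrightarrow> \<bar>L_form S A c v w\<bar> \<le> C * H10_norm S w"
proof -
  obtain P where P: "P \<ge> 0" "\<And>w. w \<in> H10 S \<Longrightarrow> (LINT x|lebesgue_on S. (w x)\<^sup>2) \<le> P * (H10_norm S w)\<^sup>2"
    using Poincare_H10[OF open_S bounded_S] by blast
  define F where "F i = sqrt (LINT x|lebesgue_on S. (flux i x)\<^sup>2)" for i
  define G where "G = sqrt (LINT x|lebesgue_on S. (c x * v x)\<^sup>2)"
  have "\<bar>L_form S A c v w\<bar> \<le> ((\<Sum>i\<in>UNIV. F i) + G * sqrt P) * H10_norm S w" if w: "w \<in> H10 S" for w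
  proof -
    have wH: "w \<in> H1 S" using w by (rule H10_imp_H1)
    have N: "H10_norm S w \<ge> 0" by (simp add: H10_norm_def)
    have 1: "\<bar>LINT x|lebesgue_on S. flux i x * weak_gradient S w x $ i\<bar> \<le> F i * H10_norm S w" for i
    proof -
      have "\<bar>LINT x|lebesgue_on S. flux i x * weak_gradient S w x $ i\<bar> \<le>
          F i * sqrt (LINT x|lebesgue_on S. (weak_gradient S w x $ i)\<^sup>2)"
        unfolding F_def using flux_L2 weak_gradient_L2[OF wH]
        by (intro Cauchy_Schwarz_integral) (auto simp: L2_iff)
      also have "\<dots> \<le> F i * H10_norm S w"
      proof (rule mult_left_mono)
        show "sqrt (LINT x|lebesgue_on S. (weak_gradient S w x $ i)\<^sup>2) \<le> H10_norm S w"
          by (intro real_le_lsqrt N L2_square_le_sum wH)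
      qed (simp add: F_def)
      finally show ?thesis .
    qed
    have "\<bar>LINT x|lebesgue_on S. c x * v x * w x\<bar> \<le> G * sqrt (LINT x|lebesgue_on S. (w x)\<^sup>2)"
      unfolding G_def using reaction_L2 H1_imp_L2[OF wH]
      by (intro Cauchy_Schwarz_integral) (auto simp: L2_iff)
    also have "\<dots> \<le> G * sqrt (P * (H10_norm S w)\<^sup>2)"
      by (intro mult_left_mono real_sqrt_le_mono P w) (simp add: G_def)
    also have "\<dots> = G * sqrt P * H10_norm S w" using N by (simp add: real_sqrt_mult)
    finally have 2: "\<bar>LINT x|lebesgue_on S. c x * v x * w x\<bar> \<le> G * sqrt P * H10_norm S w" .
    have "\<bar>L_form S A c v w\<bar> \<le> (\<Sum>i\<in>UNIV. \<bar>LINT x|lebesgue_on S. flux i x * weak_gradient S w x $ i\<bar>) +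
        \<bar>LINT x|lebesgue_on S. c x * v x * w x\<bar>"
      unfolding L_form_eq[OF wH] by (rule order_trans[OF abs_triangle_ineq add_right_mono[OF sum_abs]])
    also have "\<dots> \<le> (\<Sum>i\<in>UNIV. F i * H10_norm S w) + G * sqrt P * H10_norm S w"
      by (intro add_mono sum_mono 1 2)
    finally show ?thesis by (simp add: distrib_right sum_distrib_right)
  qed
  then show ?thesis by (rule that)
qed

end

section \<open>The energy space and the dual functional\<close>

context
  fixes \<iota> :: nat and s :: real
  assumes \<iota>: "\<iota> = 0 \<or> \<iota> = 1" and s: "0 < s" "s < 1"
begin

lemma V_space_Ht_tilde: "v \<in> V_space \<iota> s S \<Longrightarrow> v \<in> Ht_tilde s S"
  using H10_subset_Ht_tilde[OF s] by (auto simp: V_space_def split: if_splits)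

lemma V_space_add: "v \<in> V_space \<iota> s S \<Longrightarrow> w \<in> V_space \<iota> s S \<Longrightarrow> (\<lambda>x. v x + w x) \<in> V_space \<iota> s S"
  by (auto simp: V_space_def Ht_tilde_add H10_add open_S split: if_splits)

lemma V_space_scale: "w \<in> V_space \<iota> s S \<Longrightarrow> (\<lambda>x. a * w x) \<in> V_space \<iota> s S"
  by (auto simp: V_space_def Ht_tilde_scale H10_scale open_S split: if_splits)

lemma test_functions_V_space: "\<phi> \<in> test_functions S \<Longrightarrow> \<phi> \<in> V_space \<iota> s S"
  using H10_test[OF open_S] H10_subset_Ht_tilde[OF s] by (auto simp: V_space_def)

lemma Ht_norm_nonneg: "0 \<le> Ht_norm s z"
  unfolding Ht_norm_def by (intro real_sqrt_ge_zero integral_nonneg_AE AE_I2) simp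

lemma V_norm_ge_Ht_norm: "Ht_norm s (zero_extension S v) \<le> V_norm \<iota> s S v"
  unfolding V_norm_def by (rule real_le_rsqrt) simp

lemma V_norm_ge_H10_norm: "\<iota> = 1 \<Longrightarrow> H10_norm S v \<le> V_norm \<iota> s S v"
  unfolding V_norm_def by (rule real_le_rsqrt) simp

text \<open>Each summand is linear in v and bounded by the norm of v times a constant depending on
  u. Membership in \<open>H10\<close> is available only for \<iota> = 1; for \<iota> = 0 the factor
  \<iota> removes the elliptic term.\<close>

lemma A_form_V_dual:
  assumes A: "continuous_on (closure S) A" and c: "continuous_on (closure S) c"
    and D: "convection_form \<iota> s S \<beta> D" and f: "f \<in> V_dual \<iota> s S" and u: "u \<in> V_space \<iota> s S"
  shows "(\<lambda>v. A_form \<iota> s S A c D u v - f v) \<in> V_dual \<iota> s S"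
proof -
  let ?V = "V_space \<iota> s S" and ?N = "V_norm \<iota> s S"
  have H10: "v \<in> H10 S" if "\<iota> = 1" "v \<in> ?V" for v using that by (simp add: V_space_def)
  have f_lin: "linear_on_space ?V f" using f by (simp add: V_dual_def)
  have D_lin: "linear_on_space ?V (D u)" using D u by (simp add: convection_form_def)
  have L_lin: "linear_on_space ?V (\<lambda>v. real \<iota> * L_form S A c u v)"
  proof (cases "\<iota> = 1")
    case True
    note H = H10_imp_H1[OF H10[OF True]]
    show ?thesis
      unfolding linear_on_space_def
      using L_form_add[OF A c H[OF u] H H] L_form_scale[OF A c H[OF u] H] by (simp add: distrib_left)
  next
    case False
    then show ?thesis using \<iota> by (simp add: linear_on_space_def)
  qed
  have a_lin: "linear_on_space ?V (frac_form s S u)"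
    unfolding linear_on_space_def
  proof (intro conjI ballI allI)
    show "frac_form s S u (\<lambda>x. v x + w x) = frac_form s S u v + frac_form s S u w" if "v \<in> ?V" "w \<in> ?V" for v w
      by (intro frac_form_add V_space_Ht_tilde u that)
    show "frac_form s S u (\<lambda>x. a * w x) = a * frac_form s S u w" if "w \<in> ?V" for a w
      by (intro frac_form_scale V_space_Ht_tilde that)
  qed
  have lin: "linear_on_space ?V (\<lambda>v. A_form \<iota> s S A c D u v - f v)"
    using f_lin D_lin L_lin a_lin unfolding linear_on_space_def A_form_def
    by (simp add: algebra_simps)
  obtain Cf where Cf: "\<And>v. v \<in> ?V \<Longrightarrow> \<bar>f v\<bar> \<le> Cf * ?N v" using f by (auto simp: V_dual_def)
  obtain CD where CD: "\<And>v. v \<in> ?V \<Longrightarrow> \<bar>D u v\<bar> \<le> CD * ?N v"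
    using D u unfolding convection_form_def by blast
  have Ca: "\<bar>frac_form s S u v\<bar> \<le> Ht_norm s (zero_extension S u) * ?N v" if "v \<in> ?V" for v
    using frac_form_integrable(2)[OF V_space_Ht_tilde[OF u] V_space_Ht_tilde[OF that]]
      mult_left_mono[OF V_norm_ge_Ht_norm[of v] Ht_norm_nonneg] by (rule order_trans)
  obtain CL where CL: "\<And>v. v \<in> ?V \<Longrightarrow> \<bar>real \<iota> * L_form S A c u v\<bar> \<le> CL * ?N v"
  proof (cases "\<iota> = 1")
    case True
    obtain C where C: "\<And>w. w \<in> H10 S \<Longrightarrow> \<bar>L_form S A c u w\<bar> \<le> C * H10_norm S w"
      using L_form_bounded[OF A c H10_imp_H1[OF H10[OF True u]]] by blast
    have "\<bar>real \<iota> * L_form S A c u v\<bar> \<le> \<bar>C\<bar> * ?N v" if v: "v \<in> ?V" for v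
    proof -
      have N: "H10_norm S v \<ge> 0" by (simp add: H10_norm_def)
      have "\<bar>L_form S A c u v\<bar> \<le> C * H10_norm S v" by (rule C[OF H10[OF True v]])
      also have "\<dots> \<le> \<bar>C\<bar> * H10_norm S v" using N by (intro mult_right_mono) auto
      also have "\<dots> \<le> \<bar>C\<bar> * ?N v" by (intro mult_left_mono V_norm_ge_H10_norm True) simp
      finally show ?thesis using True by simp
    qed
    then show ?thesis by (rule that)
  next
    case False
    then show ?thesis using \<iota> that[of 0] by simp
  qed
  have "\<bar>A_form \<iota> s S A c D u v - f v\<bar> \<le> (CL + CD + Ht_norm s (zero_extension S u) + Cf) * ?N v"
    if "v \<in> ?V" for v
    using Cf[OF that] CD[OF that] Ca[OF that] CL[OF that] unfolding A_form_def distrib_right by linarith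
  then show ?thesis using lin unfolding V_dual_def by blast
qed

end

end

section \<open>Complementarity\<close>

text \<open>By continuity the exceptional set is open, and a nonempty open set is not negligible.
  The pointwise form is required because the representing measure need not be absolutely
  continuous.\<close>

lemma AE_le_imp_le_on_open:
  fixes f g :: "real^'n::finite \<Rightarrow> real"
  assumes "open S" "continuous_on S f" "continuous_on S g"
    and ae: "AE x in lebesgue_on S. f x \<le> g x" and x: "x \<in> S"
  shows "f x \<le> g x"
proof (rule ccontr)
  assume neg: "\<not> f x \<le> g x"
  define N where "N = {x \<in> S. g x < f x}"
  have "open (S \<inter> (\<lambda>x. f x - g x) -` {0<..})"
    by (intro continuous_open_preimage continuous_on_diff assms open_greaterThan)
  moreover have "S \<inter> (\<lambda>x. f x - g x) -` {0<..} = N" by (auto simp: N_def)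
  ultimately have N: "open N" by simp
  have "AE x in lebesgue. x \<in> S \<longrightarrow> f x \<le> g x"
    using ae assms(1) by (subst (asm) AE_restrict_space_iff) auto
  then have "AE x in lebesgue. x \<notin> N" by (rule eventually_mono) (auto simp: N_def)
  then have "N \<in> null_sets lebesgue" using N by (subst (asm) AE_iff_null_sets[symmetric]) auto
  then have "negligible N" by (simp add: negligible_iff_null_sets)
  moreover have "N \<noteq> {}" using neg x by (auto simp: N_def)
  ultimately show False using open_not_negligible[OF N] by blast
qed

theorem theorem2p5:
  fixes \<Omega> :: "(real^'n::finite) set"
    and \<iota> :: nat and s a0 a1 :: real
    and A :: "real^'n \<Rightarrow> real^'n^'n" and c :: "real^'n \<Rightarrow> real"
    and \<beta> :: "real^'n \<Rightarrow> real^'n"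
    and D :: "(real^'n \<Rightarrow> real) \<Rightarrow> (real^'n \<Rightarrow> real) \<Rightarrow> real"
    and obst u :: "real^'n \<Rightarrow> real"
    and f \<Lambda> :: "(real^'n \<Rightarrow> real) \<Rightarrow> real"
  assumes "CARD('n) \<in> {1, 2, 3}"
    and "bounded_lipschitz_domain \<Omega>"
    and "admissible_diffusion \<Omega> a0 a1 A"
    and "admissible_reaction \<Omega> c"
    and "admissible_convection \<Omega> \<beta>"
    and "case_A \<iota> s \<Omega> \<beta> \<or> case_B \<iota> s \<Omega> \<beta> \<or> case_C \<iota> s"
    and "convection_form \<iota> s \<Omega> \<beta> D"
    and "Ck_closure 2 \<Omega> obst"
    and "\<forall>x\<in>frontier \<Omega>. obst x < 0"
    and "f \<in> V_dual \<iota> s \<Omega>"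
    and "u \<in> K_set \<iota> s \<Omega> obst"
    and "\<forall>v\<in>K_set \<iota> s \<Omega> obst.
           A_form \<iota> s \<Omega> A c D u (\<lambda>x. u x - v x) \<le> f (\<lambda>x. u x - v x)"
    and "\<Lambda> = (\<lambda>v. A_form \<iota> s \<Omega> A c D u v - f v)"
  shows "\<Lambda> \<in> V_dual \<iota> s \<Omega> \<and> nonneg_in_dual \<iota> s \<Omega> \<Lambda> \<and>
    (continuous_on (closure \<Omega>) u \<longrightarrow>
       nonneg_distribution \<Omega> \<Lambda> \<and>
       nonneg_distribution \<Omega> (regular_distribution \<Omega> (\<lambda>x. u x - obst x)) \<and>
       product_vanishes \<Omega> \<Lambda> (\<lambda>x. u x - obst x))"
proof -
  have \<Omega>: "open \<Omega>" "bounded \<Omega>" using assms(2) by (auto simp: bounded_lipschitz_domain_def)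
  have \<iota>: "\<iota> = 0 \<or> \<iota> = 1" and s: "0 < s" "s < 1"
    using assms(6) by (auto simp: case_A_def case_B_def case_C_def)
  let ?V = "V_space \<iota> s \<Omega>"
  note V = V_space_add[OF \<Omega> \<iota> s] V_space_scale[OF \<Omega> \<iota> s] test_functions_V_space[OF \<Omega> \<iota> s]
  have A: "continuous_on (closure \<Omega>) A" and c: "continuous_on (closure \<Omega>) c"
    using assms(3,4) lipschitz_on_continuous_on
    by (auto simp: admissible_diffusion_def admissible_reaction_def)
  have u: "u \<in> ?V" and ob: "AE x in lebesgue_on \<Omega>. obst x \<le> u x"
    using assms(11) by (auto simp: K_set_def)
  have dual: "\<Lambda> \<in> V_dual \<iota> s \<Omega>"
    unfolding assms(13) by (rule A_form_V_dual[OF \<Omega> \<iota> s A c assms(7,10) u])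
  then have lin: "linear_on_space ?V \<Lambda>" by (simp add: V_dual_def)
  have VI: "\<Lambda> (\<lambda>x. u x - v x) \<le> 0" if "v \<in> K_set \<iota> s \<Omega> obst" for v
    using assms(12) that by (simp add: assms(13))
  have nonneg: "nonneg_in_dual \<iota> s \<Omega> \<Lambda>"
    unfolding nonneg_in_dual_def
  proof (intro ballI impI)
    fix \<phi> assume \<phi>: "\<phi> \<in> ?V" "AE x in lebesgue_on \<Omega>. 0 \<le> \<phi> x"
    have "AE x in lebesgue_on \<Omega>. obst x \<le> u x + \<phi> x"
      using ob \<phi>(2) by eventually_elim simp
    then have "(\<lambda>x. u x + \<phi> x) \<in> K_set \<iota> s \<Omega> obst" using V(1)[OF u \<phi>(1)] by (simp add: K_set_def)
    from VI[OF this] have "\<Lambda> (\<lambda>x. (-1) * \<phi> x) \<le> 0" by simp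
    moreover have "\<Lambda> (\<lambda>x. (-1) * \<phi> x) = (-1) * \<Lambda> \<phi>"
      using lin \<phi>(1) unfolding linear_on_space_def by blast
    ultimately show "0 \<le> \<Lambda> \<phi>" by simp
  qed
  have "nonneg_distribution \<Omega> \<Lambda> \<and>
       nonneg_distribution \<Omega> (regular_distribution \<Omega> (\<lambda>x. u x - obst x)) \<and>
       product_vanishes \<Omega> \<Lambda> (\<lambda>x. u x - obst x)" if u_cont: "continuous_on (closure \<Omega>) u"
  proof (intro conjI)
    show nn: "nonneg_distribution \<Omega> \<Lambda>"
      using nonneg V(3) unfolding nonneg_distribution_def nonneg_in_dual_def by auto
    show "nonneg_distribution \<Omega> (regular_distribution \<Omega> (\<lambda>x. u x - obst x))"
      unfolding nonneg_distribution_def regular_distribution_def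
    proof (intro ballI impI integral_nonneg_AE)
      fix \<phi> :: "real^'n \<Rightarrow> real" assume "\<forall>x. 0 \<le> \<phi> x"
      then show "AE x in lebesgue_on \<Omega>. 0 \<le> (u x - obst x) * \<phi> x"
        using ob by (auto elim!: eventually_mono)
    qed
    have "continuous_on (closure \<Omega>) obst"
      using assms(8) by (simp add: numeral_2_eq_2)
    then have cont: "continuous_on \<Omega> obst" "continuous_on \<Omega> u"
      using u_cont by (auto intro: continuous_on_subset[OF _ closure_subset])
    have ob_le: "obst x \<le> u x" if "x \<in> \<Omega>" for x
      using AE_le_imp_le_on_open[OF \<Omega>(1) cont ob that] .
    have "positive_functional \<Omega> \<Lambda>"
      using \<Omega>(1) nn lin V(3) by unfold_locales (auto simp: linear_on_space_def)
    then obtain \<mu> where \<mu>: "radon_measure_on \<Omega> \<mu>" "\<And>\<phi>. \<phi> \<in> test_functions \<Omega> \<Longrightarrow> \<Lambda> \<phi> = (LINT x|\<mu>. \<phi> x)"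
      and null: "\<And>U. open U \<Longrightarrow> U \<subseteq> \<Omega> \<Longrightarrow>
        (\<And>\<eta>. \<eta> \<in> test_functions U \<Longrightarrow> (\<And>x. 0 \<le> \<eta> x) \<Longrightarrow> \<Lambda> \<eta> = 0) \<Longrightarrow> AE x in \<mu>. x \<notin> U"
      by (rule positive_functional.riesz_representation) blast
    define N where "N = \<Omega> \<inter> (\<lambda>x. u x - obst x) -` {0<..}"
    have N: "open N" "N \<subseteq> \<Omega>"
      unfolding N_def using cont \<Omega>(1) by (auto intro!: continuous_open_preimage continuous_on_diff)
    have "AE x in \<mu>. x \<notin> N"
    proof (rule null[OF N])
      fix \<eta> assume \<eta>: "\<eta> \<in> test_functions N" "\<And>x. 0 \<le> \<eta> x"
      then have \<eta>\<Omega>: "\<eta> \<in> test_functions \<Omega>" using test_functions_mono[OF N(2)] by blast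
      obtain K where K: "compact K" "K \<subseteq> N" "\<And>x. x \<notin> K \<Longrightarrow> \<eta> x = 0"
        using test_functions_support[OF \<eta>(1)] by blast
      obtain C where C: "\<And>x. \<bar>\<eta> x\<bar> \<le> C" "C \<ge> 0" using test_functions_bounded[OF \<eta>(1)] by blast
      \<comment> \<open>The minimum of \<open>u x - obst x\<close> over the compact support,
        positive because K lies in N; for empty K any positive number will do.\<close>
      obtain \<delta> where \<delta>: "\<delta> > 0" "\<And>x. x \<in> K \<Longrightarrow> \<delta> \<le> u x - obst x"
      proof (cases "K = {}")
        case False
        have "continuous_on K (\<lambda>x. u x - obst x)"
          using cont K(2) N(2) by (intro continuous_on_diff) (auto intro: continuous_on_subset)
        then obtain x0 where "x0 \<in> K" "\<forall>y\<in>K. u x0 - obst x0 \<le> u y - obst y"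
          using continuous_attains_inf[OF K(1) False] by blast
        then show ?thesis using K(2) by (intro that[of "u x0 - obst x0"]) (auto simp: N_def)
      qed (use that[of 1] in auto)
      \<comment> \<open>Chosen so that \<open>t * \<eta> x\<close> never exceeds \<delta>;
        subtracting it from u then keeps u above the obstacle on K and changes nothing elsewhere.
        The summand 1 covers C = 0.\<close>
      define t where "t = \<delta> / (C + 1)"
      have t: "t > 0" using \<delta> C by (simp add: t_def)
      have small: "t * \<eta> x \<le> \<delta>" for x
      proof -
        have "t * \<eta> x \<le> t * (C + 1)" using t C(1)[of x] by (intro mult_left_mono) auto
        then show ?thesis using C(2) by (simp add: t_def)
      qed
      have t\<eta>: "(\<lambda>x. (- t) * \<eta> x) \<in> ?V" using V(2)[OF V(3)[OF \<eta>\<Omega>]] .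
      have "AE x in lebesgue_on \<Omega>. obst x \<le> u x + (- t) * \<eta> x"
        using ob
      proof eventually_elim
        case (elim x)
        then show ?case using \<delta>(2)[of x] small[of x] K(3)[of x] by (cases "x \<in> K") auto
      qed
      then have "(\<lambda>x. u x + (- t) * \<eta> x) \<in> K_set \<iota> s \<Omega> obst"
        using V(1)[OF u t\<eta>] by (simp add: K_set_def)
      from VI[OF this] have "\<Lambda> (\<lambda>x. t * \<eta> x) \<le> 0" by simp
      moreover have "\<Lambda> (\<lambda>x. t * \<eta> x) = t * \<Lambda> \<eta>"
        using lin V(3)[OF \<eta>\<Omega>] unfolding linear_on_space_def by blast
      ultimately have "\<Lambda> \<eta> \<le> 0" using t by (simp add: mult_le_0_iff)
      moreover have "0 \<le> \<Lambda> \<eta>" using nn \<eta>\<Omega> \<eta>(2) unfolding nonneg_distribution_def by blast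
      ultimately show "\<Lambda> \<eta> = 0" by simp
    qed
    moreover have "space \<mu> = \<Omega>"
      using \<mu>(1) sets_eq_imp_space_eq[of \<mu> "restrict_space borel \<Omega>"]
      by (simp add: radon_measure_on_def space_restrict_space)
    ultimately have "AE x in \<mu>. x \<notin> N \<and> x \<in> \<Omega>"
      using AE_space[of \<mu>] by auto
    \<comment> \<open>Off N the difference is at most 0, and the pointwise obstacle inequality makes
      it at least 0.\<close>
    then have "AE x in \<mu>. u x - obst x = 0"
      by (rule eventually_mono) (use ob_le in \<open>force simp: N_def\<close>)
    then have "(LINT x|\<mu>. (u x - obst x) * \<phi> x) = 0" for \<phi>
      by (intro integral_eq_zero_AE) (auto elim: eventually_mono)
    then show "product_vanishes \<Omega> \<Lambda> (\<lambda>x. u x - obst x)"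
      unfolding product_vanishes_def using \<mu> by blast
  qed
  then show ?thesis using dual nonneg by blast
qed

end
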